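(* Let $\ell$ be an odd prime, $(V,\omega)$ a finite-dimensional symplectic $\mathbb{F}_\ell$-vector space, and $g\in\mathrm{Sp}(V)$ semisimple with characteristic polynomial $f$. Write $f(t)=(t+1)^a(t-1)^b\bar f(t)$ with $\bar f$ having no factor $t+1$ or $t-1$, and let $n_{-1}$ be the dimension of the $-1$-eigenspace of $g$. Then \[\operatorname{tr}(g\mid\mathfrak{H}(V))=\left(\frac{(-1)^{n_{-1}/2}(-1)^{(\deg\bar f)/2}\bar f(1)}{\ell}\right)\sqrt{|V^g|},\] where $V^g$ is the set of $g$-fixed vectors and $\left(\frac{\cdot}{\ell}\right)$ is the Legendre symbol.
   Context: Fix a primitive $\ell$-th root of unity $\zeta\in\mathbb{C}$, $\psi(z)=\zeta^z$. $H(V)=\mathbb{F}_\ell\times V$ with $(\lambda,a)(\mu,b)=(\lambda+\mu+\tfrac12\omega(a,b),a+b)$; $\mathrm{Sp}(V)$ acts by $(z,v)\mapsto(z,gv)$. An oriented Lagrangian $M^\circ=(M,o_M)$ is a Lagrangian $M$ with $0\ne o_M\in\bigwedge^{top}M$. $C_{M^\circ}$: functions $f:H(V)\to\mathbb{C}$ with $f((z,0)h)=\psi(z)f(h)$, $f((0,m)h)=f(h)$ ($m\in M$); it is the unique irreducible representation of $H(V)$ (right translation) with central character $\psi$. For oriented Lagrangians $M^\circ,L^\circ$: $I=M\cap L$, $n_I=\dim(I^\perp/I)/2$, $o_M=\iota_M\otimes o_{M/I}$, $o_L=\iota_L\otimes o_{L/I}$ ($\iota_M,\iota_L\in\bigwedge^{top}I$),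 $\omega_\wedge:\bigwedge^{top}(L/I)\times\bigwedge^{top}(M/I)\to\mathbb{F}_\ell$ induced by $\omega$, $G(\alpha,\ell)=\sum_{z}\psi(\alpha z^2)$, $A_{M^\circ,L^\circ}=(G(\tfrac12,\ell)/\ell)^{n_I}\left(\frac{(-1)^{\binom{n_I}{2}}(\iota_L/\iota_M)\omega_\wedge(o_{L/I},o_{M/I})}{\ell}\right)$, $F_{M^\circ,L^\circ}:C_{L^\circ}\to C_{M^\circ}$, $F[f](v)=\sum_{m+I\in M/I}f((0,m)v)$, $T_{M^\circ,L^\circ}=A_{M^\circ,L^\circ}F_{M^\circ,L^\circ}$. For $g\in\mathrm{Sp}(V)$, $gM^\circ=(gM,g(o_M))$ and $g$ acts on $C_{M^\circ}$ by $\phi\mapsto T_{M^\circ,gM^\circ}(\phi\circ g^{-1})$; $\operatorname{tr}(g\mid\mathfrak{H}(V))$ is the trace of this operator (independent of $M^\circ$). *)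

theory Defs
  imports
    "HOL-Library.Function_Algebras"
    "HOL-Number_Theory.Number_Theory"
    "Jordan_Normal_Form.Char_Poly"
    "Berlekamp_Zassenhaus.Finite_Field"
begin

text \<open>
  The prime field with \<open>\<ell>\<close> elements is the type \<open>'p mod_ring\<close> with \<open>'p :: prime_card\<close>, so that
  \<open>\<ell> = CARD('p)\<close>.
\<close>

section \<open>Endomorphisms of vector spaces\<close>

text \<open>
  A plain copy of the locale \<open>vector_space\<close>, to keep the definitions below out of the type-class
  interpretations of that locale.
\<close>

locale linear_space = vector_space scale
  for scale :: "'a::field \<Rightarrow> 'b::ab_group_add \<Rightarrow> 'b"
begin

definition ordered_basis :: "'b set \<Rightarrow> 'b list \<Rightarrow> bool" where
  "ordered_basis W bs \<longleftrightarrow> distinct bs \<and> independent (set bs) \<and> span (set bs) = W"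

definition endo_mat :: "'b list \<Rightarrow> ('b \<Rightarrow> 'b) \<Rightarrow> 'a mat" where
  "endo_mat bs T = mat (length bs) (length bs)
     (\<lambda>(i, j). representation (set bs) (T (bs ! j)) (bs ! i))"

text \<open>
  Trace and characteristic polynomial of an endomorphism of a finite-dimensional subspace \<open>W\<close>,
  computed in an arbitrary basis of \<open>W\<close>.
\<close>

definition endo_trace :: "'b set \<Rightarrow> ('b \<Rightarrow> 'b) \<Rightarrow> 'a" where
  "endo_trace W T =
     (let A = endo_mat (SOME bs. ordered_basis W bs) T in \<Sum>i<dim_row A. A $$ (i, i))"

definition endo_char_poly :: "'b set \<Rightarrow> ('b \<Rightarrow> 'b) \<Rightarrow> 'a poly" where
  "endo_char_poly W T = char_poly (endo_mat (SOME bs. ordered_basis W bs) T)"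

definition semisimple_endo :: "('b \<Rightarrow> 'b) \<Rightarrow> bool" where
  "semisimple_endo g \<longleftrightarrow>
     (\<forall>U. subspace U \<and> g ` U \<subseteq> U \<longrightarrow>
        (\<exists>W. subspace W \<and> g ` W \<subseteq> W \<and> U \<inter> W = {0} \<and> (\<forall>v. \<exists>u\<in>U. \<exists>w\<in>W. v = u + w)))"

end

text \<open>The vector space of all functions from a type to a field, with pointwise operations.\<close>

definition fscale :: "'k::field \<Rightarrow> ('x \<Rightarrow> 'k) \<Rightarrow> 'x \<Rightarrow> 'k" where
  "fscale c f = (\<lambda>x. c * f x)"

interpretation fun_vs: linear_space "fscale :: 'k::field \<Rightarrow> ('x \<Rightarrow> 'k) \<Rightarrow> 'x \<Rightarrow> 'k"
  by unfold_locales (auto simp: fscale_def fun_eq_iff algebra_simps)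

definition coset :: "'b::ab_group_add set \<Rightarrow> 'b \<Rightarrow> 'b set" where
  "coset R x = {x + r |r. r \<in> R}"


section \<open>Exterior powers of subquotients\<close>

text \<open>
  For subspaces \<open>I \<subseteq> M\<close>, the exterior power \<open>\<And>\<^sup>k(M/I)\<close> is presented as the free vector space on
  \<open>k\<close>-tuples (lists) of elements of \<open>M\<close>, modulo multilinearity, vanishing of tuples with a repeated
  entry, and vanishing of tuples with an entry in \<open>I\<close>. Its elements are cosets; the zero element is
  the coset \<open>ext_rel k M I\<close>. The choice \<open>I = {0}\<close> gives \<open>\<And>\<^sup>k M\<close>.
\<close>

definition gen :: "'v list \<Rightarrow> 'v list \<Rightarrow> 'k::field" where
  "gen xs = (\<lambda>ys. if ys = xs then 1 else 0)"

text \<open>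
  Product on the tensor algebra: the bilinear extension of concatenation, i.e.\ \<open>gen xs\<close> and \<open>gen ys\<close>
  are sent to \<open>gen (xs @ ys)\<close>.
\<close>

definition conv :: "('v list \<Rightarrow> 'k::field) \<Rightarrow> ('v list \<Rightarrow> 'k) \<Rightarrow> 'v list \<Rightarrow> 'k" where
  "conv x y = (\<lambda>zs. \<Sum>j\<le>length zs. x (take j zs) * y (drop j zs))"

type_synonym ('k, 'v) ext = "('v list \<Rightarrow> 'k) set"

context linear_space
begin

definition ext_relators :: "nat \<Rightarrow> 'b set \<Rightarrow> 'b set \<Rightarrow> ('b list \<Rightarrow> 'a) set" where
  "ext_relators k M I =
     {gen (xs @ [u + v] @ ys) - gen (xs @ [u] @ ys) - gen (xs @ [v] @ ys) |xs u v ys.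
        set xs \<union> {u, v} \<union> set ys \<subseteq> M \<and> length xs + 1 + length ys = k}
     \<union> {gen (xs @ [scale c u] @ ys) - fscale c (gen (xs @ [u] @ ys)) |xs c u ys.
        set xs \<union> {u} \<union> set ys \<subseteq> M \<and> length xs + 1 + length ys = k}
     \<union> {gen xs |xs. set xs \<subseteq> M \<and> length xs = k \<and> \<not> distinct xs}
     \<union> {gen xs |xs. set xs \<subseteq> M \<and> length xs = k \<and> set xs \<inter> I \<noteq> {}}"

definition ext_rel :: "nat \<Rightarrow> 'b set \<Rightarrow> 'b set \<Rightarrow> ('b list \<Rightarrow> 'a) set" where
  "ext_rel k M I = fun_vs.span (ext_relators k M I)"

definition ext_power :: "nat \<Rightarrow> 'b set \<Rightarrow> 'b set \<Rightarrow> ('a, 'b) ext set" where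
  "ext_power k M I =
     coset (ext_rel k M I) ` fun_vs.span {gen xs |xs. set xs \<subseteq> M \<and> length xs = k}"

definition top_deg :: "'b set \<Rightarrow> 'b set \<Rightarrow> nat" where
  "top_deg M I = dim M - dim I"

definition top_rel :: "'b set \<Rightarrow> 'b set \<Rightarrow> ('b list \<Rightarrow> 'a) set" where
  "top_rel M I = ext_rel (top_deg M I) M I"

definition top_ext :: "'b set \<Rightarrow> 'b set \<Rightarrow> ('a, 'b) ext set" where
  "top_ext M I = ext_power (top_deg M I) M I"

definition top_scale :: "'b set \<Rightarrow> 'a \<Rightarrow> ('a, 'b) ext \<Rightarrow> ('a, 'b) ext" where
  "top_scale M c X = (\<Union>x\<in>X. coset (top_rel M {0}) (fscale c x))"

text \<open>For \<open>Y\<close> nonzero in the line \<open>\<And>\<^sup>t\<^sup>o\<^sup>p M\<close>, the scalar \<open>X / Y\<close>.\<close>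

definition top_ratio :: "'b set \<Rightarrow> ('a, 'b) ext \<Rightarrow> ('a, 'b) ext \<Rightarrow> 'a" where
  "top_ratio M X Y = (THE c. X = top_scale M c Y)"

text \<open>
  The canonical isomorphism from \<open>\<And>\<^sup>t\<^sup>o\<^sup>p I \<otimes> \<And>\<^sup>t\<^sup>o\<^sup>p(M/I)\<close> to \<open>\<And>\<^sup>t\<^sup>o\<^sup>p M\<close>, which takes the pair of
  \<open>i\<^sub>1 \<and> \<dots> \<and> i\<^sub>k\<close> and \<open>m\<^sub>1 \<and> \<dots> \<and> m\<^sub>n\<close> to \<open>i\<^sub>1 \<and> \<dots> \<and> i\<^sub>k \<and> m\<^sub>1 \<and> \<dots> \<and> m\<^sub>n\<close>. The union
  below consists of equal cosets.
\<close>

definition top_mult :: "'b set \<Rightarrow> ('a, 'b) ext \<Rightarrow> ('a, 'b) ext \<Rightarrow> ('a, 'b) ext" where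
  "top_mult M X Y = (\<Union>x\<in>X. \<Union>y\<in>Y. coset (top_rel M {0}) (conv x y))"

definition top_decomp :: "'b set \<Rightarrow> 'b set \<Rightarrow> ('a, 'b) ext \<Rightarrow> ('a, 'b) ext \<times> ('a, 'b) ext" where
  "top_decomp M I X =
     (SOME (x, y). x \<in> top_ext I {0} \<and> y \<in> top_ext M I \<and> X = top_mult M x y)"

end

text \<open>The image under an invertible \<open>g\<close>: \<open>gen xs\<close> is sent to \<open>gen (map g xs)\<close>.\<close>

definition ext_map :: "('v \<Rightarrow> 'v) \<Rightarrow> ('k, 'v) ext \<Rightarrow> ('k, 'v) ext" where
  "ext_map g X = (\<lambda>x. x \<circ> map (inv_into UNIV g)) ` X"


section \<open>Symplectic spaces and oriented Lagrangians\<close>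

locale symplectic_space = linear_space scale
  for scale :: "'p::prime_card mod_ring \<Rightarrow> 'v::ab_group_add \<Rightarrow> 'v" +
  fixes \<omega> :: "'v \<Rightarrow> 'v \<Rightarrow> 'p mod_ring"
  assumes finite_dim: "\<exists>B. finite B \<and> span B = UNIV"
    and linear_right: "\<And>u. Vector_Spaces.linear scale (*) (\<lambda>v. \<omega> u v)"
    and linear_left: "\<And>v. Vector_Spaces.linear scale (*) (\<lambda>u. \<omega> u v)"
    and alternating: "\<And>v. \<omega> v v = 0"
    and nondegenerate: "\<And>u. (\<And>v. \<omega> u v = 0) \<Longrightarrow> u = 0"
begin

definition Sp :: "('v \<Rightarrow> 'v) set" where
  "Sp = {g. Vector_Spaces.linear scale scale g \<and> bij g \<and> (\<forall>u v. \<omega> (g u) (g v) = \<omega> u v)}"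

definition perp :: "'v set \<Rightarrow> 'v set" where
  "perp U = {v. \<forall>u\<in>U. \<omega> v u = 0}"

definition lagrangian :: "'v set \<Rightarrow> bool" where
  "lagrangian M \<longleftrightarrow> subspace M \<and> perp M = M"

definition oriented_lagrangian :: "'v set \<times> ('p mod_ring, 'v) ext \<Rightarrow> bool" where
  "oriented_lagrangian = (\<lambda>(M, oM).
     lagrangian M \<and> oM \<in> top_ext M {0} \<and> oM \<noteq> top_rel M {0})"

definition act_orient ::
  "('v \<Rightarrow> 'v) \<Rightarrow> 'v set \<times> ('p mod_ring, 'v) ext \<Rightarrow> 'v set \<times> ('p mod_ring, 'v) ext" where
  "act_orient g = (\<lambda>(M, oM). (g ` M, ext_map g oM))"

text \<open>
  The pairing \<open>\<omega>\<^sub>\<and>\<close> of \<open>\<And>\<^sup>n(L/I)\<close> with \<open>\<And>\<^sup>n(M/I)\<close> induced by \<open>\<omega>\<close>. It contracts adjacent factors of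
  \<open>l\<^sub>1 \<and> \<dots> \<and> l\<^sub>n \<otimes> m\<^sub>1 \<and> \<dots> \<and> m\<^sub>n\<close> from the inside out, so that \<open>l\<^sub>n\<close> meets \<open>m\<^sub>1\<close>: the value is
  the determinant of the matrix of all \<open>\<omega>(l\<^sub>i, m\<^sub>n\<^sub>+\<^sub>1\<^sub>-\<^sub>j)\<close>, which is \<open>(-1)^(n choose 2)\<close> times the
  determinant of the matrix of all \<open>\<omega>(l\<^sub>i, m\<^sub>j)\<close>. With the opposite convention, the sign
  \<open>(-1)^(n choose 2)\<close> in the coefficients \<open>A\<close> below would be wrong: for \<open>\<ell> = 3\<close> and \<open>dim V = 4\<close>, the
  element \<open>g\<close> that is \<open>1\<close> on one hyperbolic plane and \<open>-1\<close> on the orthogonal one would get trace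
  \<open>3\<close> on \<open>C_M\<close> if \<open>M \<inter> g M = {0}\<close>, but trace \<open>-3\<close> if \<open>g M = M\<close>.
\<close>

definition omega_wedge :: "nat \<Rightarrow> ('p mod_ring, 'v) ext \<Rightarrow> ('p mod_ring, 'v) ext \<Rightarrow> 'p mod_ring" where
  "omega_wedge n X Y =
     (let x = (SOME x. x \<in> X); y = (SOME y. y \<in> Y) in
      \<Sum>ls | x ls \<noteq> 0. \<Sum>ms | y ms \<noteq> 0.
        x ls * y ms * det (mat n n (\<lambda>(i, j). \<omega> (ls ! i) (ms ! (n - 1 - j)))))"

end


section \<open>The Heisenberg group and the Weil representation\<close>

definition legendre :: "'p::prime_card mod_ring \<Rightarrow> int" where
  "legendre x = Legendre (to_int_mod_ring x) (int CARD('p))"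

locale weil_setting = symplectic_space scale \<omega>
  for scale :: "'p::prime_card mod_ring \<Rightarrow> 'v::ab_group_add \<Rightarrow> 'v"
    and \<omega> :: "'v \<Rightarrow> 'v \<Rightarrow> 'p mod_ring" +
  fixes \<zeta> :: complex
  assumes odd_card: "odd CARD('p)"
    and root_of_unity: "\<zeta> ^ CARD('p) = 1"
    and primitive: "\<And>k. 0 < k \<Longrightarrow> k < CARD('p) \<Longrightarrow> \<zeta> ^ k \<noteq> 1"
begin

definition \<psi> :: "'p mod_ring \<Rightarrow> complex" where
  "\<psi> z = \<zeta> ^ nat (to_int_mod_ring z)"

definition gauss :: "'p mod_ring \<Rightarrow> complex" where
  "gauss \<alpha> = (\<Sum>z\<in>UNIV. \<psi> (\<alpha> * z ^ 2))"

definition hmult :: "'p mod_ring \<times> 'v \<Rightarrow> 'p mod_ring \<times> 'v \<Rightarrow> 'p mod_ring \<times> 'v" where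
  "hmult = (\<lambda>(z, a) (w, b). (z + w + 1 / 2 * \<omega> a b, a + b))"

definition C_space ::
  "'v set \<times> ('p mod_ring, 'v) ext \<Rightarrow> ('p mod_ring \<times> 'v \<Rightarrow> complex) set" where
  "C_space = (\<lambda>(M, oM). {f.
     (\<forall>z h. f (hmult (z, 0) h) = \<psi> z * f h) \<and>
     (\<forall>m\<in>M. \<forall>h. f (hmult (0, m) h) = f h)})"

text \<open>The sum ranges over \<open>M/I\<close>; for \<open>f \<in> C_L\<close> it does not depend on the representatives.\<close>

definition F_op ::
  "'v set \<times> ('p mod_ring, 'v) ext \<Rightarrow> 'v set \<times> ('p mod_ring, 'v) ext \<Rightarrow>
   ('p mod_ring \<times> 'v \<Rightarrow> complex) \<Rightarrow> 'p mod_ring \<times> 'v \<Rightarrow> complex" where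
  "F_op = (\<lambda>(M, oM) (L, oL) f h.
     \<Sum>X\<in>coset (M \<inter> L) ` M. f (hmult (0, SOME m. m \<in> X) h))"

text \<open>
  The value does not depend on the chosen decompositions of the orientations, since rescaling one
  multiplies the argument of the Legendre symbol by a nonzero square.
\<close>

definition A_coeff ::
  "'v set \<times> ('p mod_ring, 'v) ext \<Rightarrow> 'v set \<times> ('p mod_ring, 'v) ext \<Rightarrow> complex" where
  "A_coeff = (\<lambda>(M, oM) (L, oL).
     let I = M \<inter> L;
         n = (dim (perp I) - dim I) div 2;
         (iM, oMI) = top_decomp M I oM;
         (iL, oLI) = top_decomp L I oL
     in (gauss (1 / 2) / of_nat CARD('p)) ^ n *
        of_int (legendre ((- 1) ^ (n choose 2) * top_ratio I iL iM * omega_wedge n oLI oMI)))"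

definition T_op ::
  "'v set \<times> ('p mod_ring, 'v) ext \<Rightarrow> 'v set \<times> ('p mod_ring, 'v) ext \<Rightarrow>
   ('p mod_ring \<times> 'v \<Rightarrow> complex) \<Rightarrow> 'p mod_ring \<times> 'v \<Rightarrow> complex" where
  "T_op Mo Lo f = fscale (A_coeff Mo Lo) (F_op Mo Lo f)"

definition weil_op ::
  "'v set \<times> ('p mod_ring, 'v) ext \<Rightarrow> ('v \<Rightarrow> 'v) \<Rightarrow>
   ('p mod_ring \<times> 'v \<Rightarrow> complex) \<Rightarrow> 'p mod_ring \<times> 'v \<Rightarrow> complex" where
  "weil_op Mo g \<phi> = T_op Mo (act_orient g Mo) (\<phi> \<circ> (\<lambda>(z, v). (z, inv_into UNIV g v)))"

definition weil_trace :: "'v set \<times> ('p mod_ring, 'v) ext \<Rightarrow> ('v \<Rightarrow> 'v) \<Rightarrow> complex" where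
  "weil_trace Mo g = fun_vs.endo_trace (C_space Mo) (weil_op Mo g)"

end

end

theory Submission
  imports Defs
begin

text \<open>
  Write \<open>\<beta>(x, y) = \<omega>(g x - x, y)\<close> and \<open>X = {x. g x - x \<in> M}\<close>, on which \<open>\<beta>\<close> is symmetric. Summing the diagonal
  coefficients of the operator on \<open>C\<^sub>M\<close> expresses the trace as a multiple of the Gauss sum of the quadratic
  form \<open>\<beta>(x, x) / 2\<close> on \<open>X\<close>, hence, up to powers of \<open>\<ell>\<close> and of \<open>(-1 / \<ell>)\<close>, as the Legendre symbol of the
  discriminant of \<open>\<beta>\<close> on \<open>X\<close> times that of the argument in the coefficient \<open>A\<close>. In a basis of \<open>V\<close> modulo
  \<open>V\<^sup>g\<close> adapted to \<open>M \<inter> g\<^sup>-\<^sup>1M\<close>, \<open>M\<close> and \<open>X\<close>, the Gram matrix of \<open>\<beta>\<close> is block triangular after a permutation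
  of its columns, and its determinant is the product of exactly these two quantities with a square.
  Semisimplicity gives \<open>V = V\<^sup>g \<oplus> (g - 1)V\<close>, so the same determinant is, up to squares,
  \<open>det (g - 1)\<close> on \<open>(g - 1)V\<close>, because the Gram determinant of a symplectic form is a square. This is
  the value at \<open>1\<close> of the characteristic polynomial of \<open>g\<close> on \<open>(g - 1)V\<close>.
\<close>

section \<open>Bases modulo a subspace\<close>

text \<open>The obstacle is that \<open>M\<close> and gM may meet in any dimension. Both the
  discriminant on \<open>X\<close> and the argument of the symbol in the coefficient then vary with
  \<open>M\<close>, and only their combination depends on \<open>g\<close> alone. As \<beta> need
  not be symmetric on all of \<open>V\<close>, it is the Gram determinant on \<open>V\<close> modulo
  \<open>V1\<close>, meaningful without symmetry, that ties the two together. Quotients are never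
  formed: a basis of W/K is a list of vectors of W, flags are concatenated lists, and determinants
  are those of matrices indexed by lists. The coefficient and the sum over \<open>X\<close> together
  contain an even number of factors \<open>gauss (1 / 2)\<close>, whose square is (-1 / l) l for the
  field size l. The resulting power of (-1 / l) joins the sign of the column permutation to give
  (-1)^(dim U / 2), where dim U is n_(-1) + deg fbar. The eigenvalue -1 is set apart because g - 1
  acts there as -2: it contributes to det (g - 1) a power of 2 with even exponent, hence a square,
  and stays visible only in that sign.\<close>

context linear_space
begin

definition lin_comb :: "'b list \<Rightarrow> (nat \<Rightarrow> 'a) \<Rightarrow> 'b" where
  "lin_comb bs c = (\<Sum>j<length bs. scale (c j) (bs ! j))"

text \<open>A basis of W/K given by representatives. Independence concerns only coefficients below
  \<open>length bs\<close>, since \<open>lin_comb\<close> ignores all others. For K = {0} this is an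
  ordered basis of W.\<close>

definition basis_mod :: "'b set \<Rightarrow> 'b list \<Rightarrow> 'b set \<Rightarrow> bool" where
  "basis_mod K bs W \<longleftrightarrow> subspace K \<and> W = {k + lin_comb bs c |k c. k \<in> K} \<and>
     (\<forall>c. lin_comb bs c \<in> K \<longrightarrow> (\<forall>j<length bs. c j = 0))"

text \<open>Only the values \<open>coord K bs x j\<close> with \<open>x \<in> W\<close> and \<open>j < length bs\<close> are meaningful.\<close>

definition coord :: "'b set \<Rightarrow> 'b list \<Rightarrow> 'b \<Rightarrow> nat \<Rightarrow> 'a" where
  "coord K bs x = (SOME c. x - lin_comb bs c \<in> K)"

definition coord_mat :: "'b set \<Rightarrow> 'b list \<Rightarrow> 'b list \<Rightarrow> 'a mat" where
  "coord_mat K bs xs = mat (length xs) (length bs) (\<lambda>(i, j). coord K bs (xs ! i) j)"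

text \<open>For lists of equal length, the factor between the wedge of \<open>xs\<close> and the
  wedge of \<open>bs\<close> in the top exterior power of W/K.\<close>

definition coord_det :: "'b set \<Rightarrow> 'b list \<Rightarrow> 'b list \<Rightarrow> 'a" where
  "coord_det K bs xs = det (coord_mat K bs xs)"

lemma lin_comb_Nil: "lin_comb [] c = 0"
  by (simp add: lin_comb_def)

lemma lin_comb_add: "lin_comb bs (\<lambda>j. c j + d j) = lin_comb bs c + lin_comb bs d"
  by (simp add: lin_comb_def scale_left_distrib sum.distrib)

lemma lin_comb_scale: "lin_comb bs (\<lambda>j. a * c j) = scale a (lin_comb bs c)"
  by (simp add: lin_comb_def scale_sum_right)

lemma lin_comb_diff: "lin_comb bs (\<lambda>j. c j - d j) = lin_comb bs c - lin_comb bs d"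
  by (simp add: lin_comb_def scale_left_diff_distrib sum_subtractf)

lemma lin_comb_zero: "lin_comb bs (\<lambda>j. 0) = 0"
  by (simp add: lin_comb_def)

lemma lin_comb_cong: "(\<And>j. j < length bs \<Longrightarrow> c j = d j) \<Longrightarrow> lin_comb bs c = lin_comb bs d"
  by (auto simp: lin_comb_def intro!: sum.cong)

lemma lin_comb_append:
  "lin_comb (as @ bs) c = lin_comb as c + lin_comb bs (\<lambda>j. c (length as + j))"
proof -
  have "lin_comb (as @ bs) c = (\<Sum>j<length as + length bs. scale (c j) ((as @ bs) ! j))"
    by (simp add: lin_comb_def)
  also have "\<dots> = (\<Sum>j<length as. scale (c j) ((as @ bs) ! j)) +
      (\<Sum>j<length bs. scale (c (length as + j)) ((as @ bs) ! (length as + j)))"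
    by (induction ("length bs")) (auto simp: add.assoc)
  also have "\<dots> = lin_comb as c + lin_comb bs (\<lambda>j. c (length as + j))"
    by (simp add: lin_comb_def nth_append)
  finally show ?thesis .
qed

lemma lin_comb_append_case:
  "lin_comb (as @ bs) (\<lambda>j. if j < length as then c j else d (j - length as)) =
     lin_comb as c + lin_comb bs d"
  by (auto simp: lin_comb_append intro!: arg_cong2[where f="(+)"] lin_comb_cong)

lemma lin_comb_unit: "i < length bs \<Longrightarrow> lin_comb bs (\<lambda>j. if j = i then 1 else 0) = bs ! i"
  by (simp add: lin_comb_def if_distrib[of "\<lambda>c. scale c _"] sum.delta' cong: if_cong)

lemma lin_comb_single: "lin_comb [w] c = scale (c 0) w"
  by (simp add: lin_comb_def)

lemma lin_comb_in_subspace: "subspace W \<Longrightarrow> set bs \<subseteq> W \<Longrightarrow> lin_comb bs c \<in> W"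
  unfolding lin_comb_def by (intro subspace_sum subspace_scale) auto

lemma basis_mod_subspace: "basis_mod K bs W \<Longrightarrow> subspace K"
  by (simp add: basis_mod_def)

lemma basis_modD: "basis_mod K bs W \<Longrightarrow> lin_comb bs c \<in> K \<Longrightarrow> j < length bs \<Longrightarrow> c j = 0"
  by (simp add: basis_mod_def)

lemma basis_mod_elim:
  assumes "basis_mod K bs W" "x \<in> W"
  obtains k c where "k \<in> K" "x = k + lin_comb bs c"
  using assms by (auto simp: basis_mod_def)

lemma basis_mod_memI: "basis_mod K bs W \<Longrightarrow> k \<in> K \<Longrightarrow> k + lin_comb bs c \<in> W"
  by (auto simp: basis_mod_def)

lemma basis_mod_lin_comb: "basis_mod K bs W \<Longrightarrow> lin_comb bs c \<in> W"
  using basis_mod_memI[of K bs W 0 c] by (simp add: basis_mod_def subspace_0)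

lemma basis_mod_set: "basis_mod K bs W \<Longrightarrow> set bs \<subseteq> W"
  by (metis basis_mod_lin_comb in_set_conv_nth lin_comb_unit subsetI)

lemma basis_mod_subset: "basis_mod K bs W \<Longrightarrow> K \<subseteq> W"
  using basis_mod_memI[of K bs W _ "\<lambda>j. 0"] by (auto simp: lin_comb_zero)

lemma basis_mod_subspace':
  assumes B: "basis_mod K bs W" shows "subspace W"
proof (rule subspaceI)
  note K = basis_mod_subspace[OF B]
  show "0 \<in> W" using basis_mod_subset[OF B] subspace_0[OF K] by auto
  fix x y assume "x \<in> W" "y \<in> W"
  then obtain k c l d where "k \<in> K" "x = k + lin_comb bs c" "l \<in> K" "y = l + lin_comb bs d"
    by (metis basis_mod_elim[OF B])
  then have "x + y = (k + l) + lin_comb bs (\<lambda>j. c j + d j)" "k + l \<in> K"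
    by (auto simp: lin_comb_add subspace_add[OF K])
  then show "x + y \<in> W" using basis_mod_memI[OF B] by metis
next
  note K = basis_mod_subspace[OF B]
  fix a x assume "x \<in> W"
  then obtain k c where "k \<in> K" "x = k + lin_comb bs c"
    by (metis basis_mod_elim[OF B])
  then have "scale a x = scale a k + lin_comb bs (\<lambda>j. a * c j)" "scale a k \<in> K"
    by (auto simp: lin_comb_scale scale_right_distrib subspace_scale[OF K])
  then show "scale a x \<in> W" using basis_mod_memI[OF B] by metis
qed

lemma coord_ex:
  assumes "basis_mod K bs W" "x \<in> W"
  shows "x - lin_comb bs (coord K bs x) \<in> K"
proof -
  obtain k c where "k \<in> K" "x = k + lin_comb bs c" using assms by (rule basis_mod_elim)
  then have "x - lin_comb bs c \<in> K" by simp
  then show ?thesis unfolding coord_def by (rule someI[where P="\<lambda>c. x - lin_comb bs c \<in> K"])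
qed

lemma coord_eq:
  assumes B: "basis_mod K bs W" and x: "x - lin_comb bs c \<in> K" and j: "j < length bs"
  shows "coord K bs x j = c j"
proof -
  have K: "subspace K" using B by (rule basis_mod_subspace)
  have "x - lin_comb bs (coord K bs x) \<in> K"
    unfolding coord_def using x by (rule someI[where P="\<lambda>c. x - lin_comb bs c \<in> K"])
  then have "(x - lin_comb bs c) - (x - lin_comb bs (coord K bs x)) \<in> K"
    using x subspace_diff[OF K] by blast
  then have "lin_comb bs (\<lambda>j. coord K bs x j - c j) \<in> K" by (simp add: lin_comb_diff)
  from basis_modD[OF B this j] show ?thesis by simp
qed

lemma coord_add:
  assumes B: "basis_mod K bs W" and x: "x \<in> W" and y: "y \<in> W" and j: "j < length bs"
  shows "coord K bs (x + y) j = coord K bs x j + coord K bs y j"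
proof -
  have K: "subspace K" using B by (rule basis_mod_subspace)
  have "(x - lin_comb bs (coord K bs x)) + (y - lin_comb bs (coord K bs y)) \<in> K"
    using coord_ex[OF B x] coord_ex[OF B y] subspace_add[OF K] by blast
  then have "x + y - lin_comb bs (\<lambda>j. coord K bs x j + coord K bs y j) \<in> K"
    by (simp add: lin_comb_add algebra_simps)
  from coord_eq[OF B this j] show ?thesis .
qed

lemma coord_scale:
  assumes B: "basis_mod K bs W" and x: "x \<in> W" and j: "j < length bs"
  shows "coord K bs (scale a x) j = a * coord K bs x j"
proof -
  have K: "subspace K" using B by (rule basis_mod_subspace)
  have "scale a (x - lin_comb bs (coord K bs x)) \<in> K"
    using coord_ex[OF B x] subspace_scale[OF K] by blast
  then have "scale a x - lin_comb bs (\<lambda>j. a * coord K bs x j) \<in> K"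
    by (simp add: lin_comb_scale scale_right_diff_distrib)
  from coord_eq[OF B this j] show ?thesis .
qed

lemma coord_zero:
  assumes B: "basis_mod K bs W" and x: "x \<in> K" and j: "j < length bs"
  shows "coord K bs x j = 0"
proof -
  have "x - lin_comb bs (\<lambda>j. 0) \<in> K" using x by (simp add: lin_comb_zero)
  from coord_eq[OF B this j] show ?thesis .
qed

lemma coord_lin_comb:
  assumes B: "basis_mod K bs W" and k: "k \<in> K" and j: "j < length bs"
  shows "coord K bs (k + lin_comb bs c) j = c j"
  using coord_eq[OF B _ j, of "k + lin_comb bs c" c] k by simp

lemma coord_basis:
  assumes B: "basis_mod K bs W" and i: "i < length bs" and j: "j < length bs"
  shows "coord K bs (bs ! i) j = (if i = j then 1 else 0)"
proof -
  have "0 \<in> K" using B by (simp add: basis_mod_def subspace_0)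
  from coord_lin_comb[OF B this j, of "\<lambda>j. if j = i then 1 else 0"] show ?thesis
    by (auto simp: lin_comb_unit[OF i])
qed

lemma basis_mod_distinct:
  assumes B: "basis_mod K bs W" shows "distinct bs"
  unfolding distinct_conv_nth
proof (intro allI impI notI)
  fix i j assume ij: "i < length bs" "j < length bs" "i \<noteq> j" "bs ! i = bs ! j"
  show False using coord_basis[OF B ij(1,2)] coord_basis[OF B ij(2,2)] ij by simp
qed

lemma basis_mod_Nil: "subspace K \<Longrightarrow> basis_mod K [] K"
  by (auto simp: basis_mod_def lin_comb_Nil)

text \<open>All flags below are assembled this way. Independence is peeled off from the top: modulo
  W only the coefficients of \<open>cs\<close> are visible, and once they vanish those of
  \<open>bs\<close> remain.\<close>

lemma basis_mod_append:
  assumes B: "basis_mod K bs W" and C: "basis_mod W cs Z"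
  shows "basis_mod K (bs @ cs) Z"
  unfolding basis_mod_def
proof (intro conjI allI impI)
  have K: "subspace K" using B by (rule basis_mod_subspace)
  have W: "subspace W" using C by (rule basis_mod_subspace)
  show "subspace K" by fact
  show "Z = {k + lin_comb (bs @ cs) c |k c. k \<in> K}"
  proof (intro equalityI subsetI)
    fix z assume "z \<in> Z"
    then obtain w d where w: "w \<in> W" "z = w + lin_comb cs d" by (rule basis_mod_elim[OF C])
    obtain k c where k: "k \<in> K" "w = k + lin_comb bs c" by (rule basis_mod_elim[OF B w(1)])
    have "z = k + lin_comb (bs @ cs) (\<lambda>j. if j < length bs then c j else d (j - length bs))"
      by (simp add: lin_comb_append_case w k add.assoc)
    then show "z \<in> {k + lin_comb (bs @ cs) c |k c. k \<in> K}" using k(1) by blast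
  next
    fix z assume "z \<in> {k + lin_comb (bs @ cs) c |k c. k \<in> K}"
    then obtain k c where k: "k \<in> K" "z = k + lin_comb (bs @ cs) c" by blast
    then have "z = (k + lin_comb bs c) + lin_comb cs (\<lambda>j. c (length bs + j))"
      by (simp add: lin_comb_append add.assoc)
    then show "z \<in> Z" using basis_mod_memI[OF C basis_mod_memI[OF B k(1)]] by simp
  qed
next
  fix c j assume c: "lin_comb (bs @ cs) c \<in> K" and j: "j < length (bs @ cs)"
  have K: "subspace K" using B by (rule basis_mod_subspace)
  have W: "subspace W" using C by (rule basis_mod_subspace)
  have e: "lin_comb (bs @ cs) c = lin_comb bs c + lin_comb cs (\<lambda>j. c (length bs + j))"
    by (rule lin_comb_append)
  have "lin_comb (bs @ cs) c - lin_comb bs c \<in> W"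
    using c basis_mod_subset[OF B] basis_mod_lin_comb[OF B] subspace_diff[OF W] by blast
  then have "lin_comb cs (\<lambda>j. c (length bs + j)) \<in> W" by (simp add: e)
  from basis_modD[OF C this] have z: "\<And>i. i < length cs \<Longrightarrow> c (length bs + i) = 0" .
  have "lin_comb cs (\<lambda>j. c (length bs + j)) = lin_comb cs (\<lambda>j. 0)"
    by (rule lin_comb_cong) (simp add: z)
  then have "lin_comb bs c \<in> K" using c e by (simp add: lin_comb_zero)
  from basis_modD[OF B this] z[of "j - length bs"] j show "c j = 0"
    by (cases "j < length bs") auto
qed

lemma basis_mod_singleton:
  assumes K: "subspace K" and w: "w \<notin> K"
  shows "basis_mod K [w] {k + scale a w |k a. k \<in> K}"
  unfolding basis_mod_def lin_comb_single
proof (intro conjI allI impI)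
  show "{k + scale a w |k a. k \<in> K} = {k + scale (c 0) w |k (c :: nat \<Rightarrow> 'a). k \<in> K}"
  proof (intro equalityI subsetI)
    fix x assume "x \<in> {k + scale a w |k a. k \<in> K}"
    then obtain k a where "k \<in> K" "x = k + scale a w" by blast
    then show "x \<in> {k + scale (c 0) w |k (c :: nat \<Rightarrow> 'a). k \<in> K}"
      by (auto intro!: exI[of _ k] exI[of _ "\<lambda>_. a"])
  qed blast
  fix c :: "nat \<Rightarrow> 'a" and j assume c: "scale (c 0) w \<in> K" and j: "j < length [w]"
  have "c 0 = 0"
  proof (rule ccontr)
    assume "c 0 \<noteq> 0"
    then have "scale (inverse (c 0)) (scale (c 0) w) = w" by simp
    then show False using subspace_scale[OF K c] w by metis
  qed
  then show "c j = 0" using j by simp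
qed (rule K)

lemma basis_mod_exists:
  assumes "subspace K" "subspace W" "K \<subseteq> W" "finite W"
  shows "\<exists>bs. basis_mod K bs W"
  using assms
proof (induction "card (W - K)" arbitrary: K rule: less_induct)
  case less
  show ?case
  proof (cases "K = W")
    case True
    then show ?thesis using basis_mod_Nil less.prems by blast
  next
    case False
    then obtain w where w: "w \<in> W" "w \<notin> K" using less.prems by blast
    define K' where "K' = {k + scale a w |k a. k \<in> K}"
    have B: "basis_mod K [w] K'" unfolding K'_def by (rule basis_mod_singleton[OF less.prems(1) w(2)])
    have sub: "K' \<subseteq> W"
      using less.prems w by (auto simp: K'_def intro!: subspace_add subspace_scale)
    have "w \<in> K'" using basis_mod_set[OF B] by simp
    then have "W - K' \<subset> W - K" using w basis_mod_subset[OF B] by blast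
    then have "card (W - K') < card (W - K)"
      using less.prems(4) by (intro psubset_card_mono) auto
    from less.hyps[OF this basis_mod_subspace'[OF B] less.prems(2) sub less.prems(4)]
    show ?thesis using basis_mod_append[OF B] by blast
  qed
qed

text \<open>The second isomorphism theorem \<open>A / (A \<inter> K) \<cong> (K + A) / K\<close>.\<close>

lemma basis_mod_sum:
  assumes B: "basis_mod L bs A" and K: "subspace K" and L: "L = A \<inter> K"
  shows "basis_mod K bs {k + a |k a. k \<in> K \<and> a \<in> A}"
  unfolding basis_mod_def
proof (intro conjI allI impI)
  show "subspace K" by fact
  show "{k + a |k a. k \<in> K \<and> a \<in> A} = {k + lin_comb bs c |k c. k \<in> K}"
  proof (intro equalityI subsetI)
    fix z assume "z \<in> {k + a |k a. k \<in> K \<and> a \<in> A}"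
    then obtain k a where k: "k \<in> K" "a \<in> A" "z = k + a" by blast
    then obtain l c where l: "l \<in> L" "a = l + lin_comb bs c" using basis_mod_elim[OF B] by metis
    then have "z = (k + l) + lin_comb bs c" "k + l \<in> K"
      using k L by (auto simp: add.assoc subspace_add[OF K])
    then show "z \<in> {k + lin_comb bs c |k c. k \<in> K}" by blast
  qed (use basis_mod_lin_comb[OF B] in blast)
  fix c j assume "lin_comb bs c \<in> K" "j < length bs"
  then show "c j = 0" using basis_modD[OF B] basis_mod_lin_comb[OF B] L by blast
qed

text \<open>Cardinalities stand in for dimensions: equations between dimensions are later obtained
  by comparing exponents of the field size.\<close>

lemma basis_mod_card:
  assumes B: "basis_mod K bs W" and fin: "finite (UNIV :: 'a set)" "finite K"
  shows "card W = card K * CARD('a) ^ length bs"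
proof -
  let ?S = "K \<times> ({..<length bs} \<rightarrow>\<^sub>E (UNIV :: 'a set))"
  have "bij_betw (\<lambda>(k, c). k + lin_comb bs c) ?S W"
    unfolding bij_betw_def
  proof (intro conjI)
    show "inj_on (\<lambda>(k, c). k + lin_comb bs c) ?S"
    proof (rule inj_onI, clarsimp)
      fix k c l d assume kl: "k \<in> K" "l \<in> K" and cd: "c \<in> {..<length bs} \<rightarrow>\<^sub>E (UNIV :: 'a set)"
        "d \<in> {..<length bs} \<rightarrow>\<^sub>E (UNIV :: 'a set)" and eq: "k + lin_comb bs c = l + lin_comb bs d"
      have "c j = d j" if "j < length bs" for j
        using coord_lin_comb[OF B kl(1) that, of c] coord_lin_comb[OF B kl(2) that, of d] eq by simp
      then have "c = d" using cd by (intro PiE_ext) auto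
      then show "k = l \<and> c = d" using eq by simp
    qed
    show "(\<lambda>(k, c). k + lin_comb bs c) ` ?S = W"
    proof (intro equalityI subsetI)
      fix x assume "x \<in> W"
      then obtain k c where k: "k \<in> K" "x = k + lin_comb bs c" by (rule basis_mod_elim[OF B])
      have "lin_comb bs c = lin_comb bs (restrict c {..<length bs})"
        by (rule lin_comb_cong) auto
      then show "x \<in> (\<lambda>(k, c). k + lin_comb bs c) ` ?S"
        using k by (intro image_eqI[of _ _ "(k, restrict c {..<length bs})"]) auto
    qed (auto intro: basis_mod_memI[OF B])
  qed
  then have "card W = card ?S" by (metis bij_betw_same_card)
  also have "\<dots> = card K * CARD('a) ^ length bs"
    by (simp add: card_cartesian_product card_PiE)
  finally show ?thesis .
qed

section \<open>Comparison with ordered bases, dimension and representation\<close>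

lemma lin_comb_set:
  assumes "distinct bs" shows "lin_comb bs (\<lambda>j. u (bs ! j)) = (\<Sum>v\<in>set bs. scale (u v) v)"
proof -
  have "bij_betw ((!) bs) {..<length bs} (set bs)" using bij_betw_nth[OF assms] by blast
  from sum.reindex_bij_betw[OF this] show ?thesis by (simp add: lin_comb_def)
qed

text \<open>Traces and characteristic polynomials are defined in an unspecified
  \<open>ordered_basis\<close>; this and \<open>representation_eq_coord\<close> carry them over to
  \<open>basis_mod\<close> and \<open>coord\<close>.\<close>

lemma ordered_basis_iff: "ordered_basis W bs \<longleftrightarrow> basis_mod {0} bs W"
proof
  assume o: "ordered_basis W bs"
  show "basis_mod {0} bs W" unfolding basis_mod_def
  proof (intro conjI allI impI)
    have sp: "span (set bs) = W" and d: "distinct bs" and ind: "independent (set bs)"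
      using o by (auto simp: ordered_basis_def)
    show "W = {k + lin_comb bs c |k c. k \<in> {0}}"
    proof (intro equalityI subsetI)
      fix x assume "x \<in> W"
      then obtain u where "x = (\<Sum>v\<in>set bs. scale (u v) v)"
        using sp span_finite[of "set bs"] by auto
      then have "x = 0 + lin_comb bs (\<lambda>j. u (bs ! j))" by (simp add: lin_comb_set[OF d])
      then show "x \<in> {k + lin_comb bs c |k c. k \<in> {0}}" by blast
    next
      fix x assume "x \<in> {k + lin_comb bs c |k c. k \<in> {0}}"
      then show "x \<in> W" using sp lin_comb_in_subspace[of W bs] by (auto simp: span_superset)
    qed
    fix c j assume c: "lin_comb bs c \<in> {0}" and j: "j < length bs"
    \<comment> \<open>Turns a coefficient per position into a coefficient per vector, which is
      possible because the list is distinct.\<close>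
    define u where "u v = c (the_inv_into {..<length bs} ((!) bs) v)" for v
    have inj: "inj_on ((!) bs) {..<length bs}" using d by (auto simp: inj_on_def nth_eq_iff_index_eq)
    have u: "u (bs ! j) = c j" if "j < length bs" for j
      unfolding u_def using the_inv_into_f_f[OF inj, of j] that by simp
    have "lin_comb bs (\<lambda>j. u (bs ! j)) = lin_comb bs c" by (rule lin_comb_cong) (rule u)
    then have "(\<Sum>v\<in>set bs. scale (u v) v) = 0" using c by (simp add: lin_comb_set[OF d])
    then have "u (bs ! j) = 0" using ind independentD[of "set bs" "set bs" u "bs ! j"] j by simp
    then show "c j = 0" using u[OF j] by simp
  qed simp
next
  assume B: "basis_mod {0} bs W"
  show "ordered_basis W bs" unfolding ordered_basis_def
  proof (intro conjI)
    show d: "distinct bs" by (rule basis_mod_distinct[OF B])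
    show "independent (set bs)" unfolding independent_explicit_finite_subsets
    proof (intro allI impI ballI)
      fix S u v assume S: "S \<subseteq> set bs" "finite S" "(\<Sum>v\<in>S. scale (u v) v) = 0" and v: "v \<in> S"
      obtain j where j: "j < length bs" "v = bs ! j" using v S by (metis in_set_conv_nth subsetD)
      have "lin_comb bs (\<lambda>j. if bs ! j \<in> S then u (bs ! j) else 0) =
          (\<Sum>v\<in>set bs. scale (if v \<in> S then u v else 0) v)"
        by (rule lin_comb_set[OF d])
      also have "\<dots> = (\<Sum>v\<in>S. scale (u v) v)"
        using S by (intro sum.mono_neutral_cong_right) auto
      finally have "lin_comb bs (\<lambda>j. if bs ! j \<in> S then u (bs ! j) else 0) \<in> {0}" using S by simp
      from basis_modD[OF B this j(1)] v j show "u v = 0" by simp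
    qed
    show "span (set bs) = W"
    proof
      show "span (set bs) \<subseteq> W" by (rule span_minimal[OF basis_mod_set[OF B] basis_mod_subspace'[OF B]])
      show "W \<subseteq> span (set bs)"
      proof
        fix x assume "x \<in> W"
        then obtain k c where "k \<in> {0}" "x = k + lin_comb bs c" by (rule basis_mod_elim[OF B])
        then show "x \<in> span (set bs)" using lin_comb_in_subspace[of "span (set bs)" bs c]
          by (auto simp: span_superset)
      qed
    qed
  qed
qed

lemma dim_basis_mod:
  assumes "basis_mod {0} bs W" shows "dim W = length bs"
proof -
  have o: "ordered_basis W bs" using assms by (simp add: ordered_basis_iff)
  then have "dim W = card (set bs)"
    by (metis dim_eq_card ordered_basis_def span_span)
  also have "\<dots> = length bs" using o by (simp add: ordered_basis_def distinct_card)
  finally show ?thesis .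
qed

lemma representation_eq_coord:
  assumes B: "basis_mod {0} bs W" and x: "x \<in> W" and j: "j < length bs"
  shows "representation (set bs) x (bs ! j) = coord {0} bs x j"
proof -
  have o: "distinct bs" "independent (set bs)" "span (set bs) = W"
    using B by (auto simp: ordered_basis_iff[symmetric] ordered_basis_def)
  have "x = (\<Sum>v\<in>set bs. scale (representation (set bs) x v) v)"
    using sum_representation_eq[OF o(2), of x "set bs"] x o by simp
  then have "x - lin_comb bs (\<lambda>j. representation (set bs) x (bs ! j)) \<in> {0}"
    by (simp add: lin_comb_set[OF o(1)])
  from coord_eq[OF B this j] show ?thesis by simp
qed

end

section \<open>Gram matrices and coordinate determinants\<close>

text \<open>The two argument types may differ so that a coordinate matrix is itself a Gram matrix,
  of \<open>coord K bs\<close> against the positions \<open>[0..<length bs]\<close>. The block and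
  base change lemmas then serve both.\<close>

definition gram :: "('x \<Rightarrow> 'y \<Rightarrow> 'k) \<Rightarrow> 'x list \<Rightarrow> 'y list \<Rightarrow> 'k mat" where
  "gram \<beta> xs ys = mat (length xs) (length ys) (\<lambda>(i, j). \<beta> (xs ! i) (ys ! j))"

lemma gram_carrier: "gram \<beta> xs ys \<in> carrier_mat (length xs) (length ys)"
  by (simp add: gram_def)

lemma gram_cong:
  assumes "\<And>x y. x \<in> set xs \<Longrightarrow> y \<in> set ys \<Longrightarrow> \<beta> x y = \<gamma> x y"
  shows "gram \<beta> xs ys = gram \<gamma> xs ys"
  unfolding gram_def by (intro cong_mat) (auto simp: assms)

lemma gram_append:
  "gram \<beta> (xs @ xs') (ys @ ys') =
     four_block_mat (gram \<beta> xs ys) (gram \<beta> xs ys') (gram \<beta> xs' ys) (gram \<beta> xs' ys')"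
  by (intro eq_matI) (auto simp: gram_def nth_append)

lemma gram_eq_zero:
  assumes "\<And>x y. x \<in> set xs \<Longrightarrow> y \<in> set ys \<Longrightarrow> \<beta> x y = 0"
  shows "gram \<beta> xs ys = 0\<^sub>m (length xs) (length ys)"
  by (intro eq_matI) (auto simp: gram_def assms)

lemma det_gram_append_upper_zero:
  fixes \<beta> :: "'x \<Rightarrow> 'y \<Rightarrow> 'k::idom"
  assumes "\<And>x y. x \<in> set xs \<Longrightarrow> y \<in> set ys' \<Longrightarrow> \<beta> x y = 0"
    and "length xs = length ys" "length xs' = length ys'"
  shows "det (gram \<beta> (xs @ xs') (ys @ ys')) = det (gram \<beta> xs ys) * det (gram \<beta> xs' ys')"
  unfolding gram_append
  by (rule det_four_block_mat_upper_right_zero[of _ "length xs" _ "length xs'"])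
    (use assms gram_eq_zero[of xs ys' \<beta>] in \<open>auto simp: gram_def\<close>)

lemma det_gram_append_lower_zero:
  fixes \<beta> :: "'x \<Rightarrow> 'y \<Rightarrow> 'k::idom"
  assumes "\<And>x y. x \<in> set xs' \<Longrightarrow> y \<in> set ys \<Longrightarrow> \<beta> x y = 0"
    and "length xs = length ys" "length xs' = length ys'"
  shows "det (gram \<beta> (xs @ xs') (ys @ ys')) = det (gram \<beta> xs ys) * det (gram \<beta> xs' ys')"
  unfolding gram_append
  by (rule det_four_block_mat_lower_left_zero[of _ "length xs" _ "length xs'"])
    (use assms gram_eq_zero[of xs' ys \<beta>] in \<open>auto simp: gram_def\<close>)

lemma det_gram_transpose:
  fixes \<beta> :: "'x \<Rightarrow> 'y \<Rightarrow> 'k::comm_ring_1"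
  assumes "length xs = length ys"
  shows "det (gram \<beta> xs ys) = det (gram (\<lambda>y x. \<beta> x y) ys xs)"
proof -
  have "gram (\<lambda>y x. \<beta> x y) ys xs = transpose_mat (gram \<beta> xs ys)"
    by (intro eq_matI) (auto simp: gram_def)
  then show ?thesis using det_transpose[of "gram \<beta> xs ys" "length xs"] assms
    by (simp add: gram_def)
qed

lemma det_gram_swap:
  fixes \<beta> :: "'x \<Rightarrow> 'y \<Rightarrow> 'k::comm_ring_1"
  assumes "length xs = length (as @ bs @ cs)"
  shows "det (gram \<beta> xs (as @ bs @ cs)) =
    (- 1) ^ (length as * length bs) * det (gram \<beta> xs (bs @ as @ cs))"
proof -
  let ?A = "gram \<beta> xs (as @ bs @ cs)" and ?m = "length xs"
  have A: "?A \<in> carrier_mat ?m ?m" using assms gram_carrier[of \<beta> xs "as @ bs @ cs"] by simp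
  have le: "length as + length bs \<le> ?m" using assms by simp
  have "mat ?m ?m (\<lambda>(i, j). ?A $$ (i, if j < length bs then j + length as
      else if j < length as + length bs then j - length bs else j)) = gram \<beta> xs (bs @ as @ cs)"
    using assms by (intro eq_matI) (auto simp: gram_def nth_append add.commute)
  then show ?thesis using det_swap_initial_cols[OF A le] by simp
qed

text \<open>The reversal comes from \<open>omega_wedge\<close>, where the last entry meets the
  first. The tail \<open>zs\<close> absorbs the entry split off in the induction; moving that entry
  back across k columns adds k to the exponent, as (k+1 choose 2) = k + (k choose 2).\<close>

lemma det_gram_rev:
  fixes \<beta> :: "'x \<Rightarrow> 'y \<Rightarrow> 'k::comm_ring_1"
  assumes "length xs = length (ys @ zs)"
  shows "det (gram \<beta> xs (rev ys @ zs)) = (- 1) ^ (length ys choose 2) * det (gram \<beta> xs (ys @ zs))"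
  using assms
proof (induction ys arbitrary: zs)
  case Nil
  then show ?case by (simp add: binomial_eq_0)
next
  case (Cons y ys)
  have "det (gram \<beta> xs (rev ys @ y # zs)) =
      (- 1) ^ (length ys choose 2) * det (gram \<beta> xs (ys @ [y] @ zs))"
    using Cons.IH[of "y # zs"] Cons.prems by simp
  also have "det (gram \<beta> xs (ys @ [y] @ zs)) =
      (- 1) ^ length ys * det (gram \<beta> xs ([y] @ ys @ zs))"
    using det_gram_swap[of xs ys "[y]" zs \<beta>] Cons.prems by simp
  finally show ?case
    by (simp add: power_add[symmetric] mult.assoc[symmetric] numeral_2_eq_2 add.commute)
qed

section \<open>Functionals, bilinear forms and change of basis\<close>

context linear_space
begin

text \<open>Linearity is asked on a subspace only, because coordinates modulo K are meaningful on W
  alone; elsewhere \<open>coord\<close> is an arbitrary choice.\<close>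

definition functional_on :: "'b set \<Rightarrow> ('b \<Rightarrow> 'a) \<Rightarrow> bool" where
  "functional_on W \<phi> \<longleftrightarrow> (\<forall>x\<in>W. \<forall>y\<in>W. \<phi> (x + y) = \<phi> x + \<phi> y) \<and>
     (\<forall>a. \<forall>x\<in>W. \<phi> (scale a x) = a * \<phi> x)"

definition bilinear_form :: "('b \<Rightarrow> 'b \<Rightarrow> 'a) \<Rightarrow> bool" where
  "bilinear_form \<beta> \<longleftrightarrow> (\<forall>x. functional_on UNIV (\<beta> x)) \<and> (\<forall>y. functional_on UNIV (\<lambda>x. \<beta> x y))"

lemma functional_on_mono: "functional_on W \<phi> \<Longrightarrow> U \<subseteq> W \<Longrightarrow> functional_on U \<phi>"
  unfolding functional_on_def by (meson subsetD)

lemma functional_lin_comb: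
  assumes W: "subspace W" "functional_on W \<phi>" and bs: "set bs \<subseteq> W"
  shows "\<phi> (lin_comb bs c) = (\<Sum>j<length bs. c j * \<phi> (bs ! j))"
proof -
  have "\<phi> (\<Sum>j\<in>S. scale (c j) (bs ! j)) = (\<Sum>j\<in>S. c j * \<phi> (bs ! j))"
    if "finite S" "S \<subseteq> {..<length bs}" for S
    using that
  proof (induction S rule: finite_induct)
    case empty
    have "\<phi> (scale 0 0) = 0 * \<phi> 0"
      using W subspace_0[OF W(1)] unfolding functional_on_def by blast
    then show ?case by simp
  next
    case (insert j S)
    have nth: "bs ! i \<in> W" if "i \<in> insert j S" for i
    proof -
      have "i < length bs" using that insert.prems by auto
      then show ?thesis using bs nth_mem by blast
    qed
    moreover have "(\<Sum>j\<in>S. scale (c j) (bs ! j)) \<in> W"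
      by (intro subspace_sum[OF W(1)] subspace_scale[OF W(1)] nth) auto
    ultimately show ?case using insert W subspace_scale[OF W(1)]
      by (simp add: functional_on_def)
  qed
  then show ?thesis by (simp add: lin_comb_def)
qed

lemma functional_coord:
  assumes B: "basis_mod K bs W" and \<phi>: "functional_on W \<phi>" and z: "\<And>x. x \<in> K \<Longrightarrow> \<phi> x = 0"
    and x: "x \<in> W"
  shows "\<phi> x = (\<Sum>j<length bs. coord K bs x j * \<phi> (bs ! j))"
proof -
  have W: "subspace W" using B by (rule basis_mod_subspace')
  let ?l = "lin_comb bs (coord K bs x)"
  have "x - ?l \<in> K" by (rule coord_ex[OF B x])
  then have "\<phi> (x - ?l + ?l) = 0 + \<phi> ?l"
    using \<phi> z basis_mod_subset[OF B] basis_mod_lin_comb[OF B] unfolding functional_on_def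
    by (metis subsetD)
  then show ?thesis using functional_lin_comb[OF W \<phi> basis_mod_set[OF B]] by simp
qed

lemma functional_on_coord:
  "basis_mod K bs W \<Longrightarrow> j < length bs \<Longrightarrow> functional_on W (\<lambda>x. coord K bs x j)"
  by (simp add: functional_on_def coord_add coord_scale)

lemma bilinear_form_left: "bilinear_form \<beta> \<Longrightarrow> functional_on W (\<lambda>x. \<beta> x y)"
  using functional_on_mono[OF _ subset_UNIV] unfolding bilinear_form_def by blast

lemma bilinear_form_right: "bilinear_form \<beta> \<Longrightarrow> functional_on W (\<beta> x)"
  using functional_on_mono[OF _ subset_UNIV] unfolding bilinear_form_def by blast

lemma bilinear_form_simps:
  assumes "bilinear_form \<beta>"
  shows "\<beta> (x + y) z = \<beta> x z + \<beta> y z" "\<beta> z (x + y) = \<beta> z x + \<beta> z y"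
    "\<beta> (scale a x) z = a * \<beta> x z" "\<beta> z (scale a x) = a * \<beta> z x"
    "\<beta> 0 z = 0" "\<beta> z 0 = 0" "\<beta> (- x) z = - \<beta> x z" "\<beta> z (- x) = - \<beta> z x"
    "\<beta> (x - y) z = \<beta> x z - \<beta> y z" "\<beta> z (x - y) = \<beta> z x - \<beta> z y"
proof -
  note b = assms[unfolded bilinear_form_def functional_on_def]
  show add: "\<beta> (x + y) z = \<beta> x z + \<beta> y z" "\<beta> z (x + y) = \<beta> z x + \<beta> z y" for x y
    using b by auto
  show sc: "\<beta> (scale a x) z = a * \<beta> x z" "\<beta> z (scale a x) = a * \<beta> z x" for a x
    using b by auto
  show "\<beta> 0 z = 0" "\<beta> z 0 = 0" using sc[of 0 0] by auto
  show neg: "\<beta> (- x) z = - \<beta> x z" "\<beta> z (- x) = - \<beta> z x" for x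
    using sc[of "-1" x] by auto
  show "\<beta> (x - y) z = \<beta> x z - \<beta> y z" "\<beta> z (x - y) = \<beta> z x - \<beta> z y"
    using add[of x "- y"] neg[of y] by auto
qed

text \<open>A form vanishing on K in its left argument sees that argument only through its
  coordinates in W/K, and expanding these is a matrix product.\<close>

lemma gram_change_left:
  assumes B: "basis_mod K bs W"
    and \<beta>: "\<And>y. y \<in> set ys \<Longrightarrow> functional_on W (\<lambda>x. \<beta> x y)"
    and z: "\<And>x y. x \<in> K \<Longrightarrow> y \<in> set ys \<Longrightarrow> \<beta> x y = 0" and xs: "set xs \<subseteq> W"
  shows "gram \<beta> xs ys = coord_mat K bs xs * gram \<beta> bs ys"
proof (intro eq_matI)
  fix i j assume ij: "i < dim_row (coord_mat K bs xs * gram \<beta> bs ys)"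
    "j < dim_col (coord_mat K bs xs * gram \<beta> bs ys)"
  then have i: "i < length xs" and j: "j < length ys" by (auto simp: coord_mat_def gram_def)
  have "\<beta> (xs ! i) (ys ! j) = (\<Sum>k<length bs. coord K bs (xs ! i) k * \<beta> (bs ! k) (ys ! j))"
    using functional_coord[OF B \<beta>[OF nth_mem[OF j]] z[OF _ nth_mem[OF j]], of "xs ! i"]
      xs nth_mem[OF i] by blast
  then show "gram \<beta> xs ys $$ (i, j) = (coord_mat K bs xs * gram \<beta> bs ys) $$ (i, j)"
    using i j by (simp add: coord_mat_def gram_def scalar_prod_def lessThan_atLeast0)
qed (auto simp: coord_mat_def gram_def)

lemma det_gram_change_left:
  assumes "basis_mod K bs W"
    and "\<And>y. y \<in> set ys \<Longrightarrow> functional_on W (\<lambda>x. \<beta> x y)"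
    and "\<And>x y. x \<in> K \<Longrightarrow> y \<in> set ys \<Longrightarrow> \<beta> x y = 0"
    and "set xs \<subseteq> W" "length xs = length bs" "length ys = length bs"
  shows "det (gram \<beta> xs ys) = coord_det K bs xs * det (gram \<beta> bs ys)"
proof -
  have "det (gram \<beta> xs ys) = det (coord_mat K bs xs * gram \<beta> bs ys)"
    by (rule arg_cong[OF gram_change_left[OF assms(1-4)]])
  also have "\<dots> = det (coord_mat K bs xs) * det (gram \<beta> bs ys)"
    by (rule det_mult[of _ "length bs"]) (simp_all add: coord_mat_def gram_def assms(5,6))
  finally show ?thesis by (simp add: coord_det_def)
qed

lemma det_gram_change_right:
  assumes B: "basis_mod K bs W"
    and \<beta>: "\<And>x. x \<in> set xs \<Longrightarrow> functional_on W (\<beta> x)"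
    and z: "\<And>x y. x \<in> set xs \<Longrightarrow> y \<in> K \<Longrightarrow> \<beta> x y = 0"
    and ys: "set ys \<subseteq> W" "length ys = length bs" "length xs = length bs"
  shows "det (gram \<beta> xs ys) = coord_det K bs ys * det (gram \<beta> xs bs)"
  using det_gram_change_left[OF B, of xs "\<lambda>y x. \<beta> x y" ys] det_gram_transpose[of xs ys \<beta>]
    det_gram_transpose[of xs bs \<beta>] assms by simp

lemma coord_mat_gram: "coord_mat K bs xs = gram (coord K bs) xs [0..<length bs]"
  by (intro eq_matI) (auto simp: coord_mat_def gram_def)

lemma coord_det_gram: "coord_det K bs xs = det (gram (coord K bs) xs [0..<length bs])"
  by (simp add: coord_det_def coord_mat_gram)

lemma coord_det_self:
  assumes B: "basis_mod K bs W" shows "coord_det K bs bs = 1"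
proof -
  have "coord_mat K bs bs = 1\<^sub>m (length bs)"
    by (intro eq_matI) (auto simp: coord_mat_def coord_basis[OF B])
  then show ?thesis by (simp add: coord_det_def)
qed

text \<open>An instance of \<open>det_gram_change_left\<close> with the coordinate functions of
  \<open>bs\<close> in the place of a form.\<close>

lemma coord_det_trans:
  assumes B: "basis_mod K bs W" and C: "basis_mod K cs W"
    and xs: "set xs \<subseteq> W" "length xs = length bs" "length cs = length bs"
  shows "coord_det K bs xs = coord_det K cs xs * coord_det K bs cs"
  unfolding coord_det_gram[of K bs]
  by (rule det_gram_change_left[OF C])
    (use xs functional_on_coord[OF B] coord_zero[OF B] in auto)

lemma coord_det_inverse:
  assumes B: "basis_mod K bs W" and C: "basis_mod K cs W" and "length cs = length bs"
  shows "coord_det K cs bs * coord_det K bs cs = 1"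
  using coord_det_trans[OF B C basis_mod_set[OF B]] assms coord_det_self[OF B] by simp

lemma coord_append_left:
  assumes B: "basis_mod K bs W" and C: "basis_mod W cs Z" and x: "x \<in> W" and j: "j < length bs"
  shows "coord K (bs @ cs) x j = coord K bs x j"
proof -
  let ?c = "\<lambda>j. if j < length bs then coord K bs x j else 0"
  have "x - lin_comb (bs @ cs) ?c \<in> K"
    using coord_ex[OF B x] lin_comb_append_case[of bs cs "coord K bs x" "\<lambda>_. 0"]
    by (simp only: lin_comb_zero add_0_right)
  from coord_eq[OF basis_mod_append[OF B C] this, of j] j show ?thesis by simp
qed

lemma coord_append_right:
  assumes B: "basis_mod K bs W" and C: "basis_mod W cs Z" and x: "x \<in> Z" and j: "j < length cs"
  shows "coord K (bs @ cs) x (length bs + j) = coord W cs x j"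
proof -
  let ?w = "x - lin_comb cs (coord W cs x)"
  have w: "?w \<in> W" by (rule coord_ex[OF C x])
  let ?c = "\<lambda>j. if j < length bs then coord K bs ?w j else coord W cs x (j - length bs)"
  have "x - lin_comb (bs @ cs) ?c = ?w - lin_comb bs (coord K bs ?w)"
    by (simp add: lin_comb_append_case algebra_simps)
  then have "x - lin_comb (bs @ cs) ?c \<in> K" using coord_ex[OF B w] by (simp only:)
  from coord_eq[OF basis_mod_append[OF B C] this, of "length bs + j"] j show ?thesis by simp
qed

text \<open>Vectors of W have no coordinates along \<open>cs\<close>, and coordinates along
  \<open>cs\<close> are those of Z/W. Only the lower left block is uncontrolled, and neither
  determinants nor characteristic polynomials see it.\<close>

lemma coord_mat_append:
  assumes B: "basis_mod K bs W" and C: "basis_mod W cs Z"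
    and xs: "set xs \<subseteq> W" and ys: "set ys \<subseteq> Z"
  shows "\<exists>A. A \<in> carrier_mat (length ys) (length bs) \<and> coord_mat K (bs @ cs) (xs @ ys) =
    four_block_mat (coord_mat K bs xs) (0\<^sub>m (length xs) (length cs)) A (coord_mat W cs ys)"
proof -
  let ?r = "[length bs..<length bs + length cs]"
  have split: "[0..<length (bs @ cs)] = [0..<length bs] @ ?r"
    by (metis length_append upt_add_eq_append zero_le)
  have "gram (coord K (bs @ cs)) xs ?r = 0\<^sub>m (length xs) (length ?r)"
  proof (rule gram_eq_zero)
    fix x j assume x: "x \<in> set xs" and "j \<in> set ?r"
    moreover have "x \<in> W" "x \<in> Z" using x xs basis_mod_subset[OF C] by auto
    ultimately show "coord K (bs @ cs) x j = 0"
      using coord_append_right[OF B C, of x "j - length bs"] coord_zero[OF C, of x "j - length bs"]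
      by auto
  qed
  moreover have "gram (coord K (bs @ cs)) xs [0..<length bs] = gram (coord K bs) xs [0..<length bs]"
    by (rule gram_cong) (use xs coord_append_left[OF B C] in auto)
  moreover have "gram (coord K (bs @ cs)) ys ?r = gram (coord W cs) ys [0..<length cs]"
    by (intro eq_matI)
      (use ys coord_append_right[OF B C subsetD[OF ys nth_mem]] in \<open>auto simp: gram_def\<close>)
  ultimately show ?thesis
    unfolding coord_mat_gram split gram_append
    using gram_carrier[of "coord K (bs @ cs)" ys "[0..<length bs]"] by auto
qed

lemma coord_det_append:
  assumes "basis_mod K bs W" "basis_mod W cs Z"
    and "set xs \<subseteq> W" "length xs = length bs" and "set ys \<subseteq> Z" "length ys = length cs"
  shows "coord_det K (bs @ cs) (xs @ ys) = coord_det K bs xs * coord_det W cs ys"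
proof -
  obtain A where "A \<in> carrier_mat (length ys) (length bs)" "coord_mat K (bs @ cs) (xs @ ys) =
      four_block_mat (coord_mat K bs xs) (0\<^sub>m (length xs) (length cs)) A (coord_mat W cs ys)"
    using coord_mat_append[OF assms(1,2,3,5)] by blast
  then show ?thesis using assms(4,6) unfolding coord_det_def
    by (simp add: det_four_block_mat_upper_right_zero[of _ "length bs" _ "length cs"] coord_mat_def)
qed

end

section \<open>Top exterior powers\<close>

text \<open>Laplace expansion along the row of \<open>u\<close>. Deleting that row removes all
  dependence on \<open>u\<close>, so the cofactors can be fixed once and linearity in
  \<open>u\<close> becomes visible.\<close>

lemma det_gram_row:
  fixes \<beta> :: "'x \<Rightarrow> 'y \<Rightarrow> 'k::comm_ring_1"
  assumes "length xs + 1 + length ys = length zs"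
  obtains C where "\<And>u. det (gram \<beta> (xs @ [u] @ ys) zs) = (\<Sum>j<length zs. \<beta> u (zs ! j) * C j)"
proof -
  let ?i = "length xs" and ?n = "length zs"
  let ?A = "\<lambda>u. gram \<beta> (xs @ [u] @ ys) zs"
  have n: "?n = Suc (length xs + length ys)" using assms by simp
  have "det (?A u) = (\<Sum>j<?n. \<beta> u (zs ! j) * cofactor (?A v) ?i j)" for u v
  proof -
    have "?A u \<in> carrier_mat ?n ?n" using gram_carrier[of \<beta> "xs @ [u] @ ys" zs] assms by simp
    from laplace_expansion_row[OF this, of ?i]
    have "det (?A u) = (\<Sum>j<?n. ?A u $$ (?i, j) * cofactor (?A u) ?i j)" using assms by simp
    also have "\<dots> = (\<Sum>j<?n. \<beta> u (zs ! j) * cofactor (?A v) ?i j)"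
    proof (intro sum.cong refl arg_cong2[where f = "(*)"])
      fix j assume "j \<in> {..<?n}"
      then show "?A u $$ (?i, j) = \<beta> u (zs ! j)" using assms by (simp add: gram_def nth_append)
      have "mat_delete (?A u) ?i j = mat_delete (?A v) ?i j"
        unfolding mat_delete_def using n
        by (intro cong_mat) (auto simp: gram_def nth_append nth_Cons split: nat.splits)
      then show "cofactor (?A u) ?i j = cofactor (?A v) ?i j" by (simp add: cofactor_def)
    qed
    finally show ?thesis .
  qed
  then show thesis using that by blast
qed

lemma det_gram_not_distinct:
  fixes \<beta> :: "'x \<Rightarrow> 'y \<Rightarrow> 'k::comm_ring_1"
  assumes "length xs = length zs" "\<not> distinct xs"
  shows "det (gram \<beta> xs zs) = 0"
proof -
  obtain i j where ij: "i < length xs" "j < length xs" "i \<noteq> j" "xs ! i = xs ! j"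
    using assms(2) by (auto simp: distinct_conv_nth)
  show ?thesis
    by (rule det_identical_rows[OF _ ij(3), of _ "length zs"])
      (use ij assms in \<open>auto simp: gram_def intro!: eq_vecI\<close>)
qed

section \<open>Cosets, and tensors as functions on lists\<close>

lemma coset_eq_iff:
  assumes "fun_vs.subspace R" shows "coset R x = coset R y \<longleftrightarrow> x - y \<in> R"
proof
  assume "coset R x = coset R y"
  moreover have "x \<in> coset R x"
    using fun_vs.subspace_0[OF assms] by (force simp: coset_def)
  ultimately show "x - y \<in> R" by (auto simp: coset_def)
next
  assume xy: "x - y \<in> R"
  have "x + r = y + ((x - y) + r)" "y + r = x + (r - (x - y))" for r by (auto simp: algebra_simps)
  then show "coset R x = coset R y" unfolding coset_def
    using fun_vs.subspace_add[OF assms xy] fun_vs.subspace_diff[OF assms _ xy] by blast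
qed

lemma mem_coset_iff: "fun_vs.subspace R \<Longrightarrow> y \<in> coset R x \<longleftrightarrow> y - x \<in> R"
  by (force simp: coset_def)

lemma coset_self: "fun_vs.subspace R \<Longrightarrow> x \<in> coset R x"
  by (simp add: mem_coset_iff fun_vs.subspace_0)

text \<open>The space whose cosets form \<open>ext_power\<close>. Membership guarantees finite
  support, without which the sums over supports below would not be additive.\<close>

definition tuples :: "nat \<Rightarrow> 'v set \<Rightarrow> ('v list \<Rightarrow> 'k::field) set" where
  "tuples k M = fun_vs.span {gen xs |xs. set xs \<subseteq> M \<and> length xs = k}"

lemma tuples_subspace: "fun_vs.subspace (tuples k M)"
  by (simp add: tuples_def fun_vs.subspace_span)

lemma tuples_zero: "0 \<in> tuples k M"
  by (rule fun_vs.subspace_0[OF tuples_subspace])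

lemma fscale_zero: "fscale 0 x = 0"
  by (simp add: fscale_def fun_eq_iff)

lemma gen_in_tuples: "set xs \<subseteq> M \<Longrightarrow> length xs = k \<Longrightarrow> gen xs \<in> tuples k M"
  unfolding tuples_def by (rule fun_vs.span_base) auto

text \<open>Keeps the membership of the tail \<open>y\<close> in the induction step, where
  additivity of \<open>ext_eval\<close> needs its finite support.\<close>

lemma tuples_induct [consumes 1, case_names zero step]:
  assumes x: "x \<in> tuples k M" and z: "P 0"
    and s: "\<And>c xs y. set xs \<subseteq> M \<Longrightarrow> length xs = k \<Longrightarrow> y \<in> tuples k M \<Longrightarrow> P y \<Longrightarrow>
      P (fscale c (gen xs) + y)"
  shows "P x"
proof -
  have "x \<in> tuples k M \<and> P x"
    using x unfolding tuples_def
  proof (induction rule: fun_vs.span_induct_alt)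
    case base
    show ?case by (rule conjI[OF fun_vs.span_zero z])
  next
    case (step c x y)
    then obtain xs where xs: "x = gen xs" "set xs \<subseteq> M" "length xs = k" by blast
    have "fscale c x + y \<in> tuples k M"
      using step fun_vs.span_base[OF step(1)] unfolding tuples_def
      by (intro fun_vs.span_add fun_vs.span_scale) auto
    moreover have "P (fscale c x + y)" using s[OF xs(2,3), of y c] step xs(1) by (simp add: tuples_def)
    ultimately show ?case unfolding tuples_def by (rule conjI)
  qed
  then show ?thesis by simp
qed

lemma tuples_support:
  assumes "x \<in> tuples k M"
  shows "finite {xs. x xs \<noteq> 0} \<and> (\<forall>xs. x xs \<noteq> 0 \<longrightarrow> set xs \<subseteq> M \<and> length xs = k)"
  using assms
proof (induction rule: tuples_induct)
  case (step c xs y)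
  have "{ys. (fscale c (gen xs) + y) ys \<noteq> 0} \<subseteq> insert xs {ys. y ys \<noteq> 0}"
    by (auto simp: fscale_def gen_def)
  then have "finite {ys. (fscale c (gen xs) + y) ys \<noteq> 0}"
    using step finite_subset by blast
  moreover have "ys = xs \<or> y ys \<noteq> 0" if "(fscale c (gen xs) + y) ys \<noteq> 0" for ys
    using that by (auto simp: fscale_def gen_def split: if_splits)
  ultimately show ?case using step by blast
qed auto

lemma sum_gen_add:
  fixes x y :: "'v list \<Rightarrow> 'k::field"
  assumes x: "finite {xs. x xs \<noteq> 0}" and y: "finite {xs. y xs \<noteq> 0}"
  shows "(\<Sum>xs | (fscale c x + y) xs \<noteq> 0. (fscale c x + y) xs * F xs) =
    c * (\<Sum>xs | x xs \<noteq> 0. x xs * F xs) + (\<Sum>xs | y xs \<noteq> 0. y xs * F xs)"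
proof -
  \<comment> \<open>Cancellation can shrink the support of the combination, so all three sums are
    first extended to the union of both supports.\<close>
  let ?S = "{xs. x xs \<noteq> 0} \<union> {xs. y xs \<noteq> 0}"
  have fin: "finite ?S" using x y by simp
  have e: "(\<Sum>xs | z xs \<noteq> 0. z xs * F xs) = (\<Sum>xs\<in>?S. z xs * F xs)"
    if "{xs. z xs \<noteq> 0} \<subseteq> ?S" for z :: "'v list \<Rightarrow> 'k"
    by (rule sum.mono_neutral_left) (use fin that in auto)
  have "(\<Sum>xs | (fscale c x + y) xs \<noteq> 0. (fscale c x + y) xs * F xs) =
      (\<Sum>xs\<in>?S. (fscale c x + y) xs * F xs)"
    by (rule e) (auto simp: fscale_def)
  also have "\<dots> = c * (\<Sum>xs\<in>?S. x xs * F xs) + (\<Sum>xs\<in>?S. y xs * F xs)"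
    by (simp add: fscale_def sum_distrib_left sum.distrib[symmetric] algebra_simps)
  also have "\<dots> = c * (\<Sum>xs | x xs \<noteq> 0. x xs * F xs) + (\<Sum>xs | y xs \<noteq> 0. y xs * F xs)"
    using e[of x] e[of y] by simp
  finally show ?thesis .
qed

lemma sum_gen: "(\<Sum>ys | (gen xs :: 'v list \<Rightarrow> 'k::field) ys \<noteq> 0. gen xs ys * F ys) = (F xs :: 'k)"
proof -
  have "{ys. (gen xs :: 'v list \<Rightarrow> 'k) ys \<noteq> 0} = {xs}" by (auto simp: gen_def)
  then show ?thesis by (simp add: gen_def)
qed

lemma conv_linear_left: "conv (fscale c x + y) z = fscale c (conv x z) + conv y z"
  by (auto simp: conv_def fscale_def fun_eq_iff sum.distrib sum_distrib_left algebra_simps)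

lemma conv_linear_right: "conv z (fscale c x + y) = fscale c (conv z x) + conv z y"
  by (auto simp: conv_def fscale_def fun_eq_iff sum.distrib sum_distrib_left algebra_simps)

lemma conv_zero: "conv 0 z = 0" "conv z 0 = 0"
  by (auto simp: conv_def fun_eq_iff)

lemma conv_gen: "conv (gen xs) (gen ys) = gen (xs @ ys)"
proof
  fix zs
  have "conv (gen xs) (gen ys) zs =
      (\<Sum>j\<le>length zs. if j = length xs \<and> xs @ ys = zs then 1 else 0)"
    unfolding conv_def
  proof (intro sum.cong refl)
    fix j assume j: "j \<in> {..length zs}"
    have "take j zs = xs \<and> drop j zs = ys \<longleftrightarrow> j = length xs \<and> xs @ ys = zs"
      using j by (auto simp: append_eq_conv_conj min_def)
    then show "gen xs (take j zs) * gen ys (drop j zs) =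
        (if j = length xs \<and> xs @ ys = zs then 1 else 0)"
      by (auto simp: gen_def)
  qed
  also have "\<dots> = gen (xs @ ys) zs" by (auto simp: gen_def)
  finally show "conv (gen xs) (gen ys) zs = gen (xs @ ys) zs" .
qed

lemma conv_tuples:
  assumes x: "x \<in> tuples k M" and y: "y \<in> tuples l M"
  shows "conv x y \<in> tuples (k + l) M"
  using x
proof (induction rule: tuples_induct)
  case zero
  show ?case unfolding conv_zero by (rule tuples_zero)
next
  case (step c xs x)
  note [intro] = fun_vs.subspace_add[OF tuples_subspace] fun_vs.subspace_scale[OF tuples_subspace]
  have "conv (gen xs) y \<in> tuples (k + l) M"
    using y
  proof (induction rule: tuples_induct)
    case zero
    show ?case unfolding conv_zero by (rule tuples_zero)
  next
    case (step d ys y)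
    then have "fscale d (gen (xs @ ys)) + conv (gen xs) y \<in> tuples (k + l) M"
      using \<open>set xs \<subseteq> M\<close> \<open>length xs = k\<close> gen_in_tuples[of "xs @ ys" M "k + l"] by auto
    then show ?case by (simp only: conv_linear_right conv_gen)
  qed
  then have "fscale c (conv (gen xs) y) + conv x y \<in> tuples (k + l) M" using step.IH by auto
  then show ?case by (simp only: conv_linear_left)
qed

lemma tuples_mono: "M \<subseteq> N \<Longrightarrow> tuples k M \<subseteq> tuples k N"
  unfolding tuples_def by (rule fun_vs.span_mono) blast

section \<open>The determinant functional and the relations of a top exterior power\<close>

context linear_space
begin

text \<open>The linear extension of the determinant in the basis \<open>bs\<close> of M/I. Its
  kernel on tensors of top degree will be exactly the space of relations, which makes it a
  coordinate on the top exterior power.\<close>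

definition ext_eval :: "'b set \<Rightarrow> 'b list \<Rightarrow> ('b list \<Rightarrow> 'a) \<Rightarrow> 'a" where
  "ext_eval I bs x = (\<Sum>xs | x xs \<noteq> 0. x xs * coord_det I bs xs)"

lemma ext_eval_linear:
  assumes "finite {xs. x xs \<noteq> 0}" "finite {xs. y xs \<noteq> 0}"
  shows "ext_eval I bs (fscale c x + y) = c * ext_eval I bs x + ext_eval I bs y"
  unfolding ext_eval_def by (rule sum_gen_add[OF assms])

lemma ext_eval_gen: "ext_eval I bs (gen xs) = coord_det I bs xs"
  unfolding ext_eval_def by (rule sum_gen)

lemma ext_eval_zero: "ext_eval I bs 0 = 0"
  by (simp add: ext_eval_def)

lemma ext_eval_tuples:
  assumes "x \<in> tuples k M" "y \<in> tuples l N"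
  shows "ext_eval I bs (fscale c x + y) = c * ext_eval I bs x + ext_eval I bs y"
  using assms tuples_support by (blast intro: ext_eval_linear)

lemma ext_eval_add:
  "x \<in> tuples k M \<Longrightarrow> y \<in> tuples l N \<Longrightarrow> ext_eval I bs (x + y) = ext_eval I bs x + ext_eval I bs y"
  using ext_eval_tuples[of x k M y l N I bs 1] by (simp add: fscale_def)

lemma ext_eval_scale:
  "x \<in> tuples k M \<Longrightarrow> ext_eval I bs (fscale c x) = c * ext_eval I bs x"
  using ext_eval_tuples[OF _ tuples_zero, of x k M I bs c] by (simp add: ext_eval_zero)

lemma ext_eval_diff:
  assumes "x \<in> tuples k M" "y \<in> tuples l N"
  shows "ext_eval I bs (x - y) = ext_eval I bs x - ext_eval I bs y"
proof -
  have "x - y = fscale (- 1) y + x" by (auto simp: fscale_def fun_eq_iff)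
  then show ?thesis using ext_eval_tuples[OF assms(2,1), of I bs "- 1"] by simp
qed

lemma ext_rel_subspace: "fun_vs.subspace (ext_rel k M I)"
  by (simp add: ext_rel_def)

lemma ext_rel_add:
  assumes "set xs \<union> {u, v} \<union> set ys \<subseteq> M" "length xs + 1 + length ys = k"
  shows "gen (xs @ [u + v] @ ys) - gen (xs @ [u] @ ys) - gen (xs @ [v] @ ys) \<in> ext_rel k M I"
  unfolding ext_rel_def ext_relators_def
  by (rule fun_vs.span_base, rule UnI1, rule UnI1, rule UnI1, rule CollectI, (rule exI)+,
    rule conjI[OF refl]) (use assms in simp)

lemma ext_rel_scale:
  assumes "set xs \<union> {u} \<union> set ys \<subseteq> M" "length xs + 1 + length ys = k"
  shows "gen (xs @ [scale c u] @ ys) - fscale c (gen (xs @ [u] @ ys)) \<in> ext_rel k M I"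
  unfolding ext_rel_def ext_relators_def
  by (rule fun_vs.span_base, rule UnI1, rule UnI1, rule UnI2, rule CollectI, (rule exI)+,
    rule conjI[OF refl]) (use assms in simp)

lemma ext_rel_zero:
  assumes "set xs \<subseteq> M" "length xs = k" "\<not> distinct xs \<or> set xs \<inter> I \<noteq> {}"
  shows "gen xs \<in> ext_rel k M I"
  unfolding ext_rel_def ext_relators_def
  by (rule fun_vs.span_base) (use assms in blast)

text \<open>The determinant is linear in each row, alternating, and zero as soon as a row lies in I;
  these are the four kinds of relators.\<close>

lemma ext_relators_props:
  assumes B: "basis_mod I bs M" and x: "x \<in> ext_relators (length bs) M I"
  shows "x \<in> tuples (length bs) M \<and> ext_eval I bs x = 0"
proof -
  let ?k = "length bs"
  have M: "subspace M" using B by (rule basis_mod_subspace')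
  have row: "\<exists>C. \<forall>u. coord_det I bs (xs @ [u] @ ys) = (\<Sum>j<?k. coord I bs u j * C j)"
    if "length xs + 1 + length ys = ?k" for xs ys
  proof -
    obtain C where "\<And>u. det (gram (coord I bs) (xs @ [u] @ ys) [0..<?k]) =
        (\<Sum>j<length [0..<?k]. coord I bs u ([0..<?k] ! j) * C j)"
      using \<open>length xs + 1 + length ys = ?k\<close>
      by (elim det_gram_row[of xs ys "[0..<?k]" "coord I bs", rotated]) auto
    then show ?thesis unfolding coord_det_gram by (intro exI[of _ C]) auto
  qed
  note sub = tuples_subspace[of ?k M]
  show ?thesis
    using x unfolding ext_relators_def
  proof (elim UnE CollectE exE conjE, goal_cases)
    case add: (1 xs u v ys)
    obtain C where C: "\<And>u. coord_det I bs (xs @ [u] @ ys) = (\<Sum>j<?k. coord I bs u j * C j)"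
      using row[OF add(3)] by blast
    have t: "gen (xs @ [w] @ ys) \<in> tuples ?k M" if "w \<in> M" for w
      using add that by (intro gen_in_tuples) auto
    have uv: "u \<in> M" "v \<in> M" "u + v \<in> M" using add subspace_add[OF M] by auto
    have "ext_eval I bs x =
        coord_det I bs (xs @ [u + v] @ ys) - coord_det I bs (xs @ [u] @ ys) - coord_det I bs (xs @ [v] @ ys)"
      unfolding add(1)
      using ext_eval_diff[OF fun_vs.subspace_diff[OF sub t[OF uv(3)] t[OF uv(1)]] t[OF uv(2)]]
        ext_eval_diff[OF t[OF uv(3)] t[OF uv(1)]] by (simp add: ext_eval_gen)
    also have "\<dots> = 0" unfolding C
      by (simp add: coord_add[OF B uv(1,2)] distrib_right sum.distrib)
    finally show ?thesis using fun_vs.subspace_diff[OF sub fun_vs.subspace_diff[OF sub t t] t] uv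
      unfolding add(1) by blast
  next
    case scale: (2 xs c u ys)
    obtain C where C: "\<And>u. coord_det I bs (xs @ [u] @ ys) = (\<Sum>j<?k. coord I bs u j * C j)"
      using row[OF scale(3)] by blast
    have t: "gen (xs @ [w] @ ys) \<in> tuples ?k M" if "w \<in> M" for w
      using scale that by (intro gen_in_tuples) auto
    have u: "u \<in> M" "scale c u \<in> M" using scale subspace_scale[OF M] by auto
    have t2: "fscale c (gen (xs @ [u] @ ys)) \<in> tuples ?k M"
      by (rule fun_vs.subspace_scale[OF sub t[OF u(1)]])
    have "ext_eval I bs x = coord_det I bs (xs @ [scale c u] @ ys) - c * coord_det I bs (xs @ [u] @ ys)"
      unfolding scale(1) using ext_eval_diff[OF t[OF u(2)] t2] ext_eval_scale[OF t[OF u(1)]]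
      by (simp add: ext_eval_gen)
    also have "\<dots> = 0" unfolding C
      using coord_scale[OF B u(1)] by (simp add: sum_distrib_left algebra_simps)
    finally show ?thesis using fun_vs.subspace_diff[OF sub t[OF u(2)] t2]
      unfolding scale(1) by blast
  next
    case dist: (3 xs)
    then show ?thesis
      using det_gram_not_distinct[of xs "[0..<?k]" "coord I bs"] gen_in_tuples[of xs M]
      by (simp add: ext_eval_gen coord_det_gram)
  next
    case zero: (4 xs)
    then obtain u as bs' where u: "u \<in> I" "xs = as @ [u] @ bs'"
      by (metis IntE append_Cons append_Nil ex_in_conv split_list)
    then have len: "length as + 1 + length bs' = ?k" using zero by simp
    obtain C where C: "\<And>u. coord_det I bs (as @ [u] @ bs') = (\<Sum>j<?k. coord I bs u j * C j)"
      using row[OF len] by blast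
    have "coord_det I bs xs = 0" unfolding u(2) C using coord_zero[OF B u(1)] by simp
    then show ?thesis using zero gen_in_tuples[of xs M] by (simp add: ext_eval_gen)
  qed
qed

lemma ext_rel_props:
  assumes B: "basis_mod I bs M" and x: "x \<in> ext_rel (length bs) M I"
  shows "x \<in> tuples (length bs) M \<and> ext_eval I bs x = 0"
  using x unfolding ext_rel_def
proof (induction rule: fun_vs.span_induct_alt)
  case base
  show ?case by (rule conjI[OF tuples_zero ext_eval_zero])
next
  case (step c x y)
  have x: "x \<in> tuples (length bs) M" and x0: "ext_eval I bs x = 0"
    using ext_relators_props[OF B step(1)] by auto
  have "fscale c x + y \<in> tuples (length bs) M"
    using step(2) x fun_vs.subspace_add[OF tuples_subspace] fun_vs.subspace_scale[OF tuples_subspace]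
    by blast
  moreover have "ext_eval I bs (fscale c x + y) = 0"
    using ext_eval_tuples[OF x, of y "length bs" M I bs c] step(2) x0 by simp
  ultimately show ?case by (rule conjI)
qed

text \<open>The relators only say that repeated entries vanish; antisymmetry follows by expanding
  the tuple with u + v in both places.\<close>

lemma gen_swap_in_ext_rel:
  assumes M: "subspace M" and xs: "set xs \<union> {u, v} \<union> set ys \<subseteq> M" "length xs + 2 + length ys = k"
  shows "gen (xs @ [u, v] @ ys) + gen (xs @ [v, u] @ ys) \<in> ext_rel k M I"
proof -
  let ?R = "ext_rel k M I"
  note sub = ext_rel_subspace[of k M I]
  let ?g = "\<lambda>a b. gen (xs @ [a, b] @ ys) :: 'b list \<Rightarrow> 'a"
  have uv: "u + v \<in> M" using subspace_add[OF M] xs by simp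
  have add1: "?g (a + b) c - ?g a c - ?g b c \<in> ?R" if "a \<in> M" "b \<in> M" "c \<in> M" for a b c
    using ext_rel_add[of xs a b "c # ys" M k I] that xs by simp
  have add2: "?g c (a + b) - ?g c a - ?g c b \<in> ?R" if "a \<in> M" "b \<in> M" "c \<in> M" for a b c
    using ext_rel_add[of "xs @ [c]" a b ys M k I] that xs by simp
  have alt: "?g a a \<in> ?R" if "a \<in> M" for a
    by (rule ext_rel_zero) (use that xs in auto)
  have u: "u \<in> M" and v: "v \<in> M" using xs by auto
  have "?g u v + ?g v u = ?g (u + v) (u + v) - (?g (u + v) (u + v) - ?g u (u + v) - ?g v (u + v))
      - (?g u (u + v) - ?g u u - ?g u v) - (?g v (u + v) - ?g v u - ?g v v) - ?g u u - ?g v v"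
    by (simp add: algebra_simps)
  also have "\<dots> \<in> ?R"
    by (intro fun_vs.subspace_diff[OF sub] add1 add2 alt u v uv)
  finally show ?thesis .
qed

text \<open>Only membership in a subspace containing the relations is tracked, so the sign of the
  permutation need not be. The list \<open>pre\<close> holds the entries that are already in
  place.\<close>

lemma gen_perm_in_subspace:
  assumes M: "subspace M" and S: "fun_vs.subspace S" "ext_rel k M I \<subseteq> S"
    and "mset xs = mset ys" "set xs \<subseteq> M" "set pre \<subseteq> M" "length pre + length xs = k"
    and "gen (pre @ ys) \<in> S"
  shows "gen (pre @ xs) \<in> S"
  using assms(4-)
proof (induction xs arbitrary: pre ys)
  case Nil
  then show ?case by simp
next
  case (Cons x xs)
  have "x \<in> set ys" using Cons.prems(1) by (metis list.set_intros(1) set_mset_mset)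
  then obtain y1 y2 where ys: "ys = y1 @ x # y2" by (meson split_list)
  have setys: "set ys \<subseteq> M" using Cons.prems(1,2) by (metis set_mset_mset)
  have lenys: "length ys = length (x # xs)" using Cons.prems(1) by (metis size_mset)
  \<comment> \<open>Carries \<open>x\<close> to the left across \<open>q\<close> by adjacent
    transpositions.\<close>
  have swap: "gen (p @ x # q @ r) \<in> S" if "gen (p @ q @ x # r) \<in> S"
    "set (p @ q @ x # r) \<subseteq> M" "length (p @ q @ x # r) = k" for p q r
    using that
  proof (induction q arbitrary: r rule: rev_induct)
    case Nil
    then show ?case by simp
  next
    case (snoc z q)
    have "gen ((p @ q) @ [z, x] @ r) + gen ((p @ q) @ [x, z] @ r) \<in> S"
      using gen_swap_in_ext_rel[OF M, of "p @ q" z x r k I] S(2) snoc.prems by auto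
    then have "gen ((p @ q) @ [z, x] @ r) + gen ((p @ q) @ [x, z] @ r) - gen ((p @ q) @ [z, x] @ r) \<in> S"
      by (rule fun_vs.subspace_diff[OF S(1)]) (use snoc.prems(1) in simp)
    then have "gen (p @ q @ x # z # r) \<in> S" by simp
    from snoc.IH[OF this] snoc.prems show ?case by simp
  qed
  have "gen (pre @ x # y1 @ y2) \<in> S"
    using swap[of pre y1 y2] Cons.prems setys lenys ys by simp
  then show ?case
    using Cons.IH[of "y1 @ y2" "pre @ [x]"] Cons.prems ys by simp
qed

text \<open>Entries are expanded one at a time: \<open>pre\<close> consists of basis vectors already
  substituted, \<open>post\<close> of the entries still arbitrary. When none is left, the tuple
  either repeats a vector, and is a relation, or is a permutation of \<open>bs\<close>.\<close>

lemma gen_in_subspace: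
  assumes B: "basis_mod I bs M" and S: "fun_vs.subspace S" "ext_rel (length bs) M I \<subseteq> S"
    and b: "gen bs \<in> S" and pre: "set pre \<subseteq> set bs" and post: "set post \<subseteq> M"
    and len: "length pre + length post = length bs"
  shows "gen (pre @ post) \<in> S"
  using pre post len
proof (induction post arbitrary: pre)
  case Nil
  have M: "subspace M" using B by (rule basis_mod_subspace')
  show ?case
  proof (cases "distinct pre")
    case True
    have "set pre = set bs"
      by (rule card_subset_eq) (use Nil True basis_mod_distinct[OF B] in \<open>auto simp: distinct_card\<close>)
    then have "mset pre = mset bs"
      using True basis_mod_distinct[OF B] set_eq_iff_mset_eq_distinct by blast
    from gen_perm_in_subspace[OF M S this, of "[]"] show ?thesis
      using Nil b basis_mod_set[OF B] by simp
  next
    case False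
    then have "gen pre \<in> ext_rel (length bs) M I"
      using Nil basis_mod_set[OF B] by (intro ext_rel_zero) auto
    then show ?thesis using S by auto
  qed
next
  case (Cons v post)
  have M: "subspace M" using B by (rule basis_mod_subspace')
  let ?R = "ext_rel (length bs) M I"
  have bM: "set bs \<subseteq> M" and IM: "I \<subseteq> M" using B by (rule basis_mod_set, rule basis_mod_subset)
  \<comment> \<open>The vectors admissible in the next position form a subspace; it contains I and
    the basis vectors, hence all of M.\<close>
  let ?P = "{w \<in> M. gen (pre @ [w] @ post) \<in> S}"
  have add: "w + w' \<in> ?P" if "w \<in> ?P" "w' \<in> ?P" for w w'
  proof -
    have "gen (pre @ [w + w'] @ post) - gen (pre @ [w] @ post) - gen (pre @ [w'] @ post) \<in> ?R"
      by (rule ext_rel_add) (use that Cons.prems bM in auto)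
    then have "gen (pre @ [w + w'] @ post) - gen (pre @ [w] @ post) - gen (pre @ [w'] @ post)
        + gen (pre @ [w] @ post) + gen (pre @ [w'] @ post) \<in> S"
      using S that by (intro fun_vs.subspace_add[OF S(1)]) auto
    then show ?thesis using that subspace_add[OF M] by simp
  qed
  have scl: "scale c w \<in> ?P" if "w \<in> ?P" for c w
  proof -
    have "gen (pre @ [scale c w] @ post) - fscale c (gen (pre @ [w] @ post)) \<in> ?R"
      by (rule ext_rel_scale) (use that Cons.prems bM in auto)
    then have "gen (pre @ [scale c w] @ post) - fscale c (gen (pre @ [w] @ post))
        + fscale c (gen (pre @ [w] @ post)) \<in> S"
      using S that by (intro fun_vs.subspace_add[OF S(1)] fun_vs.subspace_scale[OF S(1)]) auto
    then show ?thesis using that subspace_scale[OF M] by simp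
  qed
  have I: "w \<in> ?P" if "w \<in> I" for w
  proof -
    have "gen (pre @ [w] @ post) \<in> ?R"
      by (rule ext_rel_zero) (use that Cons.prems bM IM in auto)
    then show ?thesis using S that IM by auto
  qed
  have base: "w \<in> ?P" if "w \<in> set bs" for w
    using Cons.IH[of "pre @ [w]"] Cons.prems that bM by auto
  have "0 \<in> I" using basis_mod_subspace[OF B] by (rule subspace_0)
  have "subspace ?P"
    by (rule subspaceI) (use I[OF \<open>0 \<in> I\<close>] add scl in blast)+
  then have "lin_comb bs c \<in> ?P" for c
    by (rule lin_comb_in_subspace) (use base in blast)
  moreover obtain i c where "i \<in> I" "v = i + lin_comb bs c"
    using basis_mod_elim[OF B, of v] Cons.prems(2) by auto
  ultimately have "v \<in> ?P" using add I by blast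
  then show ?case by simp
qed

text \<open>By \<open>gen_in_subspace\<close> every tensor is a multiple of \<open>gen bs\<close>
  modulo relations. Applying \<open>ext_eval\<close>, which kills relations and is 1 on
  \<open>gen bs\<close>, identifies the multiple.\<close>

lemma tuples_reduce:
  assumes B: "basis_mod I bs M" and x: "x \<in> tuples (length bs) M"
  shows "x - fscale (ext_eval I bs x) (gen bs) \<in> ext_rel (length bs) M I"
proof -
  let ?R = "ext_rel (length bs) M I"
  let ?S = "fun_vs.span (insert (gen bs) (ext_relators (length bs) M I))"
  have S: "fun_vs.subspace ?S" by simp
  have RS: "?R \<subseteq> ?S" unfolding ext_rel_def by (rule fun_vs.span_mono) blast
  have bS: "gen bs \<in> ?S" by (simp add: fun_vs.span_base)
  have "tuples (length bs) M \<subseteq> ?S"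
    unfolding tuples_def
  proof (rule fun_vs.span_minimal[OF _ S], rule subsetI)
    fix z :: "'b list \<Rightarrow> 'a" assume "z \<in> {gen xs |xs. set xs \<subseteq> M \<and> length xs = length bs}"
    then obtain xs where "z = gen xs" "set xs \<subseteq> M" "length xs = length bs" by blast
    then show "z \<in> ?S" using gen_in_subspace[OF B S RS bS, of "[]" xs] by simp
  qed
  then obtain c where c: "x - fscale c (gen bs) \<in> ?R"
    using x fun_vs.span_breakdown_eq unfolding ext_rel_def by blast
  define r where "r = x - fscale c (gen bs)"
  have rc: "x = r + fscale c (gen bs)" "r \<in> ?R" using c by (simp_all add: r_def)
  have g: "gen bs \<in> tuples (length bs) M" using basis_mod_set[OF B] by (simp add: gen_in_tuples)
  have "ext_eval I bs x = ext_eval I bs r + ext_eval I bs (fscale c (gen bs))"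
    unfolding rc(1) using ext_rel_props[OF B rc(2)] fun_vs.subspace_scale[OF tuples_subspace g]
    by (blast intro: ext_eval_add)
  also have "\<dots> = c" using ext_rel_props[OF B rc(2)] ext_eval_scale[OF g]
    by (simp add: ext_eval_gen coord_det_self[OF B])
  finally show ?thesis using rc by simp
qed

lemma ext_rel_iff:
  assumes B: "basis_mod I bs M"
  shows "x \<in> ext_rel (length bs) M I \<longleftrightarrow> x \<in> tuples (length bs) M \<and> ext_eval I bs x = 0"
proof
  assume "x \<in> tuples (length bs) M \<and> ext_eval I bs x = 0"
  then show "x \<in> ext_rel (length bs) M I"
    using tuples_reduce[OF B, of x] by (simp add: fscale_zero)
next
  assume "x \<in> ext_rel (length bs) M I"
  then show "x \<in> tuples (length bs) M \<and> ext_eval I bs x = 0" by (rule ext_rel_props[OF B])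
qed

end

section \<open>Top exterior powers as lines with a coordinate\<close>

context linear_space
begin

text \<open>The coordinate of a coset on the line spanned by the wedge of \<open>bs\<close>. The
  representative is picked as in \<open>omega_wedge\<close>, so the two can be compared
  directly.\<close>

definition ext_val :: "'b set \<Rightarrow> 'b list \<Rightarrow> ('a, 'b) ext \<Rightarrow> 'a" where
  "ext_val I bs X = ext_eval I bs (SOME x. x \<in> X)"

lemma mem_ext_coset:
  assumes B: "basis_mod I bs M" and x: "x \<in> tuples (length bs) M"
    and y: "y \<in> coset (ext_rel (length bs) M I) x"
  shows "y \<in> tuples (length bs) M \<and> ext_eval I bs y = ext_eval I bs x"
proof -
  have "y - x \<in> ext_rel (length bs) M I" using y by (simp add: mem_coset_iff[OF ext_rel_subspace])
  then have d: "y - x \<in> tuples (length bs) M" "ext_eval I bs (y - x) = 0"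
    using ext_rel_iff[OF B] by auto
  have "x + (y - x) \<in> tuples (length bs) M" by (rule fun_vs.subspace_add[OF tuples_subspace x d(1)])
  moreover have "ext_eval I bs (x + (y - x)) = ext_eval I bs x" using ext_eval_add[OF x d(1)] d(2) by simp
  ultimately show ?thesis by simp
qed

lemma ext_coset_eq_iff:
  assumes B: "basis_mod I bs M" and x: "x \<in> tuples (length bs) M" and y: "y \<in> tuples (length bs) M"
  shows "coset (ext_rel (length bs) M I) x = coset (ext_rel (length bs) M I) y \<longleftrightarrow>
    ext_eval I bs x = ext_eval I bs y"
  using fun_vs.subspace_diff[OF tuples_subspace x y] ext_eval_diff[OF x y, of I bs]
  by (simp add: coset_eq_iff[OF ext_rel_subspace] ext_rel_iff[OF B])

lemma ext_some_in:
  assumes B: "basis_mod I bs M" and X: "X \<in> ext_power (length bs) M I"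
  shows "(SOME x. x \<in> X) \<in> tuples (length bs) M"
    "X = coset (ext_rel (length bs) M I) (SOME x. x \<in> X)"
proof -
  obtain x where x: "x \<in> tuples (length bs) M" "X = coset (ext_rel (length bs) M I) x"
    using X by (auto simp: ext_power_def tuples_def)
  have "(SOME x. x \<in> X) \<in> X"
    using someI[of "\<lambda>z. z \<in> X" x] x(2) coset_self[OF ext_rel_subspace] by blast
  then have e: "(SOME x. x \<in> X) \<in> coset (ext_rel (length bs) M I) x" using x(2) by simp
  show "(SOME x. x \<in> X) \<in> tuples (length bs) M" using mem_ext_coset[OF B x(1) e] by simp
  then show "X = coset (ext_rel (length bs) M I) (SOME x. x \<in> X)"
    using mem_ext_coset[OF B x(1) e] ext_coset_eq_iff[OF B x(1)] x(2) by metis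
qed

lemma ext_val_coset:
  assumes B: "basis_mod I bs M" and x: "x \<in> tuples (length bs) M"
  shows "ext_val I bs (coset (ext_rel (length bs) M I) x) = ext_eval I bs x"
proof -
  have "(SOME y. y \<in> coset (ext_rel (length bs) M I) x) \<in> coset (ext_rel (length bs) M I) x"
    by (rule someI[of "\<lambda>y. y \<in> coset (ext_rel (length bs) M I) x" x])
      (rule coset_self[OF ext_rel_subspace])
  then show ?thesis using mem_ext_coset[OF B x] by (simp add: ext_val_def)
qed

lemma ext_power_eqI:
  assumes B: "basis_mod I bs M" and X: "X \<in> ext_power (length bs) M I" and Y: "Y \<in> ext_power (length bs) M I"
    and e: "ext_val I bs X = ext_val I bs Y"
  shows "X = Y"
  using ext_some_in[OF B X] ext_some_in[OF B Y] ext_coset_eq_iff[OF B ext_some_in(1)[OF B X] ext_some_in(1)[OF B Y]] e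
  by (metis ext_val_def)

lemma ext_val_exists:
  assumes B: "basis_mod I bs M"
  obtains X where "X \<in> ext_power (length bs) M I" "ext_val I bs X = c"
proof
  let ?x = "fscale c (gen bs)"
  have g: "gen bs \<in> tuples (length bs) M" using basis_mod_set[OF B] by (simp add: gen_in_tuples)
  have x: "?x \<in> tuples (length bs) M" by (rule fun_vs.subspace_scale[OF tuples_subspace g])
  show "coset (ext_rel (length bs) M I) ?x \<in> ext_power (length bs) M I"
    using x by (simp add: ext_power_def tuples_def)
  show "ext_val I bs (coset (ext_rel (length bs) M I) ?x) = c"
    using ext_val_coset[OF B x] ext_eval_scale[OF g] by (simp add: ext_eval_gen coord_det_self[OF B])
qed

lemma ext_val_nonzero:
  assumes B: "basis_mod I bs M" and X: "X \<in> ext_power (length bs) M I" and nz: "X \<noteq> ext_rel (length bs) M I"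
  shows "ext_val I bs X \<noteq> 0"
proof
  assume "ext_val I bs X = 0"
  then have "(SOME x. x \<in> X) \<in> ext_rel (length bs) M I"
    using ext_some_in(1)[OF B X] by (simp add: ext_rel_iff[OF B] ext_val_def)
  then have "X = coset (ext_rel (length bs) M I) 0"
    using ext_some_in(2)[OF B X] coset_eq_iff[OF ext_rel_subspace, of "length bs" M I "SOME x. x \<in> X" 0] by simp
  also have "\<dots> = ext_rel (length bs) M I" by (auto simp: coset_def)
  finally show False using nz by simp
qed

lemma top_deg_eq:
  assumes "basis_mod {0} is I" "basis_mod I ms M"
  shows "top_deg M I = length ms"
  using dim_basis_mod[OF assms(1)] dim_basis_mod[OF basis_mod_append[OF assms]]
  by (simp add: top_deg_def)

lemma top_deg_zero:
  assumes "basis_mod {0} bs M" shows "top_deg M {0} = length bs"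
  using top_deg_eq[OF basis_mod_Nil[OF subspace_single_0] assms] by simp

text \<open>On generators this is \<open>coord_det_append\<close>; two nested inductions extend it
  bilinearly. It is the coordinate form of the isomorphism between the top power of M and the tensor
  product of those of I and M/I.\<close>

lemma ext_eval_conv:
  assumes B: "basis_mod {0} is I" and C: "basis_mod I ms M"
    and x: "x \<in> tuples (length is) I" and y: "y \<in> tuples (length ms) M"
  shows "ext_eval {0} (is @ ms) (conv x y) = ext_eval {0} is x * ext_eval I ms y"
  using x
proof (induction rule: tuples_induct)
  case zero
  show ?case unfolding conv_zero ext_eval_zero by simp
next
  case (step c xs x)
  have IM: "I \<subseteq> M" by (rule basis_mod_subset[OF C])
  have gx: "gen xs \<in> tuples (length is) M" "x \<in> tuples (length is) M"
    "gen xs \<in> tuples (length is) I"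
    using step gen_in_tuples[of xs I] tuples_mono[OF IM] by auto
  have "ext_eval {0} (is @ ms) (conv (gen xs) y) = ext_eval {0} is (gen xs) * ext_eval I ms y"
    using y
  proof (induction rule: tuples_induct)
    case zero
    show ?case unfolding conv_zero ext_eval_zero by simp
  next
    case (step d ys y)
    have gy: "gen ys \<in> tuples (length ms) M" using step by (simp add: gen_in_tuples)
    have IH: "ext_eval {0} (is @ ms) (conv (gen xs) y) = ext_eval {0} is (gen xs) * ext_eval I ms y"
      by (rule step.IH)
    have e1: "ext_eval {0} (is @ ms) (conv (gen xs) (fscale d (gen ys) + y)) =
        d * coord_det {0} (is @ ms) (xs @ ys) + ext_eval {0} (is @ ms) (conv (gen xs) y)"
      unfolding conv_linear_right
      using ext_eval_tuples[OF conv_tuples[OF gx(1) gy] conv_tuples[OF gx(1) step(3)]]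
      by (simp add: conv_gen ext_eval_gen)
    have e2: "coord_det {0} (is @ ms) (xs @ ys) = coord_det {0} is xs * coord_det I ms ys"
      using coord_det_append[OF B C] step \<open>set xs \<subseteq> I\<close> \<open>length xs = length is\<close> by simp
    have "ext_eval {0} (is @ ms) (conv (gen xs) (fscale d (gen ys) + y)) =
        ext_eval {0} is (gen xs) * ext_eval I ms (fscale d (gen ys) + y)"
      unfolding e1 e2 IH ext_eval_tuples[OF gy step(3)] ext_eval_gen by (simp add: distrib_left)
    then show ?case .
  qed
  note e1 = this
  have IH: "ext_eval {0} (is @ ms) (conv x y) = ext_eval {0} is x * ext_eval I ms y"
    by (rule step.IH)
  have "ext_eval {0} (is @ ms) (conv (fscale c (gen xs) + x) y) =
      ext_eval {0} is (fscale c (gen xs) + x) * ext_eval I ms y"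
    unfolding conv_linear_left ext_eval_tuples[OF conv_tuples[OF gx(1) y] conv_tuples[OF gx(2) y]]
      ext_eval_tuples[OF gx(3) step(3)] e1 IH by (simp add: distrib_right)
  then show ?case .
qed

text \<open>By \<open>ext_eval_conv\<close> the value of a product depends only on the values of its
  factors, so all cosets in the union coincide.\<close>

lemma top_mult_eq:
  assumes B: "basis_mod {0} is I" and C: "basis_mod I ms M"
    and X: "X \<in> top_ext I {0}" and Y: "Y \<in> top_ext M I"
  shows "top_mult M X Y \<in> top_ext M {0}"
    "ext_val {0} (is @ ms) (top_mult M X Y) = ext_val {0} is X * ext_val I ms Y"
proof -
  note BC = basis_mod_append[OF B C]
  note degs = top_deg_zero[OF B] top_deg_eq[OF B C] top_deg_zero[OF BC]
  let ?x = "SOME x. x \<in> X" and ?y = "SOME y. y \<in> Y"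
  have X': "X \<in> ext_power (length is) I {0}" and Y': "Y \<in> ext_power (length ms) M I"
    using X Y by (auto simp: top_ext_def degs)
  note x = ext_some_in[OF B X'] and y = ext_some_in[OF C Y']
  let ?R = "ext_rel (length (is @ ms)) M {0}"
  have cv: "conv a b \<in> tuples (length (is @ ms)) M"
    if "a \<in> tuples (length is) I" "b \<in> tuples (length ms) M" for a b :: "'b list \<Rightarrow> 'a"
    using conv_tuples[OF subsetD[OF tuples_mono[OF basis_mod_subset[OF C]] that(1)] that(2)] by simp
  have "coset ?R (conv a b) = coset ?R (conv ?x ?y)" if "a \<in> X" "b \<in> Y" for a b
  proof -
    have a: "a \<in> tuples (length is) I" "ext_eval {0} is a = ext_eval {0} is ?x"
      using mem_ext_coset[OF B x(1)] that(1) x(2) by auto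
    have b: "b \<in> tuples (length ms) M" "ext_eval I ms b = ext_eval I ms ?y"
      using mem_ext_coset[OF C y(1)] that(2) y(2) by auto
    show ?thesis
      using ext_coset_eq_iff[OF BC cv[OF a(1) b(1)] cv[OF x(1) y(1)]]
        ext_eval_conv[OF B C a(1) b(1)] ext_eval_conv[OF B C x(1) y(1)] a b by simp
  qed
  moreover have "?x \<in> X" "?y \<in> Y"
    using x(2) y(2) coset_self[OF ext_rel_subspace] by blast+
  ultimately have e: "top_mult M X Y = coset ?R (conv ?x ?y)"
    unfolding top_mult_def top_rel_def degs by blast
  show "top_mult M X Y \<in> top_ext M {0}"
    unfolding e top_ext_def degs using cv[OF x(1) y(1)] by (auto simp: ext_power_def tuples_def)
  show "ext_val {0} (is @ ms) (top_mult M X Y) = ext_val {0} is X * ext_val I ms Y"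
    unfolding e ext_val_coset[OF BC cv[OF x(1) y(1)]] ext_eval_conv[OF B C x(1) y(1)]
    by (simp add: ext_val_def)
qed

text \<open>Some decomposition exists, namely with the whole value in the factor from I and value 1
  in the factor from M/I. Of the one actually chosen only the product of the two values is known,
  which suffices for a Legendre symbol.\<close>

lemma top_decomp_eq:
  assumes B: "basis_mod {0} is I" and C: "basis_mod I ms M"
    and X: "X \<in> top_ext M {0}" and d: "top_decomp M I X = (x, y)"
  shows "x \<in> top_ext I {0}" "y \<in> top_ext M I"
    "ext_val {0} is x * ext_val I ms y = ext_val {0} (is @ ms) X"
proof -
  note BC = basis_mod_append[OF B C]
  note degs = top_deg_zero[OF B] top_deg_eq[OF B C] top_deg_zero[OF BC]
  let ?P = "\<lambda>(x, y). x \<in> top_ext I {0} \<and> y \<in> top_ext M I \<and> X = top_mult M x y"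
  obtain x' where x': "x' \<in> ext_power (length is) I {0}" "ext_val {0} is x' = ext_val {0} (is @ ms) X"
    by (rule ext_val_exists[OF B])
  obtain y' where y': "y' \<in> ext_power (length ms) M I" "ext_val I ms y' = 1"
    by (rule ext_val_exists[OF C])
  have xy: "x' \<in> top_ext I {0}" "y' \<in> top_ext M I" using x' y' by (auto simp: top_ext_def degs)
  have "X = top_mult M x' y'"
    using ext_power_eqI[OF BC, of X "top_mult M x' y'"] X top_mult_eq[OF B C xy] x' y'
    by (simp add: top_ext_def degs)
  then have "?P (x', y')" using xy by simp
  then have "?P (SOME p. ?P p)" by (rule someI[of ?P])
  then have "?P (x, y)" using d unfolding top_decomp_def by simp
  then show "x \<in> top_ext I {0}" "y \<in> top_ext M I"
    "ext_val {0} is x * ext_val I ms y = ext_val {0} (is @ ms) X"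
    using top_mult_eq(2)[OF B C] by auto
qed

text \<open>Scaling by c multiplies the value by c, and the value determines the element, so the
  defining equation has a unique solution.\<close>

lemma top_ratio_eq:
  assumes B: "basis_mod {0} bs M" and X: "X \<in> top_ext M {0}" and Y: "Y \<in> top_ext M {0}"
    and nz: "ext_val {0} bs Y \<noteq> 0"
  shows "top_ratio M X Y = ext_val {0} bs X / ext_val {0} bs Y"
proof -
  note deg = top_deg_zero[OF B]
  let ?R = "ext_rel (length bs) M {0}"
  have X': "X \<in> ext_power (length bs) M {0}" and Y': "Y \<in> ext_power (length bs) M {0}"
    using X Y by (auto simp: top_ext_def deg)
  let ?y = "SOME y. y \<in> Y"
  note y = ext_some_in[OF B Y']
  have sc: "fscale c z \<in> tuples (length bs) M" if "z \<in> tuples (length bs) M" for c :: 'a and z :: "'b list \<Rightarrow> 'a"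
    by (rule fun_vs.subspace_scale[OF tuples_subspace that])
  have e: "top_scale M c Y = coset ?R (fscale c ?y)" for c
  proof -
    have "coset ?R (fscale c b) = coset ?R (fscale c ?y)" if "b \<in> Y" for b
    proof -
      have b: "b \<in> tuples (length bs) M" "ext_eval {0} bs b = ext_eval {0} bs ?y"
        using mem_ext_coset[OF B y(1)] that y(2) by auto
      show ?thesis using ext_coset_eq_iff[OF B sc[OF b(1)] sc[OF y(1)]]
          ext_eval_scale[OF b(1)] ext_eval_scale[OF y(1)] b(2) by simp
    qed
    moreover have "?y \<in> Y" using y(2) coset_self[OF ext_rel_subspace] by blast
    ultimately show ?thesis unfolding top_scale_def top_rel_def deg by blast
  qed
  have v: "ext_val {0} bs (top_scale M c Y) = c * ext_val {0} bs Y" for c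
    unfolding e ext_val_coset[OF B sc[OF y(1)]] ext_eval_scale[OF y(1)] by (simp add: ext_val_def)
  have "top_scale M c Y \<in> ext_power (length bs) M {0}" for c
    unfolding e using sc[OF y(1)] by (auto simp: ext_power_def tuples_def)
  then have "X = top_scale M c Y \<longleftrightarrow> c = ext_val {0} bs X / ext_val {0} bs Y" for c
    using ext_power_eqI[OF B X', of "top_scale M c Y"] v[of c] nz by (auto simp: field_simps)
  then show ?thesis by (simp add: top_ratio_def)
qed

section \<open>Transport along an invertible linear map\<close>

lemma lin_comb_image:
  assumes "Vector_Spaces.linear scale scale g"
  shows "lin_comb (map g bs) c = g (lin_comb bs c)"
proof -
  interpret g: Vector_Spaces.linear scale scale g by fact
  show ?thesis by (simp add: lin_comb_def g.sum g.scale)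
qed

lemma basis_mod_image:
  assumes g: "Vector_Spaces.linear scale scale g" "inj g" and B: "basis_mod K bs W"
  shows "basis_mod (g ` K) (map g bs) (g ` W)"
proof -
  interpret g: Vector_Spaces.linear scale scale g by fact
  have "{k + lin_comb (map g bs) c |k c. k \<in> g ` K} = g ` {k + lin_comb bs c |k c. k \<in> K}"
  proof (intro equalityI subsetI)
    fix x assume "x \<in> {k + lin_comb (map g bs) c |k c. k \<in> g ` K}"
    then obtain k c where "k \<in> K" "x = g (k + lin_comb bs c)"
      by (auto simp: lin_comb_image[OF g(1)] g.add)
    then show "x \<in> g ` {k + lin_comb bs c |k c. k \<in> K}" by blast
  next
    fix x assume "x \<in> g ` {k + lin_comb bs c |k c. k \<in> K}"
    then obtain k c where "k \<in> K" "x = g k + lin_comb (map g bs) c"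
      by (auto simp: lin_comb_image[OF g(1)] g.add)
    then show "x \<in> {k + lin_comb (map g bs) c |k c. k \<in> g ` K}" by blast
  qed
  then show ?thesis
    using B g.subspace_image[of K] unfolding basis_mod_def lin_comb_image[OF g(1)]
    by (simp add: inj_image_mem_iff[OF g(2)])
qed

lemma coord_image:
  assumes g: "Vector_Spaces.linear scale scale g" "inj g" and B: "basis_mod K bs W"
    and x: "x \<in> W" and j: "j < length bs"
  shows "coord (g ` K) (map g bs) (g x) j = coord K bs x j"
proof (rule coord_eq[OF basis_mod_image[OF g B]])
  interpret g: Vector_Spaces.linear scale scale g by fact
  have "g x - lin_comb (map g bs) (coord K bs x) = g (x - lin_comb bs (coord K bs x))"
    by (simp add: lin_comb_image[OF g(1)] g.diff)
  then show "g x - lin_comb (map g bs) (coord K bs x) \<in> g ` K" using coord_ex[OF B x] by simp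
qed (use j in simp)

lemma coord_det_image:
  assumes g: "Vector_Spaces.linear scale scale g" "inj g" and B: "basis_mod K bs W"
    and xs: "set xs \<subseteq> W"
  shows "coord_det (g ` K) (map g bs) (map g xs) = coord_det K bs xs"
proof -
  have "coord_mat (g ` K) (map g bs) (map g xs) = coord_mat K bs xs"
    by (intro eq_matI)
      (use xs in \<open>auto simp: coord_mat_def intro!: coord_image[OF g B] subsetD[OF xs nth_mem]\<close>)
  then show ?thesis by (simp add: coord_det_def)
qed

lemma gen_comp_map_inv:
  assumes "bij g"
  shows "gen xs \<circ> map (inv_into UNIV g) = gen (map g xs)"
proof
  fix ys
  have gi: "g (inv_into UNIV g y) = y" "inv_into UNIV g (g x) = x" for x y
    using assms by (auto simp: bij_is_surj surj_f_inv_f bij_is_inj)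
  have "map (inv_into UNIV g) ys = xs \<longleftrightarrow> ys = map g xs"
    by (auto simp: gi comp_def)
  then show "(gen xs \<circ> map (inv_into UNIV g)) ys = gen (map g xs) ys" by (simp add: gen_def)
qed

lemma fun_comp_linear: "(fscale c x + y) \<circ> h = fscale c (x \<circ> h) + (y \<circ> h)"
  by (auto simp: fscale_def fun_eq_iff)

lemma tuples_image:
  assumes g: "bij g" and x: "x \<in> tuples k M"
  shows "x \<circ> map (inv_into UNIV g) \<in> tuples k (g ` M)"
  using x
proof (induction rule: tuples_induct)
  case zero
  have "0 \<circ> map (inv_into UNIV g) = 0" by (auto simp: fun_eq_iff)
  then show ?case using tuples_zero by metis
next
  case (step c xs y)
  have "gen (map g xs) \<in> tuples k (g ` M)" using step by (intro gen_in_tuples) auto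
  then have "fscale c (gen (map g xs)) + (y \<circ> map (inv_into UNIV g)) \<in> tuples k (g ` M)"
    using step.IH fun_vs.subspace_add[OF tuples_subspace] fun_vs.subspace_scale[OF tuples_subspace]
    by blast
  then show ?case by (simp only: fun_comp_linear gen_comp_map_inv[OF g])
qed

lemma tuples_image_surj:
  assumes g: "bij g" and y: "y \<in> tuples k (g ` M)"
  shows "\<exists>x\<in>tuples k M. y = x \<circ> map (inv_into UNIV g)"
  using y
proof (induction rule: tuples_induct)
  case zero
  have "0 = 0 \<circ> map (inv_into UNIV g)" by (auto simp: fun_eq_iff)
  then show ?case using tuples_zero by metis
next
  case (step c ys y)
  then obtain x where x: "x \<in> tuples k M" "y = x \<circ> map (inv_into UNIV g)" by blast
  define xs where "xs = map (inv_into UNIV g) ys"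
  have gi: "g (inv_into UNIV g y) = y" "inv_into UNIV g (g x) = x" for x y
    using g by (auto simp: bij_is_surj surj_f_inv_f bij_is_inj)
  have ys: "ys = map g xs" by (simp add: xs_def comp_def gi)
  have "set xs \<subseteq> M" using step(1) by (auto simp: xs_def gi)
  then have gx: "gen xs \<in> tuples k M" using step by (simp add: xs_def gen_in_tuples)
  have "fscale c (gen xs) + x \<in> tuples k M"
    using gx x(1) fun_vs.subspace_add[OF tuples_subspace] fun_vs.subspace_scale[OF tuples_subspace]
    by blast
  moreover have "fscale c (gen ys) + y = (fscale c (gen xs) + x) \<circ> map (inv_into UNIV g)"
    by (simp only: fun_comp_linear gen_comp_map_inv[OF g] ys x(2))
  ultimately show ?case by blast
qed

lemma ext_eval_image:
  assumes g: "Vector_Spaces.linear scale scale g" "bij g" and B: "basis_mod K bs W"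
    and x: "x \<in> tuples (length bs) W"
  shows "ext_eval (g ` K) (map g bs) (x \<circ> map (inv_into UNIV g)) = ext_eval K bs x"
  using x
proof (induction rule: tuples_induct)
  case zero
  have "0 \<circ> map (inv_into UNIV g) = 0" by (auto simp: fun_eq_iff)
  then show ?case using ext_eval_zero by metis
next
  case (step c xs y)
  have gx: "gen xs \<in> tuples (length bs) W" using step by (simp add: gen_in_tuples)
  have IH: "ext_eval (g ` K) (map g bs) (y \<circ> map (inv_into UNIV g)) = ext_eval K bs y"
    by (rule step.IH)
  have "ext_eval (g ` K) (map g bs) ((fscale c (gen xs) + y) \<circ> map (inv_into UNIV g)) =
      ext_eval K bs (fscale c (gen xs) + y)"
    unfolding fun_comp_linear ext_eval_tuples[OF tuples_image[OF g(2) gx] tuples_image[OF g(2) step(3)]]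
      ext_eval_tuples[OF gx step(3)] IH
    unfolding gen_comp_map_inv[OF g(2)] ext_eval_gen
      coord_det_image[OF g(1) bij_is_inj[OF g(2)] B step(1)] ..
  then show ?case .
qed

text \<open>An orientation and its image have the same coordinate in corresponding bases. This gives
  \<open>M\<close> and gM a common scalar, which later enters the coefficient as a square.\<close>

lemma ext_map_eq:
  assumes g: "Vector_Spaces.linear scale scale g" "bij g" and B: "basis_mod {0} bs M"
    and X: "X \<in> top_ext M {0}"
  shows "ext_map g X \<in> top_ext (g ` M) {0}"
    "ext_val {0} (map g bs) (ext_map g X) = ext_val {0} bs X"
proof -
  interpret g: Vector_Spaces.linear scale scale g by fact
  note inj = bij_is_inj[OF g(2)]
  have g0: "g ` {0} = {0}" by (simp add: g.zero)
  note Bg = basis_mod_image[OF g(1) inj B, unfolded g0]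
  let ?h = "map (inv_into UNIV g)"
  let ?R = "ext_rel (length bs) M {0}" and ?Rg = "ext_rel (length (map g bs)) (g ` M) {0}"
  have X': "X \<in> ext_power (length bs) M {0}" using X by (simp add: top_ext_def top_deg_zero[OF B])
  let ?x = "SOME x. x \<in> X"
  note x = ext_some_in[OF B X']
  have xh: "?x \<circ> ?h \<in> tuples (length (map g bs)) (g ` M)"
    using tuples_image[OF g(2) x(1)] by simp
  \<comment> \<open>Relations correspond exactly to relations, because on both sides they are the
    kernel of the determinant functional.\<close>
  have rel: "r \<circ> ?h \<in> ?Rg \<longleftrightarrow> r \<in> ?R" if "r \<in> tuples (length bs) M" for r
    using that ext_rel_iff[OF B, of r] ext_rel_iff[OF Bg, of "r \<circ> ?h"] tuples_image[OF g(2) that]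
      ext_eval_image[OF g B that] by (simp add: g0)
  have "ext_map g X = coset ?Rg (?x \<circ> ?h)"
  proof (intro equalityI subsetI)
    fix y assume "y \<in> ext_map g X"
    then obtain z where z: "z \<in> X" "y = z \<circ> ?h" by (auto simp: ext_map_def)
    then have zx: "z - ?x \<in> ?R" using x(2) mem_coset_iff[OF ext_rel_subspace] by blast
    then have "(z - ?x) \<circ> ?h \<in> ?Rg" using rel ext_rel_iff[OF B] by blast
    moreover have "(z - ?x) \<circ> ?h = y - (?x \<circ> ?h)" unfolding z(2) by (rule ext) simp
    ultimately show "y \<in> coset ?Rg (?x \<circ> ?h)" by (simp add: mem_coset_iff[OF ext_rel_subspace])
  next
    fix y assume "y \<in> coset ?Rg (?x \<circ> ?h)"
    then have y: "y - (?x \<circ> ?h) \<in> ?Rg" by (simp add: mem_coset_iff[OF ext_rel_subspace])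
    then obtain r where r: "r \<in> tuples (length bs) M" "y - (?x \<circ> ?h) = r \<circ> ?h"
      using ext_rel_iff[OF Bg] tuples_image_surj[OF g(2), of "y - (?x \<circ> ?h)" "length bs" M] by auto
    then have "r \<in> ?R" using rel y by simp
    then have "?x + r \<in> X" using x(2) mem_coset_iff[OF ext_rel_subspace, of "?x + r"] by auto
    moreover have "y = (?x + r) \<circ> ?h"
      using r(2) by (auto simp: fun_eq_iff algebra_simps)
    ultimately show "y \<in> ext_map g X" unfolding ext_map_def by blast
  qed
  note e = this
  show "ext_map g X \<in> top_ext (g ` M) {0}"
    unfolding e top_ext_def top_deg_zero[OF Bg] using xh by (auto simp: ext_power_def tuples_def)
  show "ext_val {0} (map g bs) (ext_map g X) = ext_val {0} bs X"
    unfolding e ext_val_coset[OF Bg xh] using ext_eval_image[OF g B x(1)] by (simp add: g0 ext_val_def)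
qed

end

section \<open>The pairing of top exterior powers induced by the symplectic form\<close>

context symplectic_space
begin

lemma bilinear_form_\<omega>: "bilinear_form \<omega>"
proof -
  have "functional_on UNIV (\<omega> x)" for x
  proof -
    interpret l: Vector_Spaces.linear scale "(*)" "\<omega> x" by (rule linear_right)
    show ?thesis by (simp add: functional_on_def l.add l.scale)
  qed
  moreover have "functional_on UNIV (\<lambda>x. \<omega> x y)" for y
  proof -
    interpret l: Vector_Spaces.linear scale "(*)" "\<lambda>x. \<omega> x y" by (rule linear_left)
    show ?thesis by (simp add: functional_on_def l.add l.scale)
  qed
  ultimately show ?thesis by (simp add: bilinear_form_def)
qed

lemmas \<omega>_simps = bilinear_form_simps[OF bilinear_form_\<omega>]

lemma \<omega>_flip: "\<omega> x y = - \<omega> y x"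
proof -
  have "\<omega> (x + y) (x + y) = 0" by (rule alternating)
  then have "\<omega> x y + \<omega> y x = 0"
    unfolding \<omega>_simps by (simp add: alternating add.commute)
  then show ?thesis by (simp add: add_eq_0_iff)
qed

text \<open>Since \<omega> pairs I trivially with both L and M, each determinant splits into the two
  coordinate determinants and one Gram determinant. The sign undoes the reversed pairing order and
  will cancel against the sign in \<open>A_coeff\<close>.\<close>

lemma omega_wedge_eq:
  assumes B: "basis_mod I ls L" and C: "basis_mod I ms M"
    and len: "length ls = n" "length ms = n"
    and LI: "\<And>x y. x \<in> L \<Longrightarrow> y \<in> I \<Longrightarrow> \<omega> x y = 0" and IM: "\<And>x y. x \<in> I \<Longrightarrow> y \<in> M \<Longrightarrow> \<omega> x y = 0"
    and X: "X \<in> ext_power n L I" and Y: "Y \<in> ext_power n M I"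
  shows "omega_wedge n X Y =
    ext_val I ls X * ext_val I ms Y * ((- 1) ^ (n choose 2) * det (gram \<omega> ls ms))"
proof -
  define x where "x = (SOME x. x \<in> X)"
  define y where "y = (SOME y. y \<in> Y)"
  have x: "x \<in> tuples n L" and y: "y \<in> tuples n M"
    using ext_some_in(1)[OF B] ext_some_in(1)[OF C] X Y len by (auto simp: x_def y_def)
  let ?W = "(- 1) ^ (n choose 2) * det (gram \<omega> ls ms)"
  have d: "det (mat n n (\<lambda>(i, j). \<omega> (as ! i) (bs ! (n - 1 - j)))) =
      coord_det I ls as * coord_det I ms bs * ?W" if "x as \<noteq> 0" "y bs \<noteq> 0" for as bs
  proof -
    have as: "set as \<subseteq> L" "length as = n" and bs: "set bs \<subseteq> M" "length bs = n"
      using tuples_support[OF x] tuples_support[OF y] that by auto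
    have "mat n n (\<lambda>(i, j). \<omega> (as ! i) (bs ! (n - 1 - j))) = gram \<omega> as (rev bs)"
      by (intro eq_matI) (use as bs in \<open>auto simp: gram_def rev_nth\<close>)
    then have "det (mat n n (\<lambda>(i, j). \<omega> (as ! i) (bs ! (n - 1 - j)))) = det (gram \<omega> as (rev bs @ []))"
      by simp
    also have "\<dots> = (- 1) ^ (n choose 2) * det (gram \<omega> as bs)"
      using det_gram_rev[of as bs "[]" \<omega>] as bs by simp
    also have "det (gram \<omega> as bs) = coord_det I ls as * det (gram \<omega> ls bs)"
      by (rule det_gram_change_left[OF B]) (use as bs len IM bilinear_form_left[OF bilinear_form_\<omega>] in auto)
    also have "det (gram \<omega> ls bs) = coord_det I ms bs * det (gram \<omega> ls ms)"
      by (rule det_gram_change_right[OF C])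
        (use as bs len LI basis_mod_set[OF B] bilinear_form_right[OF bilinear_form_\<omega>] in auto)
    finally show ?thesis by simp
  qed
  have "omega_wedge n X Y = (\<Sum>as | x as \<noteq> 0. \<Sum>bs | y bs \<noteq> 0.
      x as * y bs * (coord_det I ls as * coord_det I ms bs * ?W))"
    unfolding omega_wedge_def Let_def x_def[symmetric] y_def[symmetric]
    by (intro sum.cong refl arg_cong2[where f = "(*)"] d) auto
  also have "\<dots> = ext_eval I ls x * ext_eval I ms y * ?W"
    unfolding ext_eval_def sum_product
    unfolding sum_distrib_right
    by (intro sum.cong refl) (simp add: mult.assoc mult.left_commute)
  finally show ?thesis by (simp add: ext_val_def x_def y_def)
qed

end

section \<open>Legendre symbols and Gauss sums\<close>

lemma of_int_mod_ring_eq_iff: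
  "(of_int a :: 'p::prime_card mod_ring) = of_int b \<longleftrightarrow> [a = b] (mod int CARD('p))"
  unfolding of_int_of_int_mod_ring cong_def by transfer simp

lemma of_int_to_int_mod_ring: "of_int (to_int_mod_ring x) = (x :: 'p::prime_card mod_ring)"
  by (simp add: of_int_of_int_mod_ring)

lemma legendre_euler:
  fixes x :: "'p::prime_card mod_ring"
  assumes "odd CARD('p)"
  shows "of_int (legendre x) = x ^ ((CARD('p) - 1) div 2)"
proof -
  have p: "prime CARD('p)" by (rule prime_card)
  then have "2 < CARD('p)" using assms prime_ge_2_nat[OF p] by (cases "CARD('p) = 2") auto
  from euler_criterion[OF p this, of "to_int_mod_ring x"]
  have "(of_int (legendre x) :: 'p mod_ring) = of_int (to_int_mod_ring x ^ ((CARD('p) - 1) div 2))"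
    unfolding of_int_mod_ring_eq_iff legendre_def .
  then show ?thesis by (simp add: of_int_to_int_mod_ring)
qed

lemma legendre_values: "legendre x \<in> {- 1, 0, 1}"
  by (auto simp: legendre_def Legendre_def)

lemma of_int_eq_imp_small:
  assumes odd: "odd CARD('p::prime_card)" and a: "a \<in> {- 1, 0, 1}" and b: "b \<in> {- 1, 0, 1}"
    and "(of_int a :: 'p mod_ring) = of_int b"
  shows "a = b"
proof -
  have p: "prime CARD('p)" by (rule prime_card)
  then have "2 < CARD('p)" using odd prime_ge_2_nat[OF p] by (cases "CARD('p) = 2") auto
  then have g: "2 < int CARD('p)" by linarith
  have "int CARD('p) dvd a - b" using assms(4) by (simp add: of_int_mod_ring_eq_iff cong_iff_dvd_diff)
  moreover have "\<bar>a - b\<bar> < int CARD('p)" using a b g by auto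
  ultimately show ?thesis using dvd_imp_le_int[of "a - b" "int CARD('p)"] by force
qed

text \<open>Euler's criterion gives equality in the field, and the integers -1, 0, 1 stay distinct
  modulo an odd prime.\<close>

lemma legendre_mult:
  fixes x y :: "'p::prime_card mod_ring"
  assumes odd: "odd CARD('p)"
  shows "legendre (x * y) = legendre x * legendre y"
proof (rule of_int_eq_imp_small[OF odd legendre_values])
  show "legendre x * legendre y \<in> {- 1, 0, 1}"
    using legendre_values[of x] legendre_values[of y] by auto
  show "(of_int (legendre (x * y)) :: 'p mod_ring) = of_int (legendre x * legendre y)"
    by (simp add: legendre_euler[OF odd] power_mult_distrib)
qed

lemma legendre_iff:
  fixes x :: "'p::prime_card mod_ring"
  shows "legendre x = (if x = 0 then 0 else if \<exists>y. x = y ^ 2 then 1 else - 1)"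
proof -
  have "[to_int_mod_ring x = 0] (mod int CARD('p)) \<longleftrightarrow> x = 0"
    using of_int_mod_ring_eq_iff[of "to_int_mod_ring x" 0, where 'p='p]
    by (simp add: of_int_to_int_mod_ring)
  moreover have "QuadRes (int CARD('p)) (to_int_mod_ring x) \<longleftrightarrow> (\<exists>y. x = y ^ 2)"
  proof
    assume "QuadRes (int CARD('p)) (to_int_mod_ring x)"
    then obtain y where "[y ^ 2 = to_int_mod_ring x] (mod int CARD('p))" by (auto simp: QuadRes_def)
    then have "(of_int (y ^ 2) :: 'p mod_ring) = of_int (to_int_mod_ring x)"
      unfolding of_int_mod_ring_eq_iff .
    then have "x = of_int y ^ 2" by (simp add: of_int_to_int_mod_ring)
    then show "\<exists>y. x = y ^ 2" by blast
  next
    assume "\<exists>y. x = y ^ 2"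
    then obtain y where "x = y ^ 2" by blast
    then have "(of_int (to_int_mod_ring y ^ 2) :: 'p mod_ring) = of_int (to_int_mod_ring x)"
      by (simp add: of_int_to_int_mod_ring)
    then show "QuadRes (int CARD('p)) (to_int_mod_ring x)"
      unfolding of_int_mod_ring_eq_iff QuadRes_def by blast
  qed
  ultimately show ?thesis by (simp add: legendre_def Legendre_def)
qed

lemma legendre_square:
  "(x :: 'p::prime_card mod_ring) \<noteq> 0 \<Longrightarrow> legendre (x ^ 2) = 1"
  by (auto simp: legendre_iff)

lemma legendre_one: "legendre (1 :: 'p::prime_card mod_ring) = 1"
  using legendre_square[of "1 :: 'p mod_ring"] by simp

lemma legendre_mult_square:
  fixes x s :: "'p::prime_card mod_ring"
  assumes "odd CARD('p)" "s \<noteq> 0" shows "legendre (s ^ 2 * x) = legendre x"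
  using assms by (simp add: legendre_mult legendre_square)

lemma legendre_squared:
  "(x :: 'p::prime_card mod_ring) \<noteq> 0 \<Longrightarrow> legendre x * legendre x = 1"
  by (auto simp: legendre_iff)

lemma legendre_power:
  fixes x :: "'p::prime_card mod_ring"
  assumes "odd CARD('p)" shows "legendre (x ^ n) = legendre x ^ n"
  by (induction n) (auto simp: legendre_one legendre_mult[OF assms])

lemma (in linear_space) basis_mod_range:
  assumes "basis_mod K bs W" shows "basis_mod {0} bs (range (lin_comb bs))"
  using assms unfolding basis_mod_def
  by (auto simp: subspace_single_0 subspace_0)

text \<open>The span of \<open>bs\<close> is a complement of K in W, so each element of W is a sum
  in exactly one way.\<close>

lemma (in linear_space) sum_basis_mod:
  assumes B: "basis_mod K bs W" and L: "basis_mod {0} bs L"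
  shows "(\<Sum>x\<in>W. F x) = (\<Sum>k\<in>K. \<Sum>w\<in>L. F (k + w))"
proof -
  have LW: "L = range (lin_comb bs)" using L by (auto simp: basis_mod_def)
  have "bij_betw (\<lambda>(k, w). k + w) (K \<times> L) W"
    unfolding bij_betw_def
  proof (intro conjI)
    show "inj_on (\<lambda>(k, w). k + w) (K \<times> L)"
    proof (rule inj_onI, clarsimp)
      fix k w k' w' assume k: "k \<in> K" "k' \<in> K" "w \<in> L" "w' \<in> L" and e: "k + w = k' + w'"
      obtain c d where cd: "w = lin_comb bs c" "w' = lin_comb bs d" using k LW by auto
      have "c j = d j" if "j < length bs" for j
        using coord_lin_comb[OF B k(1) that, of c] coord_lin_comb[OF B k(2) that, of d] e cd by simp
      then have "w = w'" unfolding cd by (rule lin_comb_cong)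
      then show "k = k' \<and> w = w'" using e by simp
    qed
    show "(\<lambda>(k, w). k + w) ` (K \<times> L) = W"
      using B unfolding LW basis_mod_def by (auto simp: image_iff) 
  qed
  from sum.reindex_bij_betw[OF this, of F] show ?thesis
    by (simp add: sum.cartesian_product split_def)
qed

section \<open>Counting, discriminants and symplectic Gram determinants\<close>

context symplectic_space
begin

lemma finite_V: "finite (UNIV :: 'v set)"
proof -
  obtain B where B: "finite B" "span B = UNIV" using finite_dim by blast
  have "UNIV \<subseteq> (\<lambda>u. \<Sum>v\<in>B. scale (u v) v) ` (B \<rightarrow>\<^sub>E (UNIV :: 'p mod_ring set))"
  proof
    fix x :: 'v
    have "x \<in> span B" using B by simp
    then obtain u where "x = (\<Sum>v\<in>B. scale (u v) v)" using span_finite[OF B(1)] by auto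
    then have "x = (\<Sum>v\<in>B. scale (restrict u B v) v)" by simp
    then show "x \<in> (\<lambda>u. \<Sum>v\<in>B. scale (u v) v) ` (B \<rightarrow>\<^sub>E (UNIV :: 'p mod_ring set))"
      by (intro image_eqI[of _ _ "restrict u B"]) auto
  qed
  then show ?thesis by (rule finite_subset) (auto intro!: finite_PiE B)
qed

lemma finite_sub: "finite (A :: 'v set)"
  by (rule finite_subset[OF subset_UNIV finite_V])

lemma basis_exists:
  assumes "subspace K" "subspace W" "K \<subseteq> W"
  obtains bs where "basis_mod K bs W"
  using basis_mod_exists[OF assms finite_sub] by blast

lemma card_basis_mod: "basis_mod K bs W \<Longrightarrow> card W = card K * CARD('p) ^ length bs"
  using basis_mod_card[of K bs W] finite_sub by simp

lemma card_subspace_pos: "subspace K \<Longrightarrow> 0 < card K"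
  using subspace_0 finite_sub by (auto simp: card_gt_0_iff)

lemma CARD_gt_1: "1 < CARD('p)"
  using prime_card[where 'a='p] prime_gt_1_nat by blast

lemma basis_mod_length_eq:
  assumes "basis_mod K bs W" "basis_mod K cs W" shows "length bs = length cs"
  using card_basis_mod[OF assms(1)] card_basis_mod[OF assms(2)] CARD_gt_1
    card_subspace_pos[OF basis_mod_subspace[OF assms(1)]]
  by (simp add: power_inject_exp)

lemma coord_det_nonzero:
  assumes "basis_mod K bs W" "basis_mod K cs W" shows "coord_det K bs cs \<noteq> 0"
  using coord_det_inverse[OF assms] basis_mod_length_eq[OF assms] by fastforce

text \<open>Rows and columns transform by the same determinant, so a discriminant on W/K changes by
  a square and its Legendre symbol is intrinsic.\<close>

lemma det_gram_change_basis:
  assumes \<beta>: "bilinear_form \<beta>" and B: "basis_mod K bs W" and C: "basis_mod K cs W"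
    and z: "\<And>x y. x \<in> K \<Longrightarrow> y \<in> W \<Longrightarrow> \<beta> x y = 0" "\<And>x y. x \<in> W \<Longrightarrow> y \<in> K \<Longrightarrow> \<beta> x y = 0"
  shows "det (gram \<beta> bs bs) = coord_det K cs bs ^ 2 * det (gram \<beta> cs cs)"
proof -
  note len = basis_mod_length_eq[OF B C]
  have "det (gram \<beta> bs bs) = coord_det K cs bs * det (gram \<beta> cs bs)"
    by (rule det_gram_change_left[OF C])
      (use bilinear_form_left[OF \<beta>] z basis_mod_set[OF B] len in auto)
  also have "det (gram \<beta> cs bs) = coord_det K cs bs * det (gram \<beta> cs cs)"
    by (rule det_gram_change_right[OF C])
      (use bilinear_form_right[OF \<beta>] z basis_mod_set[OF B] basis_mod_set[OF C] len in auto)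
  finally show ?thesis by (simp add: power2_eq_square)
qed

lemma det_gram_single: "det (gram \<beta> [u] [v]) = \<beta> u v"
  by (subst det_single) (auto simp: gram_def)

text \<open>A hyperbolic plane splits off with Gram determinant \<omega>(u, v)^2, and its orthogonal
  complement in W is again nondegenerate.\<close>

lemma symplectic_subspace_det:
  assumes "basis_mod {0} bs W" and "\<And>x. x \<in> W \<Longrightarrow> (\<And>y. y \<in> W \<Longrightarrow> \<omega> x y = 0) \<Longrightarrow> x = 0"
  shows "even (length bs) \<and> (\<exists>s. s \<noteq> 0 \<and> det (gram \<omega> bs bs) = s ^ 2)"
  using assms
proof (induction "length bs" arbitrary: bs W rule: less_induct)
  case less
  note W = basis_mod_subspace'[OF less.prems(1)]
  show ?case
  proof (cases "W = {0}")
    case True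
    then have "bs = []"
      using basis_mod_length_eq[OF less.prems(1), of "[]"] basis_mod_Nil[OF subspace_single_0] by simp
    then show ?thesis by (auto intro!: exI[of _ 1] simp: gram_def)
  next
    case False
    then obtain u where u: "u \<in> W" "u \<noteq> 0" using subspace_0[OF W] by blast
    then obtain v where v: "v \<in> W" "\<omega> u v \<noteq> 0" using less.prems(2) by blast
    have vu: "\<omega> v u = - \<omega> u v" by (rule \<omega>_flip)
    define W' where "W' = {w \<in> W. \<omega> u w = 0 \<and> \<omega> v w = 0}"
    have W': "subspace W'"
      by (rule subspaceI) (auto simp: W'_def \<omega>_simps subspace_0[OF W] subspace_add[OF W] subspace_scale[OF W])
    have B1: "basis_mod W' [u] {k + scale a u |k a. k \<in> W'}"
      using basis_mod_singleton[OF W', of u] v vu by (auto simp: W'_def)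
    let ?W1 = "{k + scale a u |k a. k \<in> W'}"
    have "v \<notin> ?W1" using v by (auto simp: W'_def \<omega>_simps alternating)
    from basis_mod_singleton[OF basis_mod_subspace'[OF B1] this]
    have B2: "basis_mod ?W1 [v] {k + scale a v |k a. k \<in> ?W1}" .
    have e: "{k + scale a v |k a. k \<in> ?W1} = W"
    proof (intro equalityI subsetI)
      fix x assume x: "x \<in> W"
      \<comment> \<open>The coefficients are solved from orthogonality of x - a u - b v to
        \<open>v\<close> and to \<open>u\<close>.\<close>
      define a where "a = - \<omega> v x / \<omega> u v"
      define b where "b = \<omega> u x / \<omega> u v"
      have "x - scale a u - scale b v \<in> W'"
        using x u v by (simp add: W'_def \<omega>_simps alternating vu a_def b_def
          subspace_add[OF W] subspace_diff[OF W] subspace_scale[OF W])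
      moreover have "x = (x - scale a u - scale b v) + scale a u + scale b v" by simp
      ultimately show "x \<in> {k + scale a v |k a. k \<in> ?W1}" by blast
    next
      fix x assume "x \<in> {k + scale a v |k a. k \<in> ?W1}"
      then show "x \<in> W" using u v
        by (auto simp: W'_def intro!: subspace_add[OF W] subspace_scale[OF W])
    qed
    have uv: "basis_mod W' [u, v] W" using basis_mod_append[OF B1 B2] unfolding e by simp
    obtain bs' where bs': "basis_mod {0} bs' W'"
      using basis_exists[OF subspace_single_0 W'] subspace_0[OF W'] by blast
    have B: "basis_mod {0} (bs' @ [u, v]) W" by (rule basis_mod_append[OF bs' uv])
    have len: "length bs = length bs' + 2"
      using basis_mod_length_eq[OF less.prems(1) B] by simp
    have nd: "x = 0" if x: "x \<in> W'" "\<And>y. y \<in> W' \<Longrightarrow> \<omega> x y = 0" for x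
    proof (rule less.prems(2))
      show "x \<in> W" using x by (simp add: W'_def)
      fix y assume "y \<in> W"
      then have "y \<in> {k + scale b v |k b. k \<in> ?W1}" by (simp only: e)
      then obtain k a b where "k \<in> W'" "y = k + scale a u + scale b v" by blast
      moreover have "\<omega> x u = 0" "\<omega> x v = 0" 
        using x(1) \<omega>_flip[of x u] \<omega>_flip[of x v] by (simp_all add: W'_def)
      ultimately show "\<omega> x y = 0" using x(2) by (simp add: \<omega>_simps(2,4))
    qed
    have "length bs' < length bs" using len by simp
    from less.hyps[OF this bs' nd]
    obtain s where s: "even (length bs')" "s \<noteq> 0" "det (gram \<omega> bs' bs') = s ^ 2" by blast
    have W'0: "\<omega> x y = 0" if "x \<in> set bs'" "y \<in> {u, v}" for x y
      using that basis_mod_set[OF bs'] \<omega>_flip[of x u] \<omega>_flip[of x v] by (auto simp: W'_def)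
    \<comment> \<open>Exchanging the two columns makes the matrix diagonal, at the price of a sign
      that \<omega>(v, u) = - \<omega>(u, v) takes back.\<close>
    have "det (gram \<omega> [u, v] [u, v]) = - det (gram \<omega> [u, v] [v, u])"
      using det_gram_swap[of "[u, v]" "[u]" "[v]" "[]" \<omega>] by simp
    also have "det (gram \<omega> ([u] @ [v]) ([v] @ [u])) = \<omega> u v * \<omega> v u"
      by (subst det_gram_append_upper_zero) (auto simp: alternating det_gram_single)
    then have "- det (gram \<omega> [u, v] [v, u]) = (\<omega> u v) ^ 2" by (simp add: vu power2_eq_square)
    finally have d2: "det (gram \<omega> [u, v] [u, v]) = (\<omega> u v) ^ 2" .
    have "det (gram \<omega> (bs' @ [u, v]) (bs' @ [u, v])) = s ^ 2 * (\<omega> u v) ^ 2"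
      by (subst det_gram_append_upper_zero) (auto simp: W'0 s d2)
    moreover have "det (gram \<omega> bs bs) =
        coord_det {0} (bs' @ [u, v]) bs ^ 2 * det (gram \<omega> (bs' @ [u, v]) (bs' @ [u, v]))"
      by (rule det_gram_change_basis[OF bilinear_form_\<omega> less.prems(1) B]) (auto simp: \<omega>_simps)
    ultimately have "det (gram \<omega> bs bs) = (coord_det {0} (bs' @ [u, v]) bs * s * \<omega> u v) ^ 2"
      by (simp add: power_mult_distrib)
    moreover have "coord_det {0} (bs' @ [u, v]) bs * s * \<omega> u v \<noteq> 0"
      using coord_det_nonzero[OF B less.prems(1)] s v by simp
    ultimately have "\<exists>s. s \<noteq> 0 \<and> det (gram \<omega> bs bs) = s ^ 2" by blast
    then show ?thesis using len s(1) by simp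
  qed
qed

end

section \<open>Additive characters and quadratic Gauss sums\<close>

context weil_setting
begin

lemma two_nonzero: "(2 :: 'p mod_ring) \<noteq> 0"
proof
  assume "(2 :: 'p mod_ring) = 0"
  then have "(of_int 2 :: 'p mod_ring) = of_int 0" by simp
  then have "int CARD('p) dvd 2" by (simp add: of_int_mod_ring_eq_iff cong_0_iff del: of_int_numeral of_int_0)
  then have "CARD('p) dvd 2" by presburger
  then show False using odd_card CARD_gt_1 by (auto dest: dvd_imp_le simp: le_Suc_eq numeral_2_eq_2)
qed

lemma power_root_mod: "\<zeta> ^ (n mod CARD('p)) = \<zeta> ^ n"
proof -
  have "\<zeta> ^ n = \<zeta> ^ (CARD('p) * (n div CARD('p)) + n mod CARD('p))" by simp
  also have "\<dots> = \<zeta> ^ (n mod CARD('p))"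
    unfolding power_add power_mult root_of_unity by simp
  finally show ?thesis by simp
qed

lemma \<psi>_of_nat: "\<psi> (of_nat n) = \<zeta> ^ n"
proof -
  have "to_int_mod_ring (of_nat n :: 'p mod_ring) = int n mod int CARD('p)"
    unfolding of_nat_of_int_mod_ring o_def by transfer simp
  then show ?thesis by (simp add: \<psi>_def power_root_mod flip: of_nat_mod)
qed

lemma of_nat_surj:
  fixes z :: "'p mod_ring"
  obtains n where "z = of_nat n" "n < CARD('p)"
proof
  have r: "to_int_mod_ring z \<in> {0..<int CARD('p)}" using range_to_int_mod_ring[where 'a='p] by blast
  then have "of_nat (nat (to_int_mod_ring z)) = (of_int (to_int_mod_ring z) :: 'p mod_ring)"
    by (metis atLeastLessThan_iff of_int_of_nat_eq int_nat_eq)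
  then show "z = of_nat (nat (to_int_mod_ring z))" by (simp add: of_int_to_int_mod_ring)
  show "nat (to_int_mod_ring z) < CARD('p)" using r by auto
qed

lemma \<psi>_add: "\<psi> (x + y) = \<psi> x * \<psi> y"
  by (rule of_nat_surj[of x], rule of_nat_surj[of y])
    (simp add: \<psi>_of_nat power_add flip: of_nat_add)

lemma \<psi>_0: "\<psi> 0 = 1"
  using \<psi>_of_nat[of 0] by simp

lemma \<psi>_eq_1_iff: "\<psi> z = 1 \<longleftrightarrow> z = 0"
proof -
  obtain n where n: "z = of_nat n" "n < CARD('p)" by (rule of_nat_surj)
  have "z = 0" if "\<psi> z = 1"
    using primitive[of n] that n by (cases "n = 0") (auto simp: \<psi>_of_nat)
  then show ?thesis by (auto simp: \<psi>_0)
qed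

text \<open>Translation by a vector \<open>u\<close> with f(u) nonzero multiplies the sum by
  \<psi>(f(u)), which is not 1.\<close>

lemma sum_character:
  assumes W: "subspace W" and f: "functional_on W f"
  shows "(\<Sum>w\<in>W. \<psi> (f w)) = (if \<forall>w\<in>W. f w = 0 then of_nat (card W) else 0)"
proof (cases "\<forall>w\<in>W. f w = 0")
  case True
  then have "(\<Sum>w\<in>W. \<psi> (f w)) = (\<Sum>w\<in>W. 1)" by (intro sum.cong) (auto simp: \<psi>_0)
  then show ?thesis using True by simp
next
  case False
  then obtain u where u: "u \<in> W" "f u \<noteq> 0" by blast
  have "bij_betw (\<lambda>w. w + u) W W"
    by (rule bij_betw_byWitness[where f' = "\<lambda>w. w - u"])
      (use u subspace_add[OF W] subspace_diff[OF W] in auto)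
  from sum.reindex_bij_betw[OF this, of "\<lambda>w. \<psi> (f w)"]
  have "(\<Sum>w\<in>W. \<psi> (f w)) = (\<Sum>w\<in>W. \<psi> (f (w + u)))" by simp
  also have "\<dots> = \<psi> (f u) * (\<Sum>w\<in>W. \<psi> (f w))"
    unfolding sum_distrib_left
    by (intro sum.cong refl) (use u f in \<open>auto simp: functional_on_def \<psi>_add\<close>)
  finally have "(\<Sum>w\<in>W. \<psi> (f w)) * (1 - \<psi> (f u)) = 0" by (simp add: algebra_simps)
  then show ?thesis using u False by (auto simp: \<psi>_eq_1_iff)
qed

lemma sum_\<psi>_mult: "(\<Sum>z\<in>UNIV. \<psi> (c * z)) = (if c = 0 then of_nat CARD('p) else 0)"
proof (cases "c = 0")
  case True
  then show ?thesis by (simp add: \<psi>_0)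
next
  case False
  have "bij_betw (\<lambda>z. z + inverse c) UNIV (UNIV :: 'p mod_ring set)"
    by (rule bij_betw_byWitness[where f' = "\<lambda>w. w - inverse c"]) auto
  from sum.reindex_bij_betw[OF this, of "\<lambda>z. \<psi> (c * z)"]
  have "(\<Sum>z\<in>UNIV. \<psi> (c * z)) = (\<Sum>z\<in>UNIV. \<psi> (c * z + 1))"
    using False by (simp add: distrib_left)
  also have "\<dots> = \<psi> 1 * (\<Sum>z\<in>UNIV. \<psi> (c * z))" by (simp add: \<psi>_add sum_distrib_left mult.commute)
  finally have "(\<Sum>z\<in>UNIV. \<psi> (c * z)) * (1 - \<psi> 1) = 0" by (simp add: algebra_simps)
  then show ?thesis using False by (auto simp: \<psi>_eq_1_iff)
qed

lemma card_square_roots: "int (card {z :: 'p mod_ring. z ^ 2 = y}) = 1 + legendre y"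
proof (cases "\<exists>w. y = w ^ 2")
  case True
  then obtain w where w: "y = w ^ 2" by blast
  have "{z. z ^ 2 = y} = {w, - w}" unfolding w by (auto simp: power2_eq_iff)
  moreover have "w = - w \<longleftrightarrow> w = 0"
    using two_nonzero by (auto simp: eq_neg_iff_add_eq_0 simp flip: mult_2)
  ultimately show ?thesis using True w by (auto simp: legendre_iff)
next
  case False
  then have "{z. z ^ 2 = y} = {}" by auto
  then show ?thesis using False by (auto simp: legendre_iff dest: spec[of _ 0])
qed

definition legendre_sum :: complex where
  "legendre_sum = (\<Sum>y\<in>UNIV. of_int (legendre y) * \<psi> y)"

text \<open>Grouping by y = z^2 gives the weights 1 + (y / l). The constant part sums to zero, and y
  is replaced by \<alpha> y in the rest.\<close>

lemma gauss_eq: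
  assumes "\<alpha> \<noteq> 0" shows "gauss \<alpha> = of_int (legendre \<alpha>) * legendre_sum"
proof -
  have "gauss \<alpha> = (\<Sum>y\<in>UNIV. \<Sum>z | z \<in> UNIV \<and> z ^ 2 = y. \<psi> (\<alpha> * z ^ 2))"
    unfolding gauss_def by (rule sum.group[symmetric]) auto
  also have "\<dots> = (\<Sum>y\<in>UNIV. of_int (1 + legendre y) * \<psi> (\<alpha> * y))"
  proof (intro sum.cong refl)
    fix y
    have "(\<Sum>z | z \<in> UNIV \<and> z ^ 2 = y. \<psi> (\<alpha> * z ^ 2)) = (\<Sum>z | z ^ 2 = y. \<psi> (\<alpha> * y))"
      by (intro sum.cong) auto
    also have "\<dots> = of_int (1 + legendre y) * \<psi> (\<alpha> * y)"
      by (simp add: flip: card_square_roots)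
    finally show "(\<Sum>z | z \<in> UNIV \<and> z ^ 2 = y. \<psi> (\<alpha> * z ^ 2)) =
        of_int (1 + legendre y) * \<psi> (\<alpha> * y)" .
  qed
  also have "\<dots> = (\<Sum>y\<in>UNIV. \<psi> (\<alpha> * y)) + (\<Sum>y\<in>UNIV. of_int (legendre y) * \<psi> (\<alpha> * y))"
    by (simp add: distrib_right sum.distrib)
  also have "(\<Sum>y\<in>UNIV. \<psi> (\<alpha> * y)) = 0" using assms by (simp add: sum_\<psi>_mult)
  also have "(\<Sum>y\<in>UNIV. of_int (legendre y) * \<psi> (\<alpha> * y)) =
      (\<Sum>y\<in>UNIV. of_int (legendre \<alpha>) * (of_int (legendre (\<alpha> * y)) * \<psi> (\<alpha> * y)))"
    using legendre_squared[OF assms] unfolding legendre_mult[OF odd_card]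
    by (intro sum.cong refl) (simp add: mult.assoc[symmetric] flip: of_int_mult)
  also have "\<dots> = of_int (legendre \<alpha>) * legendre_sum"
  proof -
    have "bij_betw (\<lambda>y. \<alpha> * y) UNIV (UNIV :: 'p mod_ring set)"
      by (rule bij_betw_byWitness[where f' = "\<lambda>w. w / \<alpha>"]) (use assms in auto)
    from sum.reindex_bij_betw[OF this, of "\<lambda>y. of_int (legendre y) * \<psi> y"] show ?thesis
      by (simp add: legendre_sum_def flip: sum_distrib_left)
  qed
  finally show ?thesis by simp
qed

lemma half_nonzero: "(1 / 2 :: 'p mod_ring) \<noteq> 0"
  using two_nonzero by simp

lemma gauss_half_mult:
  assumes "\<alpha> \<noteq> 0" shows "gauss (1 / 2 * \<alpha>) = of_int (legendre \<alpha>) * gauss (1 / 2)"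
  using assms half_nonzero gauss_eq[of "1 / 2 * \<alpha>"] gauss_eq[OF half_nonzero]
  by (simp only: legendre_mult[OF odd_card] mult_eq_0_iff) (simp add: mult.commute)

text \<open>The substitution x = t + y makes the exponent \<alpha> t^2 + 2 \<alpha> t y linear in y,
  so only t = 0 survives. It yields the square of \<open>gauss (1 / 2)\<close> without deciding its
  sign.\<close>

lemma gauss_mult_neg:
  assumes "\<alpha> \<noteq> 0" shows "gauss \<alpha> * gauss (- \<alpha>) = of_nat CARD('p)"
proof -
  have "gauss \<alpha> * gauss (- \<alpha>) = (\<Sum>y\<in>UNIV. \<Sum>x\<in>UNIV. \<psi> (\<alpha> * (x ^ 2 - y ^ 2)))"
    unfolding gauss_def sum_product by (subst sum.swap) (simp add: \<psi>_add[symmetric] algebra_simps)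
  also have "\<dots> = (\<Sum>y\<in>UNIV. \<Sum>t\<in>UNIV. \<psi> (\<alpha> * t ^ 2) * \<psi> ((2 * \<alpha> * t) * y))"
  proof (rule sum.cong[OF refl])
    fix y :: "'p mod_ring"
    have "bij_betw (\<lambda>t. t + y) UNIV (UNIV :: 'p mod_ring set)"
      by (rule bij_betw_byWitness[where f' = "\<lambda>w. w - y"]) auto
    from sum.reindex_bij_betw[OF this, of "\<lambda>x. \<psi> (\<alpha> * (x ^ 2 - y ^ 2))"]
    show "(\<Sum>x\<in>UNIV. \<psi> (\<alpha> * (x ^ 2 - y ^ 2))) = (\<Sum>t\<in>UNIV. \<psi> (\<alpha> * t ^ 2) * \<psi> ((2 * \<alpha> * t) * y))"
      by (simp add: \<psi>_add[symmetric] power2_eq_square algebra_simps)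
  qed
  also have "\<dots> = (\<Sum>t\<in>UNIV. \<psi> (\<alpha> * t ^ 2) * (\<Sum>y\<in>UNIV. \<psi> ((2 * \<alpha> * t) * y)))"
    by (subst sum.swap) (simp add: sum_distrib_left)
  also have "\<dots> = (\<Sum>t\<in>(UNIV :: 'p mod_ring set). if t = 0 then of_nat CARD('p) else 0)"
    unfolding sum_\<psi>_mult by (intro sum.cong refl) (use assms two_nonzero in \<open>auto simp: \<psi>_0\<close>)
  finally show ?thesis by simp
qed

lemma gauss_half_squared: "gauss (1 / 2) ^ 2 = of_int (legendre (- 1 :: 'p mod_ring)) * of_nat CARD('p)"
proof -
  have n: "(- 1 :: 'p mod_ring) \<noteq> 0" by simp
  have "gauss (1 / 2) * gauss (1 / 2 * - 1) = of_nat CARD('p)"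
    using gauss_mult_neg[OF half_nonzero] by simp
  then have "of_int (legendre (- 1 :: 'p mod_ring)) * (of_int (legendre (- 1 :: 'p mod_ring)) * gauss (1 / 2) ^ 2)
      = of_int (legendre (- 1 :: 'p mod_ring)) * of_nat CARD('p)"
    unfolding gauss_half_mult[OF n] by (simp add: power2_eq_square algebra_simps)
  then show ?thesis
    using legendre_squared[OF n] by (simp add: mult.assoc[symmetric] flip: of_int_mult)
qed

text \<open>Diagonalization, one vector at a time. If \<beta>(u, u) were always 0, polarization,
  with 2 invertible, would make \<beta> vanish on W; so an anisotropic \<open>u\<close> exists, and
  the sum factors along its orthogonal complement.\<close>

lemma quadratic_gauss_sum:
  assumes \<beta>: "bilinear_form \<beta>" and "basis_mod {0} bs W"
    and "\<And>x y. x \<in> W \<Longrightarrow> y \<in> W \<Longrightarrow> \<beta> x y = \<beta> y x"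
    and "\<And>x. x \<in> W \<Longrightarrow> (\<And>y. y \<in> W \<Longrightarrow> \<beta> x y = 0) \<Longrightarrow> x = 0"
  shows "(\<Sum>x\<in>W. \<psi> (1 / 2 * \<beta> x x)) =
    gauss (1 / 2) ^ length bs * of_int (legendre (det (gram \<beta> bs bs)))"
  using assms(2-)
proof (induction "length bs" arbitrary: bs W rule: less_induct)
  case less
  note W = basis_mod_subspace'[OF less.prems(1)]
  note \<beta>_simps = bilinear_form_simps[OF \<beta>]
  show ?case
  proof (cases "W = {0}")
    case True
    then have "bs = []"
      using basis_mod_length_eq[OF less.prems(1), of "[]"] basis_mod_Nil[OF subspace_single_0] by simp
    then show ?thesis using True by (auto simp: gram_def \<psi>_0 \<beta>_simps legendre_one)
  next
    case False
    have "\<exists>u\<in>W. \<beta> u u \<noteq> 0"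
    proof (rule ccontr)
      assume "\<not> (\<exists>u\<in>W. \<beta> u u \<noteq> 0)"
      then have z: "\<beta> u u = 0" if "u \<in> W" for u using that by blast
      have "\<beta> x y = 0" if xy: "x \<in> W" "y \<in> W" for x y
      proof -
        have "\<beta> (x + y) (x + y) = 0" using z subspace_add[OF W xy] by blast
        then have "\<beta> x x + \<beta> y y + 2 * \<beta> x y = 0"
          unfolding \<beta>_simps using less.prems(2)[OF xy] by (simp add: algebra_simps)
        then show ?thesis using z xy two_nonzero by simp
      qed
      then have "x = 0" if "x \<in> W" for x using less.prems(3) that by blast
      then show False using False subspace_0[OF W] by blast
    qed
    then obtain u where u: "u \<in> W" "\<beta> u u \<noteq> 0" by blast
    define W' where "W' = {w \<in> W. \<beta> u w = 0}"
    have W': "subspace W'"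
      by (rule subspaceI) (auto simp: W'_def \<beta>_simps subspace_0[OF W] subspace_add[OF W] subspace_scale[OF W])
    have e: "{k + scale a u |k a. k \<in> W'} = W"
    proof (intro equalityI subsetI)
      fix x assume x: "x \<in> W"
      define a where "a = \<beta> u x / \<beta> u u"
      have "x - scale a u \<in> W'"
        using x u by (simp add: W'_def \<beta>_simps a_def subspace_diff[OF W] subspace_scale[OF W])
      moreover have "x = (x - scale a u) + scale a u" by simp
      ultimately show "x \<in> {k + scale a u |k a. k \<in> W'}" by blast
    next
      fix x assume "x \<in> {k + scale a u |k a. k \<in> W'}"
      then show "x \<in> W" using u by (auto simp: W'_def intro!: subspace_add[OF W] subspace_scale[OF W])
    qed
    have Bu: "basis_mod W' [u] W"
      using basis_mod_singleton[OF W', of u] u unfolding e by (auto simp: W'_def)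
    obtain bs' where bs': "basis_mod {0} bs' W'"
      using basis_exists[OF subspace_single_0 W'] subspace_0[OF W'] by blast
    have B: "basis_mod {0} (bs' @ [u]) W" by (rule basis_mod_append[OF bs' Bu])
    have len: "length bs = length bs' + 1"
      using basis_mod_length_eq[OF less.prems(1) B] by simp
    have W'W: "w \<in> W" "\<beta> u w = 0" "\<beta> w u = 0" if "w \<in> W'" for w
      using that u less.prems(2)[of w u] by (auto simp: W'_def)
    have nd: "x = 0" if x: "x \<in> W'" "\<And>y. y \<in> W' \<Longrightarrow> \<beta> x y = 0" for x
    proof (rule less.prems(3))
      show "x \<in> W" using x W'W by blast
      fix y assume "y \<in> W"
      then obtain k a where "k \<in> W'" "y = k + scale a u" unfolding e[symmetric] by blast
      then show "\<beta> x y = 0" using x W'W by (simp add: \<beta>_simps)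
    qed
    have IH: "(\<Sum>x\<in>W'. \<psi> (1 / 2 * \<beta> x x)) =
        gauss (1 / 2) ^ length bs' * of_int (legendre (det (gram \<beta> bs' bs')))"
      by (rule less.hyps[OF _ bs']) (use len W'W less.prems(2) nd in auto)
    have inj: "inj (\<lambda>a. scale a u)" using u by (auto simp: inj_on_def \<beta>_simps)
    have L: "basis_mod {0} [u] (range (\<lambda>a. scale a u))"
    proof -
      have "u \<notin> {0}" using u by (auto simp: \<beta>_simps)
      from basis_mod_singleton[OF subspace_single_0 this] show ?thesis
        by (simp add: full_SetCompr_eq)
    qed
    have "(\<Sum>x\<in>W. \<psi> (1 / 2 * \<beta> x x)) =
        (\<Sum>k\<in>W'. \<Sum>a\<in>UNIV. \<psi> (1 / 2 * \<beta> (k + scale a u) (k + scale a u)))"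
      unfolding sum_basis_mod[OF Bu L] by (simp add: sum.reindex[OF inj])
    also have "\<dots> = (\<Sum>k\<in>W'. \<Sum>a\<in>UNIV. \<psi> (1 / 2 * \<beta> k k) * \<psi> ((1 / 2 * \<beta> u u) * a ^ 2))"
      by (intro sum.cong refl) (simp add: \<beta>_simps W'W \<psi>_add[symmetric] power2_eq_square algebra_simps)
    also have "\<dots> = (\<Sum>k\<in>W'. \<psi> (1 / 2 * \<beta> k k)) * gauss (1 / 2 * \<beta> u u)"
      by (simp add: gauss_def sum_product)
    also have "\<dots> = gauss (1 / 2) ^ length bs *
        of_int (legendre (det (gram \<beta> bs' bs')) * legendre (\<beta> u u))"
      unfolding IH gauss_half_mult[OF u(2)] by (simp add: len)
    also have "legendre (det (gram \<beta> bs' bs')) * legendre (\<beta> u u) =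
        legendre (det (gram \<beta> (bs' @ [u]) (bs' @ [u])))"
      using W'W basis_mod_set[OF bs']
      by (subst det_gram_append_upper_zero) (auto simp: det_gram_single legendre_mult[OF odd_card])
    also have "\<dots> = legendre (det (gram \<beta> bs bs))"
      using det_gram_change_basis[OF \<beta> less.prems(1) B] coord_det_nonzero[OF B less.prems(1)]
      by (simp add: \<beta>_simps legendre_mult_square[OF odd_card])
    finally show ?thesis .
  qed
qed

end

section \<open>Adapted bases\<close>

context weil_setting
begin

lemma subspace_perp: "subspace (perp W)"
  by (rule subspaceI) (auto simp: perp_def \<omega>_simps)

text \<open>Double counting of the sum of \<psi>(\<omega>(x, w)) over all x in V and w in W: summing
  over w first detects x in \<open>perp W\<close>, summing over x first detects w = 0.\<close>

lemma card_perp: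
  assumes W: "subspace W" shows "card W * card (perp W) = card (UNIV :: 'v set)"
proof -
  have fl: "functional_on A (\<lambda>x. \<omega> x y)" "functional_on A (\<omega> y)" for A y
    by (rule bilinear_form_left[OF bilinear_form_\<omega>], rule bilinear_form_right[OF bilinear_form_\<omega>])
  have nd: "w = 0" if "\<forall>x. \<omega> x w = 0" for w
    using nondegenerate[of w] that unfolding \<omega>_flip[of _ w] by simp
  have "(\<Sum>x\<in>UNIV. \<Sum>w\<in>W. \<psi> (\<omega> x w)) = (\<Sum>x\<in>UNIV. if x \<in> perp W then of_nat (card W) else 0)"
    unfolding sum_character[OF W fl(2)] by (simp add: perp_def)
  also have "\<dots> = of_nat (card W * card (perp W))"
    by (simp add: sum.If_cases[OF finite_V] mult.commute)
  finally have "of_nat (card W * card (perp W)) = (\<Sum>w\<in>W. \<Sum>x\<in>UNIV. \<psi> (\<omega> x w))"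
    by (subst sum.swap) simp
  also have "\<dots> = (\<Sum>w\<in>W. if w = 0 then of_nat (card (UNIV :: 'v set)) else 0)"
    unfolding sum_character[OF subspace_UNIV fl(1)]
    by (intro sum.cong refl) (use nd in \<open>auto simp: \<omega>_simps\<close>)
  also have "\<dots> = of_nat (card (UNIV :: 'v set))"
    using subspace_0[OF W] finite_sub by simp
  finally show ?thesis by (simp only: of_nat_eq_iff)
qed

lemma card_image_kernel:
  assumes h: "Vector_Spaces.linear scale scale h" and W: "subspace W"
  shows "card W = card (h ` W) * card {w \<in> W. h w = 0}"
proof -
  interpret h: Vector_Spaces.linear scale scale h by fact
  have "card W = (\<Sum>w\<in>W. 1)" by simp
  also have "\<dots> = (\<Sum>y\<in>h ` W. \<Sum>w | w \<in> W \<and> h w = y. 1)"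
    by (rule sum.group[symmetric]) (auto simp: finite_sub)
  also have "\<dots> = (\<Sum>y\<in>h ` W. card {w \<in> W. h w = 0})"
  proof (rule sum.cong[OF refl])
    fix y assume "y \<in> h ` W"
    then obtain w0 where w0: "w0 \<in> W" "y = h w0" by blast
    have "bij_betw (\<lambda>w. w + w0) {w \<in> W. h w = 0} {w \<in> W. h w = y}"
      by (rule bij_betw_byWitness[where f' = "\<lambda>w. w - w0"])
        (use w0 subspace_add[OF W] subspace_diff[OF W] in \<open>auto simp: h.add h.diff\<close>)
    from bij_betw_same_card[OF this]
    show "(\<Sum>w | w \<in> W \<and> h w = y. 1) = card {w \<in> W. h w = 0}" by simp
  qed
  finally show ?thesis by simp
qed

end

text \<open>An expansion modulo L is also an expansion modulo the larger K, and coordinates are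
  unique.\<close>

lemma (in linear_space) coord_mat_restrict:
  assumes B: "basis_mod L bs A" and C: "basis_mod K bs W" and LK: "L \<subseteq> K" and xs: "set xs \<subseteq> A"
  shows "coord_mat L bs xs = coord_mat K bs xs"
  unfolding coord_mat_def
proof (rule cong_mat[OF refl refl], clarsimp)
  fix i j assume "i < length xs" "j < length bs"
  then show "coord L bs (xs ! i) j = coord K bs (xs ! i) j"
    using coord_eq[OF C] coord_ex[OF B] LK xs nth_mem by (metis subsetD)
qed

section \<open>Fixed space, image of g - 1, and the form beta\<close>

locale weil_element = weil_setting scale \<omega> \<zeta>
  for scale :: "'p::prime_card mod_ring \<Rightarrow> 'v::ab_group_add \<Rightarrow> 'v"
    and \<omega> :: "'v \<Rightarrow> 'v \<Rightarrow> 'p mod_ring" and \<zeta> :: complex +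
  fixes g :: "'v \<Rightarrow> 'v" and M :: "'v set"
  assumes g_Sp: "g \<in> Sp" and g_semisimple: "semisimple_endo g" and lagrangian_M: "lagrangian M"
begin

sublocale g: Vector_Spaces.linear scale scale g
  using g_Sp by (simp add: Sp_def)

lemma bij_g: "bij g" and g_\<omega>: "\<omega> (g x) (g y) = \<omega> x y"
  using g_Sp by (auto simp: Sp_def)

lemma g_linear: "Vector_Spaces.linear scale scale g" ..

lemma inj_g: "inj g"
  using bij_g by (rule bij_is_inj)

lemma subspace_M: "subspace M" and perp_M: "perp M = M"
  using lagrangian_M by (auto simp: lagrangian_def)

lemma \<omega>_M: "x \<in> M \<Longrightarrow> y \<in> M \<Longrightarrow> \<omega> x y = 0"
  using perp_M by (auto simp: perp_def)

definition d :: "'v \<Rightarrow> 'v" where "d x = g x - x"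

definition V1 :: "'v set" where "V1 = {v. g v = v}"
definition U :: "'v set" where "U = range d"
definition M1 :: "'v set" where "M1 = M \<inter> V1"
definition J :: "'v set" where "J = {x \<in> M. g x \<in> M}"
definition X :: "'v set" where "X = {x. d x \<in> M}"

definition \<beta> :: "'v \<Rightarrow> 'v \<Rightarrow> 'p mod_ring" where "\<beta> x y = \<omega> (d x) y"

lemma d_linear: "Vector_Spaces.linear scale scale d"
  unfolding Vector_Spaces.linear_def module_hom_def module_hom_axioms_def
  using vector_space_axioms module_axioms
  by (auto simp: d_def g.add g.scale algebra_simps scale_right_diff_distrib)

sublocale d: Vector_Spaces.linear scale scale d
  by (rule d_linear)

lemma subspaces: "subspace V1" "subspace U" "subspace M1" "subspace J" "subspace X"
proof -
  show "subspace V1"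
    by (rule subspaceI) (auto simp: V1_def g.zero g.add g.scale)
  then show "subspace M1" unfolding M1_def by (rule subspace_inter[OF subspace_M])
  show "subspace U" unfolding U_def by (rule d.subspace_image[OF subspace_UNIV])
  show "subspace J"
    by (rule subspaceI)
      (auto simp: J_def g.zero g.add g.scale subspace_0[OF subspace_M] subspace_add[OF subspace_M]
        subspace_scale[OF subspace_M])
  show "subspace X"
    by (rule subspaceI)
      (auto simp: X_def d.zero d.add d.scale subspace_0[OF subspace_M] subspace_add[OF subspace_M]
        subspace_scale[OF subspace_M])
qed

lemma bilinear_form_\<beta>: "bilinear_form \<beta>"
  by (auto simp: bilinear_form_def functional_on_def \<beta>_def \<omega>_simps d.add d.scale)

lemmas \<beta>_simps = bilinear_form_simps[OF bilinear_form_\<beta>]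

text \<open>For fixed x, invariance gives \<omega>(x, g y) = \<omega>(g x, g y) = \<omega>(x,
  y).\<close>

lemma V1_perp_U: "x \<in> V1 \<Longrightarrow> y \<in> U \<Longrightarrow> \<omega> x y = 0"
  using g_\<omega>[of x] by (auto simp: V1_def U_def d_def \<omega>_simps)

text \<open>Since \<beta> vanishes on \<open>V1\<close> on both sides, its Gram determinant can be
  taken in any basis of V/V1, in particular in a basis of \<open>U\<close>.\<close>

lemma \<beta>_V1: "x \<in> V1 \<Longrightarrow> \<beta> x y = 0" "y \<in> V1 \<Longrightarrow> \<beta> x y = 0"
proof -
  show "x \<in> V1 \<Longrightarrow> \<beta> x y = 0" by (simp add: \<beta>_def V1_def d_def \<omega>_simps)
  assume "y \<in> V1"
  then have "\<omega> y (d x) = 0" by (rule V1_perp_U) (simp add: U_def)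
  then show "\<beta> x y = 0" unfolding \<beta>_def \<omega>_flip[of "d x" y] by simp
qed

text \<open>In general \<beta>(y, x) - \<beta>(x, y) = \<omega>(d x, d y), and on \<open>X\<close>
  both d x and d y lie in the isotropic space \<open>M\<close>.\<close>

lemma \<beta>_sym: assumes "x \<in> X" "y \<in> X" shows "\<beta> x y = \<beta> y x"
proof -
  have "\<omega> (d x) (d y) = 0" using assms \<omega>_M by (simp add: X_def)
  then have "\<omega> (d x) (g y) = \<omega> (d x) y" by (simp add: d_def \<omega>_simps)
  moreover have "\<omega> (d x) (g y) = \<omega> x y - \<omega> x (g y)" by (simp add: d_def \<omega>_simps g_\<omega>)
  moreover have "\<omega> x y - \<omega> x (g y) = \<omega> (d y) x"
    unfolding \<omega>_flip[of x y] \<omega>_flip[of x "g y"] by (simp add: d_def \<omega>_simps)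
  ultimately show ?thesis by (simp add: \<beta>_def)
qed

lemma \<beta>_X_M: "x \<in> X \<Longrightarrow> y \<in> M \<Longrightarrow> \<beta> x y = 0"
  by (simp add: \<beta>_def X_def \<omega>_M)

lemma J_X: "J \<subseteq> X" and V1_X: "V1 \<subseteq> X" and J_M: "J \<subseteq> M" and M1_J: "M1 \<subseteq> J"
  using subspace_diff[OF subspace_M] subspace_0[OF subspace_M]
  by (auto simp: J_def X_def V1_def M1_def d_def)

text \<open>Semisimplicity enters here, and for -g through \<open>weil_element_neg\<close>. On an
  invariant complement W of \<open>V1\<close> the map \<open>d\<close> is injective, hence onto by
  finiteness; as \<open>d\<close> kills \<open>V1\<close>, its whole image is W.\<close>

lemma V1_U: "V1 \<inter> U = {0}" and V1_plus_U: "{k + a |k a. k \<in> V1 \<and> a \<in> U} = UNIV"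
proof -
  have "g ` V1 \<subseteq> V1" by (auto simp: V1_def)
  then have "\<exists>W. subspace W \<and> g ` W \<subseteq> W \<and> V1 \<inter> W = {0} \<and> (\<forall>v. \<exists>u\<in>V1. \<exists>w\<in>W. v = u + w)"
    using g_semisimple[unfolded semisimple_endo_def, THEN spec, of V1] subspaces(1) by simp
  then obtain W where W: "subspace W" "g ` W \<subseteq> W" "V1 \<inter> W = {0}" "\<And>v. \<exists>u\<in>V1. \<exists>w\<in>W. v = u + w"
    by metis
  have dW: "d ` W \<subseteq> W" using W(1,2) by (auto simp: d_def intro!: subspace_diff)
  have "inj_on d W"
  proof (rule inj_onI)
    fix x y assume xy: "x \<in> W" "y \<in> W" "d x = d y"
    then have "d (x - y) = 0" by (simp add: d.diff)
    then have "x - y \<in> V1 \<inter> W" using xy subspace_diff[OF W(1)] by (simp add: V1_def d_def)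
    then show "x = y" using W(3) by simp
  qed
  then have "d ` W = W" using dW finite_sub by (intro endo_inj_surj) auto
  moreover have "U \<subseteq> d ` W"
  proof
    fix y assume "y \<in> U"
    then obtain v where "y = d v" by (auto simp: U_def)
    moreover obtain u w where "u \<in> V1" "w \<in> W" "v = u + w" using W(4) by blast
    ultimately have "y = d w" by (simp add: d.add) (simp add: d_def V1_def)
    then show "y \<in> d ` W" using \<open>w \<in> W\<close> by blast
  qed
  moreover have "d ` W \<subseteq> U" by (auto simp: U_def)
  ultimately have "U = W" by simp
  then show "V1 \<inter> U = {0}" using W(3) by simp
  have "x \<in> {k + a |k a. k \<in> V1 \<and> a \<in> U}" for x using W(4)[of x] \<open>U = W\<close> by blast
  then show "{k + a |k a. k \<in> V1 \<and> a \<in> U} = UNIV" by blast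
qed

lemma nondegenerate_V1: assumes "x \<in> V1" "\<And>y. y \<in> V1 \<Longrightarrow> \<omega> x y = 0" shows "x = 0"
proof (rule nondegenerate)
  fix v obtain k a where "k \<in> V1" "a \<in> U" "v = k + a" using V1_plus_U by blast
  then show "\<omega> x v = 0" using assms V1_perp_U[of x a] by (simp add: \<omega>_simps)
qed

lemma nondegenerate_U: assumes "x \<in> U" "\<And>y. y \<in> U \<Longrightarrow> \<omega> x y = 0" shows "x = 0"
proof (rule nondegenerate)
  fix v obtain k a where ka: "k \<in> V1" "a \<in> U" "v = k + a" using V1_plus_U by blast
  then have "\<omega> x k = 0" using V1_perp_U[of k x] assms(1) unfolding \<omega>_flip[of x k] by simp
  then show "\<omega> x v = 0" using assms ka by (simp add: \<omega>_simps)
qed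

lemma card_M: "card M * card M = card (UNIV :: 'v set)"
  using card_perp[OF subspace_M] by (simp add: perp_M)

text \<open>Since \<open>\<omega> (d x) m = \<omega> (g x) (m - g m)\<close>, the space \<open>X\<close> is the preimage under \<open>g\<close> of the
  orthogonal complement of \<open>d ` M\<close>.\<close>

lemma card_X: "card X = card M * card M1"
proof -
  have e: "\<omega> (d x) m = - \<omega> (g x) (d m)" for x m
    by (simp add: d_def \<omega>_simps g_\<omega>)
  have "x \<in> X \<longleftrightarrow> g x \<in> perp (d ` M)" for x
  proof -
    have "x \<in> X \<longleftrightarrow> d x \<in> perp M" by (simp add: X_def perp_M)
    then show ?thesis by (simp add: perp_def e)
  qed
  then have "g ` X = perp (d ` M)" using bij_is_surj[OF bij_g] by (auto, metis imageI surjD)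
  then have "card X = card (perp (d ` M))"
    using card_image[OF inj_on_subset[OF inj_g subset_UNIV], of X] by simp
  then have a: "card (d ` M) * card X = card M * card M"
    using card_perp[OF d.subspace_image[OF subspace_M]] card_M by simp
  have "{w \<in> M. d w = 0} = M1" by (auto simp: M1_def V1_def d_def)
  then have b: "card M = card (d ` M) * card M1"
    using card_image_kernel[OF d_linear subspace_M] by simp
  have "card (d ` M) * card X = card (d ` M) * (card M * card M1)"
    unfolding a mult.left_commute[of "card (d ` M)" "card M" "card M1"] b[symmetric] ..
  moreover have "card (d ` M) \<noteq> 0"
    using card_subspace_pos[OF d.subspace_image[OF subspace_M]] by simp
  ultimately show ?thesis by simp
qed

end

text \<open>The bases below are adapted to the flags \<open>M1 \<subseteq> J \<subseteq> M\<close>, \<open>M1 \<subseteq> g ` J \<subseteq> M\<close> and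
  \<open>V1 \<subseteq> V1 + J \<subseteq> V1 + M \<subseteq> V1 + M + X \<subseteq> V\<close>.\<close>

locale weil_bases = weil_element scale \<omega> \<zeta> g M
  for scale :: "'p::prime_card mod_ring \<Rightarrow> 'v::ab_group_add \<Rightarrow> 'v"
    and \<omega> :: "'v \<Rightarrow> 'v \<Rightarrow> 'p mod_ring" and \<zeta> :: complex and g :: "'v \<Rightarrow> 'v" and M :: "'v set" +
  fixes v1 u j0 j1 m' m x' r :: "'v list"
  assumes v1: "basis_mod {0} v1 V1" and u: "basis_mod {0} u U"
    and j0: "basis_mod {0} j0 M1" and j1: "basis_mod M1 j1 J"
    and m': "basis_mod J m' M" and m: "basis_mod (g ` J) m M"
    and x': "basis_mod {k + a |k a. k \<in> V1 \<and> a \<in> J} x' X"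
    and r: "basis_mod {k + a |k a. k \<in> {k + a |k a. k \<in> V1 \<and> a \<in> M} \<and> a \<in> X} r UNIV"
begin

abbreviation "Q1 \<equiv> {k + a |k a. k \<in> V1 \<and> a \<in> J}"
abbreviation "Q2 \<equiv> {k + a |k a. k \<in> V1 \<and> a \<in> M}"
abbreviation "Q3 \<equiv> {k + a |k a. k \<in> Q2 \<and> a \<in> X}"

lemma g_M1: "g ` M1 = M1"
  by (force simp: M1_def V1_def)

lemma gj1: "basis_mod M1 (map g j1) (g ` J)"
  using basis_mod_image[OF g_linear inj_g j1] by (simp add: g_M1)

lemma gj0: "map g j0 = j0"
  using basis_mod_set[OF j0] by (intro map_idI) (auto simp: M1_def V1_def)

lemma M_basis: "basis_mod M1 (j1 @ m') M" and M_basis_g: "basis_mod M1 (map g j1 @ m) M"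
  by (rule basis_mod_append[OF j1 m'], rule basis_mod_append[OF gj1 m])

lemma Q2_basis: "basis_mod V1 (j1 @ m') Q2" and Q2_basis_g: "basis_mod V1 (map g j1 @ m) Q2"
  by (rule basis_mod_sum[OF M_basis subspaces(1)], simp add: M1_def,
    rule basis_mod_sum[OF M_basis_g subspaces(1)], simp add: M1_def)

text \<open>The point is that \<open>X\<close> meets V1 + M in V1 + J: if k + a lies in
  \<open>X\<close> with k in \<open>V1\<close> and a in \<open>M\<close>, then d a is in
  \<open>M\<close>, and so is g a = d a + a.\<close>

lemma Q3_basis: "basis_mod Q2 x' Q3"
proof (rule basis_mod_sum[OF x' basis_mod_subspace'[OF Q2_basis]], intro equalityI subsetI)
  fix z assume "z \<in> Q1"
  then show "z \<in> X \<inter> Q2"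
    using V1_X J_X J_M subspace_add[OF subspaces(5)] by blast
next
  fix z assume "z \<in> X \<inter> Q2"
  then obtain k a where ka: "k \<in> V1" "a \<in> M" "z = k + a" "z \<in> X" by blast
  then have "z - k \<in> X" using V1_X subspace_diff[OF subspaces(5)] by blast
  then have "d a \<in> M" using ka by (simp add: X_def)
  then have "d a + a \<in> M" using ka subspace_add[OF subspace_M] by blast
  then have "a \<in> J" using ka by (simp add: J_def d_def)
  then show "z \<in> Q1" using ka by blast
qed

text \<open>Bases for the rows and the columns. They differ only in the vectors spanning
  \<open>M\<close> modulo \<open>M1\<close>, so passing from one to the other costs exactly the
  factor \<open>C\<close>.\<close>

abbreviation "s \<equiv> (j1 @ m') @ (x' @ r)"
abbreviation "s1 \<equiv> (map g j1 @ m) @ (x' @ r)"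

lemma s_basis: "basis_mod V1 s UNIV" and s1_basis: "basis_mod V1 s1 UNIV"
  by (rule basis_mod_append[OF Q2_basis basis_mod_append[OF Q3_basis r]],
    rule basis_mod_append[OF Q2_basis_g basis_mod_append[OF Q3_basis r]])

lemma u_basis: "basis_mod V1 u UNIV"
  using basis_mod_sum[OF u subspaces(1)] V1_U V1_plus_U by (simp add: Int_commute)

text \<open>Obtained from |gJ| = |J|, \<open>card_X\<close> and |V| = |M|^2. The equality of the
  lengths of \<open>r\<close> and \<open>j1\<close> is what makes the outer blocks of the Gram
  matrix square.\<close>

lemma lengths: "length v1 + length x' = length m' + 2 * length j0" "length r = length j1"
  "length m = length m'" "length v1 + length u = 2 * (length j0 + length j1 + length m')"
  "card (UNIV :: 'v set) = CARD('p) ^ (2 * (length j0 + length j1 + length m'))"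
proof -
  have z: "card ({0} :: 'v set) = 1" by simp
  have V1: "card V1 = CARD('p) ^ length v1" using card_basis_mod[OF v1] by simp
  have M1: "card M1 = CARD('p) ^ length j0" using card_basis_mod[OF j0] by simp
  have J: "card J = CARD('p) ^ (length j0 + length j1)"
    using card_basis_mod[OF j1] M1 by (simp add: power_add)
  have M: "card M = CARD('p) ^ (length j0 + length j1 + length m')"
    using card_basis_mod[OF m'] J by (simp add: power_add)
  have "card (g ` J) = card J" by (rule card_image[OF inj_on_subset[OF inj_g subset_UNIV]])
  then have "card M = CARD('p) ^ (length j0 + length j1 + length m)"
    using card_basis_mod[OF m] J by (simp add: power_add)
  then show mm: "length m = length m'" using M CARD_gt_1 by (simp add: power_inject_exp)
  have Q1: "basis_mod V1 j1 Q1"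
    by (rule basis_mod_sum[OF j1 subspaces(1)]) (use J_M in \<open>auto simp: M1_def J_def V1_def\<close>)
  have "card X = CARD('p) ^ (length v1 + length j1 + length x')"
    using card_basis_mod[OF x'] card_basis_mod[OF Q1] V1 by (simp add: power_add)
  then have "CARD('p) ^ (length v1 + length j1 + length x') =
      CARD('p) ^ ((length j0 + length j1 + length m') + length j0)"
    using card_X M M1 by (simp add: power_add)
  then have "length v1 + length j1 + length x' = (length j0 + length j1 + length m') + length j0"
    using CARD_gt_1 power_inject_exp by blast
  then show l1: "length v1 + length x' = length m' + 2 * length j0" by simp
  show V: "card (UNIV :: 'v set) = CARD('p) ^ (2 * (length j0 + length j1 + length m'))"
    by (simp only: card_M[symmetric] M power_add[symmetric] mult_2)
  have "card (UNIV :: 'v set) = CARD('p) ^ (length v1 + length s)"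
    using card_basis_mod[OF s_basis] V1 by (simp add: power_add)
  then have "2 * (length j0 + length j1 + length m') = length v1 + length s"
    using V CARD_gt_1 power_inject_exp by metis
  then show "length r = length j1" using l1 by simp
  have "card (UNIV :: 'v set) = CARD('p) ^ (length v1 + length u)"
    using card_basis_mod[OF u_basis] V1 by (simp add: power_add)
  then show "length v1 + length u = 2 * (length j0 + length j1 + length m')"
    using V CARD_gt_1 power_inject_exp by metis
qed

text \<open>In \<open>\<And>\<^sup>t\<^sup>o\<^sup>p M\<close>, the basis \<open>j0, j1, m'\<close> represents \<open>C\<close> times the element represented by \<open>j0, g j1, m\<close>.\<close>

definition C :: "'p mod_ring" where
  "C = coord_det {0} (j0 @ (map g j1 @ m)) (j0 @ (j1 @ m'))"

text \<open>The common part \<open>j0\<close> contributes 1, and coordinates of vectors of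
  \<open>M\<close> modulo \<open>M1\<close> are also their coordinates modulo
  \<open>V1\<close>.\<close>

lemma C_eq: "C = coord_det V1 (map g j1 @ m) (j1 @ m')"
proof -
  have "C = coord_det {0} j0 j0 * coord_det M1 (map g j1 @ m) (j1 @ m')"
    unfolding C_def
    by (rule coord_det_append[OF j0 M_basis_g basis_mod_set[OF j0] refl basis_mod_set[OF M_basis]])
      (simp add: lengths)
  also have "coord_det M1 (map g j1 @ m) (j1 @ m') = coord_det V1 (map g j1 @ m) (j1 @ m')"
    unfolding coord_det_def
    by (subst coord_mat_restrict[OF M_basis_g Q2_basis_g _ basis_mod_set[OF M_basis]])
      (simp_all add: M1_def)
  finally show ?thesis using coord_det_self[OF j0] by simp
qed

text \<open>\<open>J\<close> lies in \<open>M\<close> and in \<open>X\<close>; \<beta> kills X times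
  M, and on \<open>X\<close> it is symmetric.\<close>

lemma \<beta>_j1: assumes "x \<in> set j1" shows "y \<in> M \<Longrightarrow> \<beta> x y = 0" "y \<in> X \<Longrightarrow> \<beta> x y = 0"
proof -
  have x: "x \<in> X" "x \<in> M" using assms basis_mod_set[OF j1] J_X J_M by auto
  show "y \<in> M \<Longrightarrow> \<beta> x y = 0" using \<beta>_X_M x by blast
  show "y \<in> X \<Longrightarrow> \<beta> x y = 0" using \<beta>_sym[of x y] \<beta>_X_M[of y x] x by simp
qed

text \<open>For x in \<open>M\<close> and z in \<open>J\<close> both terms of \<beta>(x, g z) =
  \<omega>(x, z) - \<omega>(x, g z) vanish, as z and g z are in \<open>M\<close>.\<close>

lemma \<beta>_gj1:
  assumes "y \<in> set (map g j1)" "x \<in> M \<or> x \<in> X" shows "\<beta> x y = 0"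
proof -
  obtain z where z: "y = g z" "z \<in> J" using assms(1) basis_mod_set[OF j1] by auto
  then have zM: "z \<in> M" "g z \<in> M" by (auto simp: J_def)
  show ?thesis
    using assms(2)
  proof
    assume "x \<in> M"
    then show ?thesis using zM \<omega>_M by (simp add: \<beta>_def d_def \<omega>_simps z g_\<omega>)
  qed (use \<beta>_X_M zM z in simp)
qed

text \<open>Exchanging the columns \<open>map g j1\<close> and \<open>r\<close> makes the matrix block triangular; since \<open>\<beta> x (g y) = \<beta> y x\<close>,
  its outer diagonal blocks are transposes of each other.\<close>

lemma det_s_s1:
  "det (gram \<beta> s s1) = (- 1) ^ length j1 * (det (gram \<beta> j1 r) ^ 2 *
     (det (gram \<omega> (map g m') m) * det (gram \<beta> x' x')))"
proof -
  let ?k = "length j1" and ?n = "length (m @ x')"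
  have set_x': "set x' \<subseteq> X" and set_m: "set m \<subseteq> M" and set_m': "set m' \<subseteq> M"
    using basis_mod_set[OF x'] basis_mod_set[OF m] basis_mod_set[OF m'] by auto
  note len = lengths
  have "det (gram \<beta> s s1) = det (gram \<beta> s (map g j1 @ ((m @ x') @ r) @ []))" by simp
  also have "\<dots> = (- 1) ^ (?k * (?n + ?k)) * det (gram \<beta> s (((m @ x') @ r) @ map g j1 @ []))"
    by (subst det_gram_swap) (simp_all add: len add.assoc)
  also have "((m @ x') @ r) @ map g j1 @ [] = (m @ x') @ r @ map g j1" by simp
  also have "det (gram \<beta> s ((m @ x') @ r @ map g j1)) =
      (- 1) ^ (?n * ?k) * det (gram \<beta> s (r @ (m @ x') @ map g j1))"
    by (subst det_gram_swap) (simp_all add: len)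
  \<comment> \<open>The exponents add up to k^2 + 2 n k, which has the parity of k.\<close>
  also have "(- 1) ^ (?k * (?n + ?k)) * ((- 1) ^ (?n * ?k) * det (gram \<beta> s (r @ (m @ x') @ map g j1))) =
      (- 1) ^ ?k * det (gram \<beta> s (r @ (m @ x') @ map g j1))"
    by (simp add: power_add[symmetric] mult.assoc[symmetric] minus_one_power_iff)
  also have "s = j1 @ (m' @ x') @ r" by simp
  also have "det (gram \<beta> (j1 @ (m' @ x') @ r) (r @ (m @ x') @ map g j1)) =
      det (gram \<beta> j1 r) * det (gram \<beta> ((m' @ x') @ r) ((m @ x') @ map g j1))"
  proof (rule det_gram_append_upper_zero)
    fix x y assume x: "x \<in> set j1" and "y \<in> set ((m @ x') @ map g j1)"
    then have "y \<in> M \<or> y \<in> X" using set_x' set_m basis_mod_set[OF gj1] by (auto simp: J_def)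
    then show "\<beta> x y = 0" using \<beta>_j1[OF x] by blast
  qed (simp_all add: len)
  also have "det (gram \<beta> ((m' @ x') @ r) ((m @ x') @ map g j1)) =
      det (gram \<beta> (m' @ x') (m @ x')) * det (gram \<beta> r (map g j1))"
  proof (rule det_gram_append_upper_zero)
    fix x y assume "x \<in> set (m' @ x')" and y: "y \<in> set (map g j1)"
    then have "x \<in> M \<or> x \<in> X" using set_x' set_m' by auto
    then show "\<beta> x y = 0" using \<beta>_gj1[OF y] by blast
  qed (simp_all add: len)
  also have "det (gram \<beta> (m' @ x') (m @ x')) = det (gram \<beta> m' m) * det (gram \<beta> x' x')"
    by (rule det_gram_append_lower_zero) (use \<beta>_X_M set_x' set_m len in auto)
  \<comment> \<open>In \<omega>(g x - x, y) the second term drops because \<open>M\<close> is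
    isotropic; what remains is the pairing of gM with \<open>M\<close> from the coefficient.\<close>
  also have "gram \<beta> m' m = gram \<omega> (map g m') m"
    by (intro eq_matI)
      (use set_m set_m' in \<open>auto simp: gram_def \<beta>_def d_def \<omega>_simps intro!: \<omega>_M subsetD[OF _ nth_mem]\<close>)
  also have "det (gram \<beta> r (map g j1)) = det (gram (\<lambda>x y. \<beta> y x) r j1)"
  proof -
    have "\<beta> x (g y) = \<beta> y x" for x y
      unfolding \<beta>_def d_def \<omega>_simps g_\<omega> \<omega>_flip[of x y] \<omega>_flip[of x "g y"] by simp
    then have "gram \<beta> r (map g j1) = gram (\<lambda>x y. \<beta> y x) r j1"
      by (intro eq_matI) (auto simp: gram_def)
    then show ?thesis by simp
  qed
  also have "\<dots> = det (gram \<beta> j1 r)"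
    using det_gram_transpose[of j1 r \<beta>] len by simp
  finally show ?thesis by (simp add: power2_eq_square ac_simps)
qed

lemma det_s_s: "det (gram \<beta> s s) = C * det (gram \<beta> s s1)"
proof -
  have "det (gram \<beta> s s) = coord_det V1 s1 s * det (gram \<beta> s s1)"
    by (rule det_gram_change_right[OF s1_basis])
      (auto simp: lengths \<beta>_V1 bilinear_form_right[OF bilinear_form_\<beta>])
  also have "coord_det V1 s1 s = C * coord_det Q2 (x' @ r) (x' @ r)"
    unfolding C_eq
    by (rule coord_det_append[OF Q2_basis_g basis_mod_append[OF Q3_basis r]])
      (use basis_mod_set[OF Q2_basis] lengths in auto)
  also have "coord_det Q2 (x' @ r) (x' @ r) = 1"
    by (rule coord_det_self[OF basis_mod_append[OF Q3_basis r]])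
  finally show ?thesis by simp
qed

text \<open>Two evaluations of one determinant: in the basis \<open>u\<close> it is a square times
  the determinant of \<open>d\<close> on \<open>U\<close>, in the adapted basis a square times the
  blocks. A nonzero left value forces every block to be nonzero, which supplies the nondegeneracy
  needed for the Gauss sum.\<close>

lemma det_relation:
  assumes E: "coord_det {0} u (map d u) \<noteq> 0"
  shows "legendre (C * det (gram \<omega> (map g m') m)) * legendre (det (gram \<beta> x' x')) =
    legendre ((- 1) ^ length j1 * coord_det {0} u (map d u))"
    and "det (gram \<beta> x' x') \<noteq> 0" "det (gram \<omega> (map g m') m) \<noteq> 0" "C \<noteq> 0"
proof -
  let ?E = "coord_det {0} u (map d u)"
  note leg = legendre_mult[OF odd_card]
  obtain t where t: "t \<noteq> 0" "det (gram \<omega> u u) = t ^ 2"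
    using symplectic_subspace_det[OF u nondegenerate_U] by blast
  have "det (gram \<beta> s s) = coord_det V1 u s ^ 2 * det (gram \<beta> u u)"
    by (rule det_gram_change_basis[OF bilinear_form_\<beta> s_basis u_basis]) (simp_all add: \<beta>_V1)
  also have "gram \<beta> u u = gram \<omega> (map d u) u"
    by (intro eq_matI) (auto simp: gram_def \<beta>_def)
  also have "det (gram \<omega> (map d u) u) = ?E * det (gram \<omega> u u)"
    by (rule det_gram_change_left[OF u])
      (auto simp: \<omega>_simps U_def bilinear_form_left[OF bilinear_form_\<omega>])
  finally have e1: "det (gram \<beta> s s) = coord_det V1 u s ^ 2 * (t ^ 2 * ?E)" by (simp add: t ac_simps)
  have sg: "coord_det V1 u s \<noteq> 0" by (rule coord_det_nonzero[OF u_basis s_basis])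
  let ?P = "det (gram \<beta> j1 r)" and ?W = "det (gram \<omega> (map g m') m)" and ?D = "det (gram \<beta> x' x')"
  have e2: "det (gram \<beta> s s) = ?P ^ 2 * ((- 1) ^ length j1 * (C * ?W * ?D))"
    unfolding det_s_s det_s_s1 by (simp add: ac_simps)
  have nz: "?P ^ 2 * ((- 1) ^ length j1 * (C * ?W * ?D)) \<noteq> 0"
    unfolding e2[symmetric] e1 using E t sg by simp
  then show "?D \<noteq> 0" "?W \<noteq> 0" "C \<noteq> 0" by auto
  have P: "?P \<noteq> 0" using nz by auto
  have "legendre ((- 1) ^ length j1 * (C * ?W * ?D)) = legendre ?E"
    using arg_cong[OF e1[unfolded e2], of legendre]
    unfolding legendre_mult_square[OF odd_card P] legendre_mult_square[OF odd_card sg]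
      legendre_mult_square[OF odd_card t(1)] .
  \<comment> \<open>The symbol of the sign squares to 1, so multiplying by it moves the sign to the
    other side.\<close>
  then have "legendre ((- 1) ^ length j1 :: 'p mod_ring) * legendre ((- 1) ^ length j1 * (C * ?W * ?D)) =
      legendre ((- 1) ^ length j1 * ?E)" by (simp add: leg)
  then have "(legendre ((- 1) ^ length j1 :: 'p mod_ring) * legendre ((- 1) ^ length j1 :: 'p mod_ring)) *
      legendre (C * ?W * ?D) = legendre ((- 1) ^ length j1 * ?E)"
    by (simp only: leg mult.assoc)
  then show "legendre (C * ?W) * legendre ?D = legendre ((- 1) ^ length j1 * ?E)"
    by (simp add: legendre_squared leg)
qed

end

section \<open>The trace as a Gauss sum\<close>

context linear_space
begin

lemma functional_sum:
  assumes W: "subspace W" and \<phi>: "functional_on W \<phi>" and "finite S" and "\<And>s. s \<in> S \<Longrightarrow> w s \<in> W"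
  shows "\<phi> (\<Sum>s\<in>S. scale (c s) (w s)) = (\<Sum>s\<in>S. c s * \<phi> (w s))"
  using assms(3,4)
proof (induction S rule: finite_induct)
  case empty
  have "\<phi> (scale 0 0) = 0 * \<phi> 0"
    using \<phi> subspace_0[OF W] unfolding functional_on_def by blast
  then show ?case by simp
next
  case (insert s S)
  have "w s \<in> W" "scale (c s) (w s) \<in> W" "(\<Sum>s\<in>S. scale (c s) (w s)) \<in> W"
    using insert.prems by (auto intro!: subspace_sum[OF W] subspace_scale[OF W])
  then show ?case using insert \<phi> by (simp add: functional_on_def)
qed

text \<open>The resolution of the identity \<open>x = \<Sum>\<^sub>s \<Lambda>\<^sub>s(x) w\<^sub>s\<close> need not come from a basis.\<close>

lemma endo_trace_resolution:
  assumes W: "subspace W" and T: "\<And>x. x \<in> W \<Longrightarrow> T x \<in> W"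
    and T_add: "\<And>x y. x \<in> W \<Longrightarrow> y \<in> W \<Longrightarrow> T (x + y) = T x + T y"
    and T_scale: "\<And>c x. x \<in> W \<Longrightarrow> T (scale c x) = scale c (T x)"
    and S: "finite S" and w: "\<And>s. s \<in> S \<Longrightarrow> w s \<in> W"
    and \<Lambda>: "\<And>s. s \<in> S \<Longrightarrow> functional_on W (\<Lambda> s)"
    and res: "\<And>x. x \<in> W \<Longrightarrow> x = (\<Sum>s\<in>S. scale (\<Lambda> s x) (w s))"
  shows "endo_trace W T = (\<Sum>s\<in>S. \<Lambda> s (T (w s)))"
proof -
  have Wspan: "W \<subseteq> span (w ` S)"
  proof
    fix x assume "x \<in> W"
    then have "x = (\<Sum>s\<in>S. scale (\<Lambda> s x) (w s))" by (rule res)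
    also have "\<dots> \<in> span (w ` S)" by (intro span_sum span_scale span_base) auto
    finally show "x \<in> span (w ` S)" .
  qed
  obtain B where B: "B \<subseteq> W" "independent B" "W \<subseteq> span B"
    using maximal_independent_subset[of W] by blast
  have "finite B" using independent_span_bound[of "w ` S" B] S B Wspan by auto
  then obtain bs where "set bs = B" "distinct bs" using finite_distinct_list by blast
  then have "ordered_basis W bs"
    using B span_minimal[OF B(1) W] by (auto simp: ordered_basis_def)
  then have "ordered_basis W (SOME bs. ordered_basis W bs)" by (rule someI[of "ordered_basis W"])
  then obtain bs where bs: "basis_mod {0} bs W" "bs = (SOME bs. ordered_basis W bs)"
    by (simp add: ordered_basis_iff)
  have bW: "bs ! i \<in> W" if "i < length bs" for i
    using basis_mod_set[OF bs(1)] that nth_mem by blast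
  have "endo_trace W T = (\<Sum>i<length bs. coord {0} bs (T (bs ! i)) i)"
    unfolding endo_trace_def Let_def bs(2)[symmetric]
    by (auto simp: endo_mat_def intro!: sum.cong representation_eq_coord[OF bs(1)] T bW)
  \<comment> \<open>Each basis vector is expanded by the resolution. After exchanging the sums, the
    inner sum over i rebuilds \<open>T (w s)\<close> from its coordinates, inside the
    functional.\<close>
  also have "\<dots> = (\<Sum>i<length bs. \<Sum>s\<in>S. \<Lambda> s (bs ! i) * coord {0} bs (T (w s)) i)"
  proof (intro sum.cong refl)
    fix i assume "i \<in> {..<length bs}"
    then have i: "i < length bs" by simp
    have "functional_on W (\<lambda>x. coord {0} bs (T x) i)"
      using functional_on_coord[OF bs(1) i] T T_add T_scale by (simp add: functional_on_def)
    from functional_sum[OF W this S, where w = w and c = "\<lambda>s. \<Lambda> s (bs ! i)", OF w] res[OF bW[OF i]]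
    show "coord {0} bs (T (bs ! i)) i = (\<Sum>s\<in>S. \<Lambda> s (bs ! i) * coord {0} bs (T (w s)) i)"
      by simp
  qed
  also have "\<dots> = (\<Sum>s\<in>S. \<Sum>i<length bs. coord {0} bs (T (w s)) i * \<Lambda> s (bs ! i))"
    by (subst sum.swap) (simp add: mult.commute)
  also have "\<dots> = (\<Sum>s\<in>S. \<Lambda> s (T (w s)))"
  proof (intro sum.cong refl)
    fix s assume s: "s \<in> S"
    have z: "\<Lambda> s x = 0" if "x \<in> {0}" for x
      using functional_sum[OF W \<Lambda>[OF s], of "{}"] that by simp
    show "(\<Sum>i<length bs. coord {0} bs (T (w s)) i * \<Lambda> s (bs ! i)) = \<Lambda> s (T (w s))"
      by (rule functional_coord[OF bs(1) \<Lambda>[OF s] z T[OF w[OF s]], symmetric])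
  qed
  finally show ?thesis .
qed

lemma ext_val_change:
  assumes B: "basis_mod I bs M" and C: "basis_mod I cs M" and len: "length cs = length bs"
    and X: "X \<in> ext_power (length bs) M I"
  shows "ext_val I cs X = coord_det I cs bs * ext_val I bs X"
proof -
  let ?x = "SOME x. x \<in> X"
  have x: "?x \<in> tuples (length bs) M" by (rule ext_some_in[OF B X])
  have "coord_det I cs xs = coord_det I bs xs * coord_det I cs bs" if xs: "?x xs \<noteq> 0" for xs
  proof (rule coord_det_trans[OF C B])
    show "set xs \<subseteq> M" "length xs = length cs" using tuples_support[OF x] xs len by auto
  qed (rule len[symmetric])
  then show ?thesis unfolding ext_val_def ext_eval_def sum_distrib_left
    by (intro sum.cong refl) (simp add: ac_simps)
qed

end

section \<open>The representation space and the averaging operator\<close>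

context weil_setting
begin

lemma hmult_assoc: "hmult (hmult a b) c = hmult a (hmult b c)"
  by (auto simp: hmult_def \<omega>_simps algebra_simps add_divide_distrib split: prod.splits)

lemma hmult_central: "hmult (z, 0) (w, v) = (z + w, v)"
  by (simp add: hmult_def \<omega>_simps)

lemma C_space_scale: "f \<in> C_space (L, oL) \<Longrightarrow> f (hmult (z, 0) h) = \<psi> z * f h"
  and C_space_inv: "f \<in> C_space (L, oL) \<Longrightarrow> x \<in> L \<Longrightarrow> f (hmult (0, x) h) = f h"
  by (simp_all add: C_space_def del: split_paired_All)

lemma C_space_central: "f \<in> C_space (L, oL) \<Longrightarrow> f (z, v) = \<psi> z * f (0, v)"
  using C_space_scale[of f L oL z "(0, v)"] by (simp add: hmult_central)

lemma C_space_translate: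
  assumes f: "f \<in> C_space (L, oL)" and x: "x \<in> L"
  shows "f (0, v) = \<psi> (1 / 2 * \<omega> x v) * f (0, x + v)"
  using C_space_inv[OF f x, of "(0, v)"] C_space_central[OF f, of "1 / 2 * \<omega> x v" "x + v"]
  by (simp add: hmult_def)

lemma C_space_subspace: "fun_vs.subspace (C_space (L, oL))"
  by (rule fun_vs.subspaceI) (auto simp: C_space_def fscale_def algebra_simps)

text \<open>Replaces chosen representatives by an average over \<open>M\<close>. Within a coset the
  summand is constant: (0, x) = (0, x - y)(0, y) because \<open>M\<close> is isotropic, and the left
  factor is absorbed by the invariance of \<open>f\<close> under L.\<close>

lemma F_op_eq:
  assumes f: "f \<in> C_space (L, oL)" and M: "subspace M" and L: "subspace L"
    and iso: "\<And>x y. x \<in> M \<Longrightarrow> y \<in> M \<Longrightarrow> \<omega> x y = 0"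
  shows "F_op (M, oM) (L, oL) f h = (\<Sum>x\<in>M. f (hmult (0, x) h)) / of_nat (card (M \<inter> L))"
proof -
  let ?I = "M \<inter> L"
  have I: "subspace ?I" by (rule subspace_inter[OF M L])
  have "(\<Sum>x\<in>M. f (hmult (0, x) h)) =
      (\<Sum>X\<in>coset ?I ` M. \<Sum>x | x \<in> M \<and> coset ?I x = X. f (hmult (0, x) h))"
    by (rule sum.group[symmetric]) (auto simp: finite_sub)
  also have "\<dots> = (\<Sum>X\<in>coset ?I ` M. of_nat (card ?I) * f (hmult (0, SOME m. m \<in> X) h))"
  proof (intro sum.cong refl)
    fix X assume "X \<in> coset ?I ` M"
    then obtain x0 where x0: "x0 \<in> M" "X = coset ?I x0" by blast
    have mem: "y \<in> coset ?I x \<longleftrightarrow> y - x \<in> ?I" for x y by (force simp: coset_def)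
    let ?y = "SOME m. m \<in> X"
    have "x0 \<in> X" using x0 subspace_0[OF I] by (simp add: mem)
    then have y: "?y \<in> X" by (rule someI[of "\<lambda>m. m \<in> X"])
    then have yM: "?y \<in> M" using x0 subspace_add[OF M, of "?y - x0" x0] by (auto simp: mem)
    have "{x. x \<in> M \<and> coset ?I x = X} = X"
    proof (intro equalityI subsetI)
      fix x assume "x \<in> {x. x \<in> M \<and> coset ?I x = X}"
      then show "x \<in> X" using mem[of x x] subspace_0[OF I] by auto
    next
      fix x assume x: "x \<in> X"
      then have d: "x - x0 \<in> ?I" using x0 mem by blast
      then have "x - x0 + x0 \<in> M" using x0(1) subspace_add[OF M] by blast
      moreover have "coset ?I x = coset ?I x0"
      proof (rule Set.set_eqI)
        fix z
        have "z - x0 = (z - x) + (x - x0)" "z - x = (z - x0) - (x - x0)" by simp_all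
        then show "z \<in> coset ?I x \<longleftrightarrow> z \<in> coset ?I x0"
          unfolding mem using d subspace_add[OF I] subspace_diff[OF I] by metis
      qed
      ultimately show "x \<in> {x. x \<in> M \<and> coset ?I x = X}" using x0 by simp
    qed
    moreover have "f (hmult (0, x) h) = f (hmult (0, ?y) h)" if x: "x \<in> X" for x
    proof -
      have "x - x0 - (?y - x0) \<in> ?I" using x y x0 mem subspace_diff[OF I] by blast
      then have i: "x - ?y \<in> M" "x - ?y \<in> L" by auto
      have "hmult (0, x - ?y) (0, ?y) = (0, x)"
        using iso[OF i(1) yM] by (simp add: hmult_def)
      then show ?thesis using C_space_inv[OF f i(2), of "hmult (0, ?y) h"]
        by (simp flip: hmult_assoc)
    qed
    moreover have "card X = card ?I"
    proof -
      have "X = (\<lambda>r. x0 + r) ` ?I" by (auto simp: x0 coset_def)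
      then show ?thesis by (simp add: card_image)
    qed
    ultimately show "(\<Sum>x | x \<in> M \<and> coset ?I x = X. f (hmult (0, x) h)) =
        of_nat (card ?I) * f (hmult (0, ?y) h)" by simp
  qed
  also have "\<dots> = of_nat (card ?I) * F_op (M, oM) (L, oL) f h"
    by (simp add: F_op_def sum_distrib_left)
  finally show ?thesis using card_subspace_pos[OF I] by simp
qed

end

section \<open>The operator of g and its trace\<close>

context weil_element
begin

lemma M_Int_gM: "M \<inter> g ` M = g ` J"
  by (auto simp: J_def)

lemma subspace_gM: "subspace (g ` M)"
  by (rule g.subspace_image[OF subspace_M])

lemma inv_g: "inv_into UNIV g (g x) = x" "g (inv_into UNIV g x) = x"
  using inj_g bij_is_surj[OF bij_g] by (auto simp: surj_f_inv_f)

abbreviation pullback :: "('p mod_ring \<times> 'v \<Rightarrow> complex) \<Rightarrow> 'p mod_ring \<times> 'v \<Rightarrow> complex" where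
  "pullback \<phi> \<equiv> \<phi> \<circ> (\<lambda>(z, v). (z, inv_into UNIV g v))"

lemma \<omega>_inv_g: "\<omega> (inv_into UNIV g x) (inv_into UNIV g y) = \<omega> x y"
  using g_\<omega>[of "inv_into UNIV g x" "inv_into UNIV g y"] by (simp add: inv_g)

lemma inv_g_add: "inv_into UNIV g (x + y) = inv_into UNIV g x + inv_into UNIV g y"
  by (metis g.add inv_g)

lemma pullback_C_space:
  assumes "\<phi> \<in> C_space (M, oM)" shows "pullback \<phi> \<in> C_space (g ` M, oL)"
proof -
  have h: "(\<lambda>(z, v). (z, inv_into UNIV g v)) (hmult a b) =
      hmult ((\<lambda>(z, v). (z, inv_into UNIV g v)) a) ((\<lambda>(z, v). (z, inv_into UNIV g v)) b)" for a b
    by (auto simp: hmult_def \<omega>_inv_g inv_g_add split: prod.splits)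
  have "inv_into UNIV g 0 = 0" using inv_g(1)[of 0] by (simp add: g.zero)
  then show ?thesis using assms
    by (auto simp: C_space_def comp_def h inv_g)
qed

lemma weil_op_eq:
  assumes "\<phi> \<in> C_space (M, oM)"
  shows "weil_op (M, oM) g \<phi> h =
    A_coeff (M, oM) (act_orient g (M, oM)) / of_nat (card J) * (\<Sum>x\<in>M. pullback \<phi> (hmult (0, x) h))"
proof -
  have "card (g ` J) = card J" by (rule card_image[OF inj_on_subset[OF inj_g subset_UNIV]])
  then show ?thesis
    using F_op_eq[OF pullback_C_space[OF assms] subspace_M subspace_gM \<omega>_M]
    by (simp add: weil_op_def T_op_def fscale_def act_orient_def M_Int_gM)
qed

lemma weil_op_C_space:
  assumes "\<phi> \<in> C_space (M, oM)"
  shows "weil_op (M, oM) g \<phi> \<in> C_space (M, oM)"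
proof -
  let ?F = "pullback \<phi>"
  \<comment> \<open>\<open>C_space\<close> is determined by the Lagrangian alone, hence the
    placeholder for the orientation.\<close>
  note pb = pullback_C_space[OF assms, of undefined]
  have "hmult (0, x) (hmult (z, 0) h) = hmult (z, 0) (hmult (0, x) h)" for x z h
    by (auto simp: hmult_def \<omega>_simps algebra_simps split: prod.splits)
  then have "weil_op (M, oM) g \<phi> (hmult (z, 0) h) = \<psi> z * weil_op (M, oM) g \<phi> h" for z h
    by (simp only: weil_op_eq[OF assms] C_space_scale[OF pb] sum_distrib_left[symmetric])
      (simp add: ac_simps)
  moreover have "weil_op (M, oM) g \<phi> (hmult (0, y) h) = weil_op (M, oM) g \<phi> h" if y: "y \<in> M" for y h
  proof -
    have "bij_betw (\<lambda>x. x + y) M M"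
      by (rule bij_betw_byWitness[where f' = "\<lambda>w. w - y"])
        (use y subspace_add[OF subspace_M] subspace_diff[OF subspace_M] in auto)
    from sum.reindex_bij_betw[OF this, of "\<lambda>x. ?F (hmult (0, x) h)"]
    have "(\<Sum>x\<in>M. ?F (hmult (0, x) h)) = (\<Sum>x\<in>M. ?F (hmult (0, x + y) h))" by (rule sym)
    also have "\<dots> = (\<Sum>x\<in>M. ?F (hmult (0, x) (hmult (0, y) h)))"
    proof (intro sum.cong refl)
      fix x assume "x \<in> M"
      then have "hmult (0, x) (0, y) = (0, x + y)" using \<omega>_M y by (simp add: hmult_def)
      then show "?F (hmult (0, x + y) h) = ?F (hmult (0, x) (hmult (0, y) h))"
        by (simp flip: hmult_assoc)
    qed
    finally show ?thesis by (simp add: weil_op_eq[OF assms])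
  qed
  ultimately show ?thesis by (simp add: C_space_def)
qed

text \<open>Averages over \<open>M\<close> of the functions supported on \<open>{(z, v) | z}\<close>.\<close>

definition bump :: "'v \<Rightarrow> 'p mod_ring \<times> 'v \<Rightarrow> complex" where
  "bump v = (\<lambda>(z, x). if x - v \<in> M then \<psi> (z - 1 / 2 * \<omega> (x - v) v) / of_nat (card M) else 0)"

lemma bump_C_space: "bump v \<in> C_space (M, oM)"
proof -
  have "bump v (hmult (z, 0) (w, x)) = \<psi> z * bump v (w, x)" for z w x
    by (simp add: hmult_central bump_def \<psi>_add[symmetric] algebra_simps)
  moreover have "bump v (hmult (0, y) (w, x)) = bump v (w, x)" if y: "y \<in> M" for y w x
  proof -
    have e: "y + x - v = y + (x - v)" by simp
    have mem: "y + (x - v) \<in> M \<longleftrightarrow> x - v \<in> M"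
      using y subspace_add[OF subspace_M] subspace_diff[OF subspace_M, of "y + (x - v)" y] by auto
    have "\<omega> y x = \<omega> y v" if "x - v \<in> M"
      using \<omega>_M[OF y that] by (simp add: \<omega>_simps)
    then have arg: "w + 1 / 2 * \<omega> y x - 1 / 2 * \<omega> (y + (x - v)) v = w - 1 / 2 * \<omega> (x - v) v"
      if "x - v \<in> M" using that by (simp only: \<omega>_simps(1)) (simp add: algebra_simps)
    have "bump v (hmult (0, y) (w, x)) = (if y + x - v \<in> M then
        \<psi> (w + 1 / 2 * \<omega> y x - 1 / 2 * \<omega> (y + x - v) v) / of_nat (card M) else 0)"
      by (simp add: bump_def hmult_def)
    also have "\<dots> = bump v (w, x)"
      unfolding e mem bump_def prod.case using arg by (simp only: cong: if_cong)
    finally show ?thesis .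
  qed
  ultimately show ?thesis by (auto simp: C_space_def)
qed

text \<open>For fixed (z, x) the term of \<open>v\<close> equals \<phi>(z, x) / |M| whenever x - v
  lies in \<open>M\<close>, and there are |M| such \<open>v\<close>. Indexing by all of V, not by
  representatives of V/M, gives an overcomplete family, as \<open>endo_trace_resolution\<close>
  permits.\<close>

lemma bump_resolution:
  assumes \<phi>: "\<phi> \<in> C_space (M, oM)"
  shows "\<phi> = (\<Sum>v\<in>UNIV. fscale (\<phi> (0, v)) (bump v))"
proof
  fix h :: "'p mod_ring \<times> 'v"
  obtain z x where h: "h = (z, x)" by force
  have "(\<Sum>v\<in>UNIV. fscale (\<phi> (0, v)) (bump v)) h = (\<Sum>v\<in>UNIV. \<phi> (0, v) * bump v h)"
  proof -
    have "(\<Sum>v\<in>A. F v) h = (\<Sum>v\<in>A. F v h)"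
      if "finite A" for A and F :: "'v \<Rightarrow> 'p mod_ring \<times> 'v \<Rightarrow> complex"
      using that by (induction A rule: finite_induct) auto
    from this[OF finite_V] show ?thesis by (simp add: fscale_def)
  qed
  also have "\<dots> = (\<Sum>v\<in>UNIV. if x - v \<in> M then \<phi> (z, x) / of_nat (card M) else 0)"
  proof (intro sum.cong refl)
    fix v
    have "\<phi> (0, v) * bump v h = \<phi> (z, x) / of_nat (card M)" if xv: "x - v \<in> M"
    proof -
      let ?t = "1 / 2 * \<omega> (x - v) v"
      have "\<phi> (0, v) = \<psi> ?t * \<phi> (0, x)" using C_space_translate[OF \<phi> xv, of v] by simp
      then have "\<phi> (0, v) * \<psi> (z - ?t) = \<psi> (?t + (z - ?t)) * \<phi> (0, x)"
        by (simp only: \<psi>_add) simp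
      also have "\<dots> = \<phi> (z, x)" using C_space_central[OF \<phi>, of z x] by simp
      finally show ?thesis using xv by (simp add: bump_def h)
    qed
    then show "\<phi> (0, v) * bump v h = (if x - v \<in> M then \<phi> (z, x) / of_nat (card M) else 0)"
      by (simp add: bump_def h)
  qed
  also have "\<dots> = of_nat (card {v. x - v \<in> M}) * (\<phi> (z, x) / of_nat (card M))"
    by (simp add: sum.If_cases[OF finite_V])
  also have "card {v. x - v \<in> M} = card M"
    by (rule bij_betw_same_card[of "\<lambda>v. x - v"], rule bij_betw_byWitness[where f' = "\<lambda>v. x - v"]) auto
  finally show "\<phi> h = (\<Sum>v\<in>UNIV. fscale (\<phi> (0, v)) (bump v)) h"
    using card_subspace_pos[OF subspace_M] by (simp add: h)
qed

text \<open>The substitution \<open>x = g\<^sup>-\<^sup>1(m + v)\<close>, \<open>m' = x - v\<close> turns the diagonal coefficients of the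
  operator into values of the quadratic form \<open>\<beta>\<close>.\<close>

lemma weil_trace_gauss:
  "weil_trace (M, oM) g = A_coeff (M, oM) (act_orient g (M, oM)) / of_nat (card J) *
     (\<Sum>x\<in>X. \<psi> (1 / 2 * \<beta> x x))"
proof -
  let ?A = "A_coeff (M, oM) (act_orient g (M, oM)) / of_nat (card J)"
  let ?W = "C_space (M, oM)" and ?T = "weil_op (M, oM) g"
  have add: "?T (\<phi> + \<phi>') = ?T \<phi> + ?T \<phi>'" if "\<phi> \<in> ?W" "\<phi>' \<in> ?W" for \<phi> \<phi>'
    by (rule ext) (simp add: weil_op_eq that fun_vs.subspace_add[OF C_space_subspace] sum.distrib
      distrib_left split_def)
  have scl: "?T (fscale c \<phi>) = fscale c (?T \<phi>)" if "\<phi> \<in> ?W" for c \<phi>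
    by (rule ext) (simp add: weil_op_eq that fun_vs.subspace_scale[OF C_space_subspace],
      simp add: fscale_def weil_op_eq[OF that] sum_distrib_left sum_divide_distrib ac_simps split_def)
  have ev: "fun_vs.functional_on ?W (\<lambda>\<phi>. \<phi> (0, v))" for v
    by (simp add: fun_vs.functional_on_def fscale_def)
  have "weil_trace (M, oM) g = (\<Sum>v\<in>UNIV. ?T (bump v) (0, v))"
    unfolding weil_trace_def
    by (rule fun_vs.endo_trace_resolution[OF C_space_subspace weil_op_C_space add scl finite_V
      bump_C_space ev bump_resolution])
  also have "\<dots> = ?A * (\<Sum>v\<in>UNIV. \<Sum>y\<in>M. pullback (bump v) (hmult (0, y) (0, v)))"
    by (simp add: weil_op_eq[OF bump_C_space] sum_distrib_left)
  also have "(\<Sum>v\<in>UNIV. \<Sum>y\<in>M. pullback (bump v) (hmult (0, y) (0, v))) =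
      (\<Sum>(v, y)\<in>UNIV \<times> M. if inv_into UNIV g (y + v) - v \<in> M then
        \<psi> (1 / 2 * \<omega> y v - 1 / 2 * \<omega> (inv_into UNIV g (y + v) - v) v) / of_nat (card M) else 0)"
    unfolding sum.cartesian_product by (intro sum.cong refl) (auto simp: hmult_def bump_def)
  also have "\<dots> = (\<Sum>(v, y)\<in>{(v, y). y \<in> M \<and> inv_into UNIV g (y + v) - v \<in> M}.
        \<psi> (1 / 2 * \<omega> y v - 1 / 2 * \<omega> (inv_into UNIV g (y + v) - v) v) / of_nat (card M))"
    by (rule sum.mono_neutral_cong_right) (auto simp: finite_V finite_sub split: if_splits)
  also have "\<dots> = (\<Sum>(x, y)\<in>X \<times> M. \<psi> (1 / 2 * \<beta> x x) / of_nat (card M))"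
  proof (rule sum.reindex_bij_witness[where i = "\<lambda>(x, y). (x - y, d x + y)"
        and j = "\<lambda>(v, y). (inv_into UNIV g (y + v), inv_into UNIV g (y + v) - v)"])
    fix a assume "a \<in> {(v, y). y \<in> M \<and> inv_into UNIV g (y + v) - v \<in> M}"
    then obtain v y where a: "a = (v, y)" "y \<in> M" "inv_into UNIV g (y + v) - v \<in> M" by auto
    define x where "x = inv_into UNIV g (y + v)"
    have gx: "g x = y + v" by (simp add: x_def inv_g)
    have dx: "d x = y - (x - v)" by (simp add: d_def gx)
    have xv: "x - v \<in> M" using a by (simp add: x_def)
    then have "d x \<in> M" unfolding dx using a subspace_diff[OF subspace_M] by blast
    then show "(case a of (v, y) \<Rightarrow> (inv_into UNIV g (y + v), inv_into UNIV g (y + v) - v)) \<in> X \<times> M"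
      using a by (simp add: X_def x_def)
    show "(case case a of (v, y) \<Rightarrow> (inv_into UNIV g (y + v), inv_into UNIV g (y + v) - v) of
        (x, y) \<Rightarrow> (x - y, d x + y)) = a"
      by (simp add: a x_def[symmetric] dx)
    \<comment> \<open>Isotropy of \<open>M\<close> replaces x by v in the second argument; inserting
      d x = y - (x - v) then gives the exponent of the diagonal coefficient.\<close>
    have "\<omega> (d x) (x - v) = 0" by (rule \<omega>_M[OF \<open>d x \<in> M\<close> xv])
    then have "\<omega> (d x) x = \<omega> (d x) v" by (simp add: \<omega>_simps)
    also have "\<dots> = \<omega> y v - \<omega> (x - v) v" unfolding dx \<omega>_simps ..
    finally have "1 / 2 * \<beta> x x = 1 / 2 * \<omega> y v - 1 / 2 * \<omega> (x - v) v"
      by (simp add: \<beta>_def right_diff_distrib)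
    then show "(case case a of (v, y) \<Rightarrow> (inv_into UNIV g (y + v), inv_into UNIV g (y + v) - v) of
        (x, y) \<Rightarrow> \<psi> (1 / 2 * \<beta> x x) / of_nat (card M)) = (case a of (v, y) \<Rightarrow>
        \<psi> (1 / 2 * \<omega> y v - 1 / 2 * \<omega> (inv_into UNIV g (y + v) - v) v) / of_nat (card M))"
      by (simp only: a(1) prod.case x_def[symmetric])
  next
    fix b assume "b \<in> X \<times> M"
    then obtain x y where b: "b = (x, y)" "x \<in> X" "y \<in> M" by auto
    have "d x + y + (x - y) = g x" by (simp add: d_def)
    then have e: "inv_into UNIV g (d x + y + (x - y)) = x" by (simp add: inv_g)
    show "(case case b of (x, y) \<Rightarrow> (x - y, d x + y) of
        (v, y) \<Rightarrow> (inv_into UNIV g (y + v), inv_into UNIV g (y + v) - v)) = b"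
      unfolding b(1) prod.case e by simp
    show "(case b of (x, y) \<Rightarrow> (x - y, d x + y)) \<in>
        {(v, y). y \<in> M \<and> inv_into UNIV g (y + v) - v \<in> M}"
      unfolding b(1) prod.case mem_Collect_eq e
      using b subspace_add[OF subspace_M] by (simp add: X_def)
  qed
  also have "\<dots> = (\<Sum>x\<in>X. \<psi> (1 / 2 * \<beta> x x))"
    using card_subspace_pos[OF subspace_M] by (simp add: sum.cartesian_product[symmetric])
  finally show ?thesis .
qed

end

section \<open>Evaluation of the trace in adapted bases\<close>

context weil_bases
begin

text \<open>V1 + J lies in the radical of \<beta> on \<open>X\<close>, so it contributes its
  cardinality; on the complement spanned by \<open>x'\<close> the form is nondegenerate because of
  \<open>D\<close>.\<close>

lemma sum_X: assumes D: "det (gram \<beta> x' x') \<noteq> 0"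
  shows "(\<Sum>x\<in>X. \<psi> (1 / 2 * \<beta> x x)) = of_nat (CARD('p)) ^ (length v1 + length j1) *
    (gauss (1 / 2) ^ length x' * of_int (legendre (det (gram \<beta> x' x'))))"
proof -
  let ?L = "range (lin_comb x')"
  have L: "basis_mod {0} x' ?L" by (rule basis_mod_range[OF x'])
  have Q1: "basis_mod V1 j1 Q1"
    by (rule basis_mod_sum[OF j1 subspaces(1)]) (use J_M in \<open>auto simp: M1_def J_def V1_def\<close>)
  have LX: "?L \<subseteq> X" using basis_mod_lin_comb[OF x'] by auto
  have Q1X: "Q1 \<subseteq> X" by (rule basis_mod_subset[OF x'])
  have rad: "\<beta> k y = 0" "\<beta> y k = 0" if k: "k \<in> Q1" and y: "y \<in> X" for k y
  proof -
    obtain v j where vj: "v \<in> V1" "j \<in> J" "k = v + j" using k by blast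
    then show "\<beta> y k = 0" using \<beta>_V1 \<beta>_X_M[OF y] J_M by (auto simp: \<beta>_simps)
    then show "\<beta> k y = 0" using \<beta>_sym[of k y] k y Q1X by auto
  qed
  have "(\<Sum>x\<in>X. \<psi> (1 / 2 * \<beta> x x)) = (\<Sum>k\<in>Q1. \<Sum>w\<in>?L. \<psi> (1 / 2 * \<beta> (k + w) (k + w)))"
    by (rule sum_basis_mod[OF x' L])
  also have "\<dots> = (\<Sum>k\<in>Q1. \<Sum>w\<in>?L. \<psi> (1 / 2 * \<beta> w w))"
  proof (intro sum.cong refl)
    fix k w assume "k \<in> Q1" "w \<in> ?L"
    then show "\<psi> (1 / 2 * \<beta> (k + w) (k + w)) = \<psi> (1 / 2 * \<beta> w w)"
      using rad[of k w] rad[of k k] LX Q1X by (simp add: \<beta>_simps subset_iff)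
  qed
  also have "\<dots> = of_nat (card Q1) * (\<Sum>w\<in>?L. \<psi> (1 / 2 * \<beta> w w))" by simp
  also have "card Q1 = CARD('p) ^ (length v1 + length j1)"
    using card_basis_mod[OF Q1] card_basis_mod[OF v1] by (simp add: power_add)
  also have "(\<Sum>w\<in>?L. \<psi> (1 / 2 * \<beta> w w)) =
      gauss (1 / 2) ^ length x' * of_int (legendre (det (gram \<beta> x' x')))"
  proof (rule quadratic_gauss_sum[OF bilinear_form_\<beta> L])
    fix x y assume "x \<in> ?L" "y \<in> ?L"
    then show "\<beta> x y = \<beta> y x" using LX by (intro \<beta>_sym) auto
  next
    fix x assume x: "x \<in> ?L" and z: "\<And>y. y \<in> ?L \<Longrightarrow> \<beta> x y = 0"
    obtain c where c: "x = lin_comb x' c" using x by blast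
    let ?n = "length x'" and ?G = "gram \<beta> x' x'" and ?v = "vec (length x') c"
    have G: "?G \<in> carrier_mat ?n ?n" by (rule gram_carrier)
    \<comment> \<open>A vector in the radical would give a kernel vector of the Gram matrix.\<close>
    have "?G *\<^sub>v ?v = 0\<^sub>v ?n"
    proof (rule eq_vecI)
      fix i assume "i < dim_vec (0\<^sub>v ?n :: 'p mod_ring vec)"
      then have i: "i < ?n" by simp
      then have xi: "x' ! i \<in> ?L" using basis_mod_set[OF L] nth_mem by blast
      have "\<beta> (x' ! i) x = (\<Sum>j<?n. c j * \<beta> (x' ! i) (x' ! j))"
        unfolding c by (rule functional_lin_comb[OF subspace_UNIV bilinear_form_right[OF bilinear_form_\<beta>]]) simp
      moreover have "\<beta> (x' ! i) x = 0" using z[OF xi] \<beta>_sym[of x "x' ! i"] x xi LX by auto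
      ultimately show "(?G *\<^sub>v ?v) $ i = 0\<^sub>v ?n $ i"
        using i by (simp add: gram_def scalar_prod_def lessThan_atLeast0 mult.commute)
    qed (simp add: gram_def)
    then have "?v = 0\<^sub>v ?n"
      using det_0_iff_vec_prod_zero_field[OF G] D by (metis vec_carrier)
    then have "c j = 0" if "j < ?n" for j using that by (metis index_vec index_zero_vec(1))
    then have "x = lin_comb x' (\<lambda>_. 0)" unfolding c by (rule lin_comb_cong)
    then show "x = 0" by (simp add: lin_comb_zero)
  qed
  finally show ?thesis by simp
qed

text \<open>If the orientation has value \<delta> in the basis (j0, j1, m'), then its image has
  value \<delta> in the transported basis of gM, while in the basis (i, m) of \<open>M\<close> the
  orientation has value C \<delta>. The argument of the symbol is thus \<open>C\<close> times the
  Gram determinant, up to squares.\<close>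

lemma A_coeff_eq:
  assumes oM: "oM \<in> top_ext M {0}" "oM \<noteq> top_rel M {0}"
    and nz: "C \<noteq> 0"
  shows "A_coeff (M, oM) (act_orient g (M, oM)) = (gauss (1 / 2) / of_nat CARD('p)) ^ length m' *
    of_int (legendre (C * det (gram \<omega> (map g m') m)))"
proof -
  let ?I = "M \<inter> g ` M" and ?n = "length m'"
  let ?W = "det (gram \<omega> (map g m') m)"
  \<comment> \<open>This basis of the intersection serves both sides: it begins the transported
    basis of gM and, since \<open>g\<close> fixes \<open>j0\<close>, also the basis (j0, g j1, m) of
    \<open>M\<close>.\<close>
  define i where "i = map g (j0 @ j1)"
  have J_basis: "basis_mod {0} (j0 @ j1) J" by (rule basis_mod_append[OF j0 j1])
  have g0: "g ` {0} = {0}" by (simp add: g.zero)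
  have iI: "basis_mod {0} i ?I"
    unfolding i_def M_Int_gM using basis_mod_image[OF g_linear inj_g J_basis] by (simp add: g0)
  have mI: "basis_mod ?I m M" unfolding M_Int_gM by (rule m)
  have gm': "basis_mod ?I (map g m') (g ` M)"
    unfolding M_Int_gM by (rule basis_mod_image[OF g_linear inj_g m'])
  have e: "basis_mod {0} ((j0 @ j1) @ m') M" by (rule basis_mod_append[OF J_basis m'])
  have ge: "basis_mod {0} (map g ((j0 @ j1) @ m')) (g ` M)"
    using basis_mod_image[OF g_linear inj_g e] by (simp add: g0)
  have n: "(dim (perp ?I) - dim ?I) div 2 = ?n"
  proof -
    have I: "subspace ?I" by (rule subspace_inter[OF subspace_M subspace_gM])
    obtain p where p: "basis_mod {0} p (perp ?I)"
      using basis_exists[OF subspace_single_0 subspace_perp] subspace_0[OF subspace_perp] by blast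
    have "CARD('p) ^ (length i + length p) = CARD('p) ^ (2 * (length j0 + length j1 + length m'))"
      using card_perp[OF I] card_basis_mod[OF iI] card_basis_mod[OF p] lengths(5) by (simp add: power_add)
    then have "length i + length p = 2 * (length j0 + length j1 + length m')"
      using CARD_gt_1 power_inject_exp by blast
    then have "length p - length i = 2 * ?n" by (simp add: i_def)
    then show ?thesis using dim_basis_mod[OF p] dim_basis_mod[OF iI] by simp
  qed
  define oL where "oL = ext_map g oM"
  obtain iM oMI where dM: "top_decomp M ?I oM = (iM, oMI)" by force
  obtain iL oLI where dL: "top_decomp (g ` M) ?I oL = (iL, oLI)" by force
  define \<delta> where "\<delta> = ext_val {0} ((j0 @ j1) @ m') oM"
  have oM': "oM \<in> ext_power (length ((j0 @ j1) @ m')) M {0}"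
    using oM top_deg_zero[OF e] by (simp add: top_ext_def)
  have \<delta>: "\<delta> \<noteq> 0"
    unfolding \<delta>_def using ext_val_nonzero[OF e oM'] oM(2) top_deg_zero[OF e] by (simp add: top_rel_def)
  note oL = ext_map_eq[OF g_linear bij_g e oM(1), folded oL_def \<delta>_def]
  note tM = top_decomp_eq[OF iI mI oM(1) dM] and tL = top_decomp_eq[OF iI gm' oL(1) dL]
  have i_eq: "i = j0 @ map g j1" by (simp add: i_def gj0)
  have vM: "ext_val {0} i iM * ext_val ?I m oMI = C * \<delta>"
  proof -
    have "ext_val {0} (i @ m) oM = coord_det {0} (i @ m) ((j0 @ j1) @ m') * \<delta>"
      unfolding \<delta>_def
      by (rule ext_val_change[OF e basis_mod_append[OF iI mI] _ oM']) (simp add: lengths i_def)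
    then show ?thesis using tM(3) by (simp add: C_def i_eq)
  qed
  have vL: "ext_val {0} i iL * ext_val ?I (map g m') oLI = \<delta>"
    using tL(3) oL(2) by (simp add: i_def)
  have iM0: "ext_val {0} i iM \<noteq> 0" using vM nz \<delta> by auto
  have ratio: "top_ratio ?I iL iM = ext_val {0} i iL / ext_val {0} i iM"
    by (rule top_ratio_eq[OF iI tL(1) tM(1) iM0])
  have wedge: "omega_wedge ?n oLI oMI = ext_val ?I (map g m') oLI * ext_val ?I m oMI *
      ((- 1) ^ (?n choose 2) * ?W)"
  proof (rule omega_wedge_eq[OF gm' mI])
    fix x y assume "x \<in> g ` M" "y \<in> ?I"
    then show "\<omega> x y = 0" using \<omega>_M by (auto simp: g_\<omega>)
  next
    fix x y assume "x \<in> ?I" "y \<in> M"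
    then show "\<omega> x y = 0" using \<omega>_M by auto
  next
    show "oLI \<in> ext_power ?n (g ` M) ?I" using tL(2) top_deg_eq[OF iI gm'] by (simp add: top_ext_def)
    show "oMI \<in> ext_power ?n M ?I" using tM(2) top_deg_eq[OF iI mI] by (simp add: top_ext_def lengths)
  qed (simp_all add: lengths)
  let ?arg = "(- 1) ^ (?n choose 2) * top_ratio ?I iL iM * omega_wedge ?n oLI oMI"
  \<comment> \<open>The square clears the denominator of the ratio and supplies the missing factor
    for the product of values of \<open>oM\<close>; the two equal signs cancel.\<close>
  have "ext_val {0} i iM ^ 2 * ?arg = ((- 1) ^ (?n choose 2) * (- 1) ^ (?n choose 2)) *
      ((ext_val {0} i iL * ext_val ?I (map g m') oLI) * (ext_val {0} i iM * ext_val ?I m oMI)) * ?W"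
    unfolding ratio wedge using iM0 by (simp add: power2_eq_square field_simps)
  also have "\<dots> = \<delta> ^ 2 * (C * ?W)"
    unfolding vM vL by (simp add: power2_eq_square power_mult_distrib[symmetric])
  finally have "legendre (ext_val {0} i iM ^ 2 * ?arg) = legendre (\<delta> ^ 2 * (C * ?W))" by simp
  then have leg: "legendre ?arg = legendre (C * ?W)"
    unfolding legendre_mult_square[OF odd_card iM0] legendre_mult_square[OF odd_card \<delta>] .
  have "A_coeff (M, oM) (g ` M, oL) = (gauss (1 / 2) / of_nat CARD('p)) ^ ?n * of_int (legendre ?arg)"
    unfolding A_coeff_def prod.case Let_def dM dL n ..
  then show ?thesis unfolding leg by (simp add: act_orient_def oL_def)
qed

text \<open>What remains is bookkeeping of exponents: the Gauss sums pair up to f factors (-1 / l)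
  l, the sign exponent is f + |j1| = e, and the powers of l leave exactly c.\<close>

lemma weil_trace_bases:
  assumes oM: "oM \<in> top_ext M {0}" "oM \<noteq> top_rel M {0}"
    and E: "coord_det {0} u (map d u) \<noteq> 0" and len: "length v1 = 2 * c" "length u = 2 * e"
  shows "weil_trace (M, oM) g =
    of_int (legendre ((- 1) ^ e * coord_det {0} u (map d u))) * of_nat CARD('p) ^ c"
proof -
  let ?E = "coord_det {0} u (map d u)"
  let ?G = "gauss (1 / 2)" and ?q = "of_nat CARD('p) :: complex" and ?n = "length m'"
  let ?l = "of_int (legendre (- 1 :: 'p mod_ring)) :: complex"
  let ?k = "length j0 + length j1"
  note rel = det_relation[OF E]
  have q: "?q \<noteq> 0" using CARD_gt_1 by simp
  have J: "of_nat (card J) = ?q ^ ?k"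
    using card_basis_mod[OF basis_mod_append[OF j0 j1]] by simp
  have ll: "?l * ?l = 1" using legendre_squared[of "- 1 :: 'p mod_ring"] by (simp flip: of_int_mult)
  have l2: "length v1 + length x' = ?n + 2 * length j0" and l4: "c + e = ?k + ?n"
    using lengths len by auto
  have ce: "c \<le> ?n + length j0" using l2 len by simp
  \<comment> \<open>Half the total number of Gauss sums, those of the coefficient and those of the
    sum over \<open>X\<close>.\<close>
  obtain f where f: "?n + length j0 = c + f" using ce le_Suc_ex by blast
  have nr: "?n + length x' = 2 * f" using l2 len f by simp
  have parity: "?l ^ f * ?l ^ length j1 = ?l ^ e"
  proof -
    have "f + length j1 = e" using f l4 by simp
    then show ?thesis by (simp flip: power_add)
  qed
  have "weil_trace (M, oM) g = (?G / ?q) ^ ?n * of_int (legendre (C * det (gram \<omega> (map g m') m))) / ?q ^ ?k *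
      (?q ^ (length v1 + length j1) * (?G ^ length x' * of_int (legendre (det (gram \<beta> x' x')))))"
    unfolding weil_trace_gauss A_coeff_eq[OF oM rel(4)] sum_X[OF rel(2)] J ..
  also have "\<dots> = of_int (legendre (C * det (gram \<omega> (map g m') m)) * legendre (det (gram \<beta> x' x'))) *
      (?G ^ (?n + length x') * ?q ^ (2 * c + length j1) / ?q ^ (?n + ?k))"
    by (simp add: power_add power_divide len)
  also have "?G ^ (?n + length x') = ?l ^ f * ?q ^ f"
    unfolding nr power_mult gauss_half_squared by (simp add: power_mult_distrib)
  also have "?l ^ f * ?q ^ f * ?q ^ (2 * c + length j1) / ?q ^ (?n + ?k) = ?l ^ f * ?q ^ c"
  proof -
    have "f + (2 * c + length j1) = (?n + ?k) + c" using f by simp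
    then have "?q ^ f * ?q ^ (2 * c + length j1) = ?q ^ (?n + ?k) * ?q ^ c"
      by (simp only: power_add[symmetric])
    then show ?thesis using q by (simp add: mult.assoc)
  qed
  also have "of_int (legendre (C * det (gram \<omega> (map g m') m)) * legendre (det (gram \<beta> x' x'))) =
      ?l ^ length j1 * of_int (legendre ?E)"
    unfolding rel(1) by (simp add: legendre_mult[OF odd_card] legendre_power[OF odd_card])
  also have "?l ^ length j1 * of_int (legendre ?E) * (?l ^ f * ?q ^ c) =
      (?l ^ f * ?l ^ length j1) * of_int (legendre ?E) * ?q ^ c" by (simp add: ac_simps)
  also have "\<dots> = of_int (legendre ((- 1) ^ e * ?E)) * ?q ^ c"
    unfolding parity by (simp add: legendre_mult[OF odd_card] legendre_power[OF odd_card])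
  finally show ?thesis .
qed

end

section \<open>The characteristic polynomial\<close>

lemma char_poly_four_block_mat_upper_right_zero:
  fixes A :: "'a :: idom mat"
  assumes A: "A \<in> carrier_mat n n" and C: "C \<in> carrier_mat m n" and D: "D \<in> carrier_mat m m"
  shows "char_poly (four_block_mat A (0\<^sub>m n m) C D) = char_poly A * char_poly D"
proof -
  have "char_poly_matrix (four_block_mat A (0\<^sub>m n m) C D) =
      four_block_mat (char_poly_matrix A) (0\<^sub>m n m) (map_mat (\<lambda>a. [:- a:]) C) (char_poly_matrix D)"
    using A C D by (intro eq_matI) (auto simp: char_poly_matrix_def)
  then show ?thesis
    unfolding char_poly_def using A C D
    by (simp add: det_four_block_mat_upper_right_zero[of _ n _ m])
qed

lemma char_poly_scalar_mat:
  "char_poly (c \<cdot>\<^sub>m 1\<^sub>m n :: 'a :: comm_ring_1 mat) = [:- c, 1:] ^ n"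
proof -
  have "upper_triangular (c \<cdot>\<^sub>m 1\<^sub>m n)" by (auto simp: upper_triangular_def)
  from char_poly_upper_triangular[OF _ this, of n]
  have "char_poly (c \<cdot>\<^sub>m 1\<^sub>m n) = (\<Prod>a\<leftarrow>diag_mat (c \<cdot>\<^sub>m 1\<^sub>m n). [:- a, 1:])" by simp
  also have "diag_mat (c \<cdot>\<^sub>m 1\<^sub>m n) = replicate n c"
    by (intro nth_equalityI) (auto simp: diag_mat_def)
  finally show ?thesis by simp
qed

context linear_space
begin

text \<open>The characteristic polynomial of the endomorphism induced on W/K. Images are rows here,
  so for K = {0} this is the transpose of the matrix in \<open>endo_mat\<close>.\<close>

definition cp :: "'b set \<Rightarrow> 'b list \<Rightarrow> ('b \<Rightarrow> 'b) \<Rightarrow> 'a poly" where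
  "cp K bs T = char_poly (coord_mat K bs (map T bs))"

lemma coord_mat_carrier: "coord_mat K bs (map T bs) \<in> carrier_mat (length bs) (length bs)"
  by (simp add: coord_mat_def)

lemma cp_append:
  assumes B: "basis_mod K bs W" and C: "basis_mod W cs Z" and T: "T ` W \<subseteq> W" "T ` Z \<subseteq> Z"
  shows "cp K (bs @ cs) T = cp K bs T * cp W cs T"
proof -
  have "set (map T bs) \<subseteq> W" "set (map T cs) \<subseteq> Z"
    using T basis_mod_set[OF B] basis_mod_set[OF C] by (auto simp: image_subset_iff)
  from coord_mat_append[OF B C this] obtain A where
    A: "A \<in> carrier_mat (length cs) (length bs)" "coord_mat K (bs @ cs) (map T (bs @ cs)) =
      four_block_mat (coord_mat K bs (map T bs)) (0\<^sub>m (length bs) (length cs)) A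
        (coord_mat W cs (map T cs))" by auto
  show ?thesis
    unfolding cp_def A(2)
    by (rule char_poly_four_block_mat_upper_right_zero[OF coord_mat_carrier A(1) coord_mat_carrier])
qed

lemma cp_scalar:
  assumes B: "basis_mod K bs W" and T: "\<And>x. x \<in> W \<Longrightarrow> T x = scale c x"
  shows "cp K bs T = [:- c, 1:] ^ length bs"
proof -
  have "coord_mat K bs (map T bs) = c \<cdot>\<^sub>m 1\<^sub>m (length bs)"
  proof (intro eq_matI)
    fix i j assume "i < dim_row (c \<cdot>\<^sub>m 1\<^sub>m (length bs))" "j < dim_col (c \<cdot>\<^sub>m 1\<^sub>m (length bs))"
    then have ij: "i < length bs" "j < length bs" by simp_all
    have "bs ! i \<in> W" using basis_mod_set[OF B] nth_mem[OF ij(1)] by blast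
    then show "coord_mat K bs (map T bs) $$ (i, j) = (c \<cdot>\<^sub>m 1\<^sub>m (length bs)) $$ (i, j)"
      using ij T coord_scale[OF B _ ij(2)] coord_basis[OF B ij] by (simp add: coord_mat_def)
  qed (simp_all add: coord_mat_def)
  then show ?thesis by (simp add: cp_def char_poly_scalar_mat)
qed

text \<open>Needed because \<open>endo_char_poly\<close> uses an unspecified basis. The two
  coordinate matrices are inverse to each other and conjugate one matrix into the other.\<close>

lemma cp_change_basis:
  assumes B: "basis_mod {0} bs W" and C: "basis_mod {0} cs W" and len: "length bs = length cs"
    and T: "Vector_Spaces.linear scale scale T" "T ` W \<subseteq> W"
  shows "cp {0} bs T = cp {0} cs T"
proof -
  interpret T: Vector_Spaces.linear scale scale T by fact
  let ?P = "coord_mat {0} cs bs" and ?Q = "coord_mat {0} bs cs"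
  let ?A = "coord_mat {0} bs (map T bs)" and ?B = "coord_mat {0} cs (map T cs)" and ?n = "length cs"
  have trans: "coord_mat {0} as xs = coord_mat {0} ds xs * coord_mat {0} as ds"
    if "basis_mod {0} as W" "basis_mod {0} ds W" "set xs \<subseteq> W" for as ds xs
    unfolding coord_mat_gram[of "{0}" as]
    by (rule gram_change_left[OF that(2)])
      (use that functional_on_coord[OF that(1)] coord_zero[OF that(1)] in auto)
  have one: "coord_mat {0} as as = 1\<^sub>m (length as)" if "basis_mod {0} as W" for as
    by (intro eq_matI) (auto simp: coord_mat_def coord_basis[OF that])
  have "?A = ?P * coord_mat {0} bs (map T cs)"
  proof -
    have e: "coord_mat {0} bs (map T xs) = gram (\<lambda>x j. coord {0} bs (T x) j) xs [0..<length bs]" for xs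
      by (intro eq_matI) (auto simp: coord_mat_def gram_def)
    show ?thesis unfolding e
    proof (rule gram_change_left[OF C])
      fix j assume "j \<in> set [0..<length bs]"
      then have j: "j < length bs" by simp
      show "functional_on W (\<lambda>x. coord {0} bs (T x) j)"
        using functional_on_coord[OF B j] T(2) by (auto simp: functional_on_def T.add T.scale image_subset_iff)
      show "coord {0} bs (T x) j = 0" if "x \<in> {0}" for x
        using that coord_zero[OF B _ j] by (simp add: T.zero)
    qed (rule basis_mod_set[OF B])
  qed
  also have "coord_mat {0} bs (map T cs) = ?B * ?Q"
    by (rule trans[OF B C]) (use T basis_mod_set[OF C] in auto)
  also have "?P * (?B * ?Q) = ?P * ?B * ?Q"
    by (rule assoc_mult_mat[symmetric, of _ ?n ?n _ ?n _ ?n]) (simp_all add: coord_mat_def len)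
  finally have A: "?A = ?P * ?B * ?Q" .
  have PQ: "?P * ?Q = 1\<^sub>m ?n" "?Q * ?P = 1\<^sub>m ?n"
    using trans[OF B C basis_mod_set[OF B]] trans[OF C B basis_mod_set[OF C]] one[OF B] one[OF C] len
    by simp_all
  have "{?A, ?B, ?P, ?Q} \<subseteq> carrier_mat ?n ?n" by (simp add: coord_mat_def len)
  then have "similar_mat ?A ?B" using PQ A by (rule similar_matI)
  then show ?thesis unfolding cp_def by (rule char_poly_similar)
qed

lemma endo_char_poly_eq_cp:
  assumes B: "basis_mod {0} bs W" and T: "Vector_Spaces.linear scale scale T" "T ` W \<subseteq> W"
  shows "endo_char_poly W T = cp {0} bs T"
proof -
  have "ordered_basis W bs" using B by (simp add: ordered_basis_iff)
  then have "ordered_basis W (SOME bs. ordered_basis W bs)" by (rule someI[of "ordered_basis W"])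
  then obtain cs where cs: "basis_mod {0} cs W" "cs = (SOME bs. ordered_basis W bs)"
    by (simp add: ordered_basis_iff)
  have "T (cs ! j) \<in> W" if "j < length cs" for j
    using T(2) basis_mod_set[OF cs(1)] nth_mem[OF that] by auto
  then have "endo_mat cs T = transpose_mat (coord_mat {0} cs (map T cs))"
    by (intro eq_matI) (auto simp: endo_mat_def coord_mat_def representation_eq_coord[OF cs(1)])
  then have "endo_char_poly W T = cp {0} cs T"
    unfolding endo_char_poly_def cs(2)[symmetric] cp_def
    by (simp only: char_poly_transpose_mat[OF coord_mat_carrier])
  moreover have "length cs = length bs" using dim_basis_mod[OF cs(1)] dim_basis_mod[OF B] by simp
  ultimately show ?thesis using cp_change_basis[OF cs(1) B _ T] by simp
qed

text \<open>An eigenvector of the map induced on W/K, expressed by a representative. It is read off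
  the transposed matrix, since the coefficient vector multiplies the rows.\<close>

lemma cp_root:
  assumes B: "basis_mod K bs W" and T: "Vector_Spaces.linear scale scale T" "T ` K \<subseteq> K" "T ` W \<subseteq> W"
    and root: "poly (cp K bs T) c = 0"
  obtains x where "x \<in> W" "x \<notin> K" "T x - scale c x \<in> K"
proof -
  interpret T: Vector_Spaces.linear scale scale T by fact
  let ?A = "coord_mat K bs (map T bs)" and ?n = "length bs"
  note A = coord_mat_carrier[of K bs T]
  have At: "transpose_mat ?A \<in> carrier_mat ?n ?n" using A by simp
  have "eigenvalue (transpose_mat ?A) c"
    unfolding eigenvalue_root_char_poly[OF At] char_poly_transpose_mat[OF A]
    using root by (simp add: cp_def)
  then obtain v where v: "v \<in> carrier_vec ?n" "v \<noteq> 0\<^sub>v ?n" "transpose_mat ?A *\<^sub>v v = c \<cdot>\<^sub>v v"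
    using A unfolding eigenvalue_def eigenvector_def by auto
  define x where "x = lin_comb bs (\<lambda>i. v $ i)"
  have K: "subspace K" by (rule basis_mod_subspace[OF B])
  note W = basis_mod_subspace'[OF B]
  have xW: "x \<in> W" unfolding x_def by (rule basis_mod_lin_comb[OF B])
  have "x \<notin> K"
  proof
    assume "x \<in> K"
    then have "v $ i = 0" if "i < ?n" for i using basis_modD[OF B _ that] by (simp add: x_def)
    then show False using v(1,2) by (auto intro: eq_vecI)
  qed
  have "coord K bs (T x) j = c * v $ j" if j: "j < ?n" for j
  proof -
    have "functional_on W (\<lambda>x. coord K bs (T x) j)"
      using functional_on_coord[OF B j] T(3) by (auto simp: functional_on_def T.add T.scale image_subset_iff)
    from functional_lin_comb[OF W this basis_mod_set[OF B], of "\<lambda>i. v $ i"]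
    have "coord K bs (T x) j = (\<Sum>i<?n. v $ i * coord K bs (T (bs ! i)) j)" by (simp add: x_def)
    also have "\<dots> = (transpose_mat ?A *\<^sub>v v) $ j"
      using v(1) j by (simp add: coord_mat_def scalar_prod_def lessThan_atLeast0 mult.commute)
    finally show ?thesis using v(1,3) j by simp
  qed
  then have "lin_comb bs (coord K bs (T x)) = scale c x"
    unfolding x_def lin_comb_scale[symmetric] by (intro lin_comb_cong) simp
  moreover have "T x \<in> W" using T(3) xW by blast
  ultimately have "T x - scale c x \<in> K" using coord_ex[OF B] by metis
  then show thesis using that xW \<open>x \<notin> K\<close> by blast
qed

end

lemma legendre_even_power:
  fixes x s :: "'p::prime_card mod_ring"
  assumes "odd CARD('p)" "s \<noteq> 0" "even n" shows "legendre (s ^ n * x) = legendre x"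
proof -
  obtain k where "n = 2 * k" using \<open>even n\<close> by blast
  then have "s ^ n = (s ^ k) ^ 2" by (simp add: power_mult mult.commute flip: power_mult)
  then show ?thesis using legendre_mult_square[OF assms(1), of "s ^ k" x] assms(2) by simp
qed

section \<open>The eigenvalues 1 and -1\<close>

context weil_element
begin

definition Vm :: "'v set" where "Vm = {v. g v = - v}"

text \<open>The \<open>-1\<close>-eigenspace of \<open>g\<close> is the fixed space of \<open>-g\<close>, so the results on \<open>V1\<close> carry over to it.\<close>

lemma weil_element_neg: "weil_element scale \<omega> \<zeta> (\<lambda>x. - g x) M"
proof
  have lin: "Vector_Spaces.linear scale scale (\<lambda>x. - g x)"
    unfolding Vector_Spaces.linear_def module_hom_def module_hom_axioms_def
    using vector_space_axioms module_axioms by (auto simp: g.add g.scale)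
  moreover have "bij (\<lambda>x. - g x)"
    by (rule bij_betw_byWitness[where f' = "\<lambda>y. inv_into UNIV g (- y)"]) (auto simp: inv_g)
  ultimately show "(\<lambda>x. - g x) \<in> Sp" by (auto simp: Sp_def \<omega>_simps g_\<omega>)
  show "semisimple_endo (\<lambda>x. - g x)"
  proof -
    have "(\<lambda>x. - g x) ` A \<subseteq> A \<longleftrightarrow> g ` A \<subseteq> A" if "subspace A" for A
      using subspace_neg[OF that] by (force simp: image_subset_iff)
    then show ?thesis using g_semisimple unfolding semisimple_endo_def by metis
  qed
  show "lagrangian M" by (rule lagrangian_M)
qed

lemma subspace_Vm: "subspace Vm"
  by (rule subspaceI) (auto simp: Vm_def g.zero g.add g.scale)

lemma d_Vm: assumes "x \<in> Vm" shows "d x = - scale 2 x"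
proof -
  have "scale 2 x = x + x" using scale_left_distrib[of 1 1 x] by simp
  then show ?thesis using assms by (simp add: d_def Vm_def)
qed

text \<open>On \<open>Vm\<close> the map \<open>d\<close> is multiplication by -2, which is
  invertible in odd characteristic; this gives the preimage -x/2.\<close>

lemma Vm_U: "Vm \<subseteq> U"
proof
  fix x assume x: "x \<in> Vm"
  have "d (scale (- (1 / 2)) x) = scale (- (1 / 2)) (- (scale 2 x))"
    unfolding d.scale d_Vm[OF x] ..
  also have "\<dots> = x" using two_nonzero by simp
  finally show "x \<in> U" unfolding U_def by (metis rangeI)
qed

lemma even_Vm: assumes "basis_mod {0} vm Vm" shows "even (length vm)"
proof -
  interpret neg: weil_element scale \<omega> \<zeta> "\<lambda>x. - g x" M by (rule weil_element_neg)
  have "neg.V1 = Vm" by (auto simp: neg.V1_def Vm_def minus_equation_iff)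
  then show ?thesis using symplectic_subspace_det[OF assms] neg.nondegenerate_V1 by simp
qed

text \<open>It says that -1 is no eigenvalue on V/Vm. For -g in place of \<open>g\<close>, the
  vector -(g x + x) lies both in the fixed space and in the image of -g - 1, and these meet in
  0.\<close>

lemma Vm_isolated: assumes "g x + x \<in> Vm" shows "x \<in> Vm"
proof -
  interpret neg: weil_element scale \<omega> \<zeta> "\<lambda>x. - g x" M by (rule weil_element_neg)
  have V: "neg.V1 = Vm" by (auto simp: neg.V1_def Vm_def minus_equation_iff)
  have m: "neg.d x = - (g x + x)" by (simp add: neg.d_def)
  then have "neg.d x \<in> neg.V1" using subspace_neg[OF subspace_Vm assms] by (simp only: V)
  moreover have "neg.d x \<in> neg.U" by (simp add: neg.U_def)
  ultimately have "neg.d x \<in> neg.V1 \<inter> neg.U" by blast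
  then have "neg.d x = 0" using neg.V1_U by simp
  then have "g x + x = 0" unfolding m by (simp only: neg_equal_0_iff_equal)
  then show ?thesis by (simp add: Vm_def eq_neg_iff_add_eq_0)
qed

text \<open>It says that 1 is no eigenvalue on U/Vm. The vector y = -(d x)/2 of \<open>Vm\<close>
  has d y = d x, so x - y lies in both \<open>V1\<close> and \<open>U\<close>.\<close>

lemma V1_isolated: assumes x: "x \<in> U" "d x \<in> Vm" shows "x \<in> Vm"
proof -
  let ?y = "scale (- (1 / 2)) (d x)"
  have yV: "?y \<in> Vm" using subspace_scale[OF subspace_Vm x(2)] .
  have "d ?y = scale (- (1 / 2)) (- (scale 2 (d x)))"
    unfolding d.scale d_Vm[OF x(2)] ..
  also have "\<dots> = d x" using two_nonzero by simp
  finally have "d ?y = d x" .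
  then have "d (x - ?y) = 0" unfolding d.diff by simp
  then have "x - ?y \<in> V1" by (simp add: V1_def d_def)
  moreover have "x - ?y \<in> U" using x(1) yV Vm_U subspace_diff[OF subspaces(2)] by blast
  ultimately have "x - ?y = 0" using V1_U by blast
  then have "x = ?y" by (rule eq_iff_diff_eq_0[THEN iffD2])
  then show ?thesis using yV by (rule ssubst)
qed

lemma invariant: "g ` V1 \<subseteq> V1" "g ` Vm \<subseteq> Vm" "g ` U \<subseteq> U"
proof -
  show "g ` V1 \<subseteq> V1" "g ` Vm \<subseteq> Vm" by (auto simp: V1_def Vm_def g.neg)
  have "g (d x) = d (g x)" for x by (simp add: d_def g.diff)
  then show "g ` U \<subseteq> U" by (auto simp: U_def)
qed

text \<open>The flag 0, V1, V1 + Vm, V is invariant, and the last quotient, taken as U/Vm, has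
  neither eigenvalue. Working in the quotient avoids choosing an invariant complement of
  \<open>Vm\<close> in \<open>U\<close>.\<close>

lemma char_poly_factorization:
  assumes v1: "basis_mod {0} v1 V1" and vm: "basis_mod {0} vm Vm" and w: "basis_mod Vm w U"
  shows "endo_char_poly UNIV g = [:- 1, 1:] ^ length v1 * [:1, 1:] ^ length vm * cp Vm w g"
    and "poly (cp {0} (vm @ w) g) 1 = 2 ^ length vm * poly (cp Vm w g) 1"
    and "poly (cp Vm w g) 1 \<noteq> 0" "poly (cp Vm w g) (- 1) \<noteq> 0" "degree (cp Vm w g) = length w"
proof -
  have U: "basis_mod {0} (vm @ w) U" by (rule basis_mod_append[OF vm w])
  have V: "basis_mod V1 (vm @ w) UNIV"
    using basis_mod_sum[OF U subspaces(1)] V1_U V1_plus_U by (simp add: Int_commute)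
  have "cp V1 (vm @ w) g = cp {0} (vm @ w) g"
    unfolding cp_def
    by (subst coord_mat_restrict[OF U V])
      (use invariant basis_mod_set[OF U] subspace_0[OF subspaces(1)] in \<open>auto simp: image_subset_iff\<close>)
  moreover have cpU: "cp {0} (vm @ w) g = [:1, 1:] ^ length vm * cp Vm w g"
    using cp_append[OF vm w invariant(2,3)] cp_scalar[OF vm, of g "- 1"] by (simp add: Vm_def)
  moreover have "cp {0} (v1 @ (vm @ w)) g = cp {0} v1 g * cp V1 (vm @ w) g"
    by (rule cp_append[OF v1 V invariant(1)]) simp
  moreover have "cp {0} v1 g = [:- 1, 1:] ^ length v1"
    using cp_scalar[OF v1, of g 1] by (simp add: V1_def)
  ultimately show "endo_char_poly UNIV g = [:- 1, 1:] ^ length v1 * [:1, 1:] ^ length vm * cp Vm w g"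
    using endo_char_poly_eq_cp[OF basis_mod_append[OF v1 V] g_linear] by (simp add: mult.assoc)
  show "poly (cp {0} (vm @ w) g) 1 = 2 ^ length vm * poly (cp Vm w g) 1"
    unfolding cpU by simp
  show "poly (cp Vm w g) 1 \<noteq> 0"
  proof
    assume "poly (cp Vm w g) 1 = 0"
    then obtain x where "x \<in> U" "x \<notin> Vm" "g x - scale 1 x \<in> Vm"
      by (rule cp_root[OF w g_linear invariant(2,3)])
    then show False using V1_isolated[of x] by (simp add: d_def)
  qed
  show "poly (cp Vm w g) (- 1) \<noteq> 0"
  proof
    assume "poly (cp Vm w g) (- 1) = 0"
    then obtain x where "x \<in> U" "x \<notin> Vm" "g x - scale (- 1) x \<in> Vm"
      by (rule cp_root[OF w g_linear invariant(2,3)])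
    then show False using Vm_isolated[of x] by simp
  qed
  show "degree (cp Vm w g) = length w"
    unfolding cp_def using degree_monic_char_poly[OF coord_mat_carrier] by blast
qed

text \<open>The characteristic polynomial at 1 is det (1 - g), whereas \<open>d\<close> is g -
  1.\<close>

lemma coord_det_d:
  assumes u: "basis_mod {0} u U"
  shows "coord_det {0} u (map d u) = (- 1) ^ length u * poly (cp {0} u g) 1"
proof -
  let ?A = "coord_mat {0} u (map g u)" and ?n = "length u"
  note A = coord_mat_carrier[of "{0}" u g]
  have "coord_mat {0} u (map d u) = (- 1) \<cdot>\<^sub>m (- char_matrix ?A 1)"
  proof (intro eq_matI)
    fix i j assume "i < dim_row ((- 1) \<cdot>\<^sub>m (- char_matrix ?A 1))" "j < dim_col ((- 1) \<cdot>\<^sub>m (- char_matrix ?A 1))"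
    then have ij: "i < ?n" "j < ?n" by (simp_all add: char_matrix_def coord_mat_def)
    have ui: "u ! i \<in> U" "g (u ! i) \<in> U"
      using basis_mod_set[OF u] nth_mem[OF ij(1)] invariant(3) by auto
    have "d (u ! i) + u ! i = g (u ! i)" by (simp add: d_def)
    moreover have "d (u ! i) \<in> U" by (simp add: U_def)
    ultimately have "coord {0} u (d (u ! i)) j = coord {0} u (g (u ! i)) j - coord {0} u (u ! i) j"
      using coord_add[OF u _ ui(1) ij(2), of "d (u ! i)"] by simp
    then show "coord_mat {0} u (map d u) $$ (i, j) = ((- 1) \<cdot>\<^sub>m (- char_matrix ?A 1)) $$ (i, j)"
      using ij coord_basis[OF u ij] by (simp add: char_matrix_def coord_mat_def)
  qed (simp_all add: char_matrix_def coord_mat_def)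
  then show ?thesis
    unfolding coord_det_def cp_def char_poly_matrix[OF A]
    by (simp add: char_matrix_def coord_mat_def)
qed

end

section \<open>The trace formula\<close>

theorem theorem4p15:
  fixes scale :: "'p::prime_card mod_ring \<Rightarrow> 'v::ab_group_add \<Rightarrow> 'v"
    and \<omega> :: "'v \<Rightarrow> 'v \<Rightarrow> 'p mod_ring"
    and \<zeta> :: complex
    and g :: "'v \<Rightarrow> 'v"
    and f fbar :: "'p mod_ring poly"
    and a b n :: nat
    and Mo :: "'v set \<times> ('p mod_ring, 'v) ext"
  assumes setting: "weil_setting scale \<omega> \<zeta>"
    and g_Sp: "g \<in> symplectic_space.Sp scale \<omega>"
    and g_semisimple: "linear_space.semisimple_endo scale g"
    and f_def: "f = linear_space.endo_char_poly scale UNIV g"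
    and f_factor: "f = [:1, 1:] ^ a * [:- 1, 1:] ^ b * fbar"
    and fbar_minus: "\<not> [:1, 1:] dvd fbar"
    and fbar_plus: "\<not> [:- 1, 1:] dvd fbar"
    and n_def: "n = vector_space.dim scale {v. g v = - v}"
    and orientation: "symplectic_space.oriented_lagrangian scale \<omega> Mo"
  shows "weil_setting.weil_trace scale \<omega> \<zeta> Mo g =
    of_int (legendre ((- 1) ^ (n div 2) * (- 1) ^ (degree fbar div 2) * poly fbar 1)) *
    complex_of_real (sqrt (real (card {v. g v = v})))"
proof -
  interpret weil_setting scale \<omega> \<zeta> by (rule setting)
  obtain M oM where Mo: "Mo = (M, oM)" by force
  have oM: "lagrangian M" "oM \<in> top_ext M {0}" "oM \<noteq> top_rel M {0}"
    using orientation by (auto simp: Mo oriented_lagrangian_def)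
  interpret weil_element scale \<omega> \<zeta> g M
    by unfold_locales (use g_Sp g_semisimple oM(1) in auto)
  have ex: "\<exists>bs. basis_mod K bs W" if "subspace K" "subspace W" "K \<subseteq> W" for K W
    using basis_exists[OF that] by blast
  have zero: "{0} \<subseteq> W" if "subspace W" for W using subspace_0[OF that] by simp
  note ex0 = ex[OF subspace_single_0 _ zero]
  have Q: "subspace {k + a |k a. k \<in> A \<and> a \<in> B}" if "subspace A" "subspace B" for A B
    using subspace_sums[OF that] by (simp add: conj_commute)
  obtain v1 vm w where v1: "basis_mod {0} v1 V1" and vm: "basis_mod {0} vm Vm" and w: "basis_mod Vm w U"
    using ex0[OF subspaces(1) subspaces(1)] ex0[OF subspace_Vm subspace_Vm]
      ex[OF subspace_Vm subspaces(2) Vm_U] by blast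
  define u where "u = vm @ w"
  have u: "basis_mod {0} u U" unfolding u_def by (rule basis_mod_append[OF vm w])
  have gJ: "subspace (g ` J)" "g ` J \<subseteq> M" by (rule g.subspace_image[OF subspaces(4)]) (auto simp: J_def)
  have Q1X: "{k + a |k a. k \<in> V1 \<and> a \<in> J} \<subseteq> X"
    using V1_X J_X subspace_add[OF subspaces(5)] by blast
  obtain j0 j1 m' m where j: "basis_mod {0} j0 M1" "basis_mod M1 j1 J" "basis_mod J m' M" "basis_mod (g ` J) m M"
    using ex0[OF subspaces(3) subspaces(3)] ex[OF subspaces(3,4) M1_J] ex[OF subspaces(4) subspace_M J_M]
      ex[OF gJ(1) subspace_M gJ(2)] by blast
  obtain x' where x': "basis_mod {k + a |k a. k \<in> V1 \<and> a \<in> J} x' X"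
    using ex[OF Q[OF subspaces(1,4)] subspaces(5) Q1X] by blast
  obtain r where r: "basis_mod {k + a |k a. k \<in> {k + a |k a. k \<in> V1 \<and> a \<in> M} \<and> a \<in> X} r UNIV"
    using ex[OF Q[OF Q[OF subspaces(1) subspace_M] subspaces(5)] subspace_UNIV] by blast
  interpret weil_bases scale \<omega> \<zeta> g M v1 u j0 j1 m' m x' r
    by unfold_locales (fact v1 u j x' r)+
  note cpf = char_poly_factorization[OF v1 vm w]
  let ?\<chi> = "cp Vm w g"
  have ev: "even (length v1)" "even (length u)" "even (length vm)"
    using symplectic_subspace_det[OF v1 nondegenerate_V1] symplectic_subspace_det[OF u nondegenerate_U]
      even_Vm[OF vm] by auto
  have evw: "even (length w)" using ev by (simp add: u_def)
  have fb: "poly fbar 1 \<noteq> 0" "poly fbar (- 1) \<noteq> 0"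
    using fbar_plus fbar_minus by (auto simp: poly_eq_0_iff_dvd)
  have feq: "[:1, 1:] ^ a * [:- 1, 1:] ^ b * fbar = [:- 1, 1:] ^ length v1 * [:1, 1:] ^ length vm * ?\<chi>"
    using f_factor cpf(1) f_def by simp
  \<comment> \<open>Comparing multiplicities of the roots 1 and -1 recovers \<open>b\<close> and
    \<open>a\<close>. The factor t + c does not vanish at c because 2 c is nonzero.\<close>
  have ord: "order c ([:- c, 1:] ^ i * [:c, 1:] ^ k * h) = i"
    if "c \<noteq> 0" "poly h c \<noteq> 0" for c :: "'p mod_ring" and i k and h :: "'p mod_ring poly"
  proof -
    have nz: "h \<noteq> 0" using that(2) by auto
    have "poly ([:c, 1:] ^ k) c = (2 * c) ^ k" by simp
    then have "order c ([:c, 1:] ^ k) = 0" using that(1) two_nonzero by (intro order_0I) simp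
    moreover have nz1: "[:- c, 1:] ^ i * [:c, 1:] ^ k * h \<noteq> 0"
      and nz2: "[:- c, 1:] ^ i * [:c, 1:] ^ k \<noteq> 0" using nz by simp_all
    ultimately show ?thesis
      unfolding order_mult[OF nz1] order_mult[OF nz2] order_power_n_n order_0I[OF that(2)] by simp
  qed
  have ab: "b = length v1" "a = length vm"
    using ord[of 1 fbar b a] ord[of 1 ?\<chi> "length v1" "length vm"]
      ord[of "- 1" fbar a b] ord[of "- 1" ?\<chi> "length vm" "length v1"] fb cpf(3,4) feq
    by (simp_all add: mult.commute mult.left_commute)
  then have fbar: "fbar = ?\<chi>" using feq by (simp add: mult.commute mult.left_commute)
  have n: "n = length vm" using dim_basis_mod[OF vm] by (simp add: n_def Vm_def)
  let ?E = "coord_det {0} u (map d u)" and ?c = "length v1 div 2" and ?e = "length u div 2"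
  \<comment> \<open>The sign in \<open>coord_det_d\<close> disappears because dim U is even.\<close>
  have E: "?E = 2 ^ length vm * poly ?\<chi> 1"
    using coord_det_d[OF u] cpf(2) ev(2) by (simp add: u_def)
  have E0: "?E \<noteq> 0" unfolding E using cpf(3) two_nonzero by simp
  have sign: "n div 2 + degree fbar div 2 = ?e"
    unfolding n fbar cpf(5) u_def using ev(3) evw by (elim evenE) simp
  have "weil_trace Mo g = of_int (legendre ((- 1) ^ ?e * ?E)) * of_nat CARD('p) ^ ?c"
    unfolding Mo by (rule weil_trace_bases[OF oM(2,3) E0]) (use ev in simp_all)
  also have "(- 1) ^ ?e * ?E = 2 ^ length vm * ((- 1) ^ ?e * poly ?\<chi> 1)"
    unfolding E by (simp only: mult.left_commute)
  \<comment> \<open>The -1-eigenspace has even dimension, so its power of 2 is a nonzero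
    square.\<close>
  also have "legendre (2 ^ length vm * ((- 1) ^ ?e * poly ?\<chi> 1)) = legendre ((- 1) ^ ?e * poly ?\<chi> 1)"
    by (rule legendre_even_power[OF odd_card two_nonzero ev(3)])
  also have "(- 1) ^ ?e * poly ?\<chi> 1 = (- 1) ^ (n div 2) * (- 1) ^ (degree fbar div 2) * poly fbar 1"
    by (simp only: sign[symmetric] power_add fbar)
  also have "of_nat CARD('p) ^ ?c = complex_of_real (sqrt (real (card {v. g v = v})))"
  proof -
    have "card {v. g v = v} = (CARD('p) ^ ?c) ^ 2"
      using card_basis_mod[OF v1] ev(1) by (simp add: V1_def power_mult[symmetric])
    then have "sqrt (real (card {v. g v = v})) = real CARD('p) ^ ?c" by simp
    then show ?thesis by simp
  qed
  finally show ?thesis .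
qed

end
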